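(* Let $K\ge 1$ and $B\ge 0$ be constants, and let $w$ be a $C^2$ $K$-quasiconformal mapping of the unit disk $\mathbb U$ onto itself satisfying $$|\Delta w(z)|\le B\,|\nabla w(z)|^2,\qquad z\in\mathbb U .$$ Then $w$ is bi-Lipschitz (with respect to the Euclidean metric), i.e. there exist constants $q>0$ and $Q>0$ such that $$q|z_1-z_2|\le |w(z_1)-w(z_2)|\le Q|z_1-z_2|,\qquad z_1,z_2\in\mathbb U .$$
   Context: $\mathbb U=\{z\in\mathbb C:|z|<1\}$ is the unit disk. For a complex-valued $C^1$ map $w$, $|\nabla w(z)|:=\sup\{|\nabla w(z)h|:|h|=1\}=|w_z|+|w_{\bar z}|$ is the operator norm of the differential, and $\Delta w=4w_{z\bar z}$. With $0\le k<1$ and $K=\frac{1+k}{1-k}$, a $C^2$ mapping $w$ is $K$-quasiconformal if it is an orientation-preserving homeomorphism onto its image with $|w_{\bar z}|\le k|w_z|$ (equivalently $|\nabla w(z)|\le K\,l(\nabla w(z))$, where $l(\nabla w(z))=\inf\{|\nabla w(z)h|:|h|=1\}=|w_z|-|w_{\bar z}|$). The map $w$ is not assumed to be a diffeomorphism. *)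

theory Defs
  imports "HOL-Complex_Analysis.Complex_Analysis"
begin

(* All notions below are meant for an open set S; "frechet_derivative f (at z)" is the
   real differential of f at z, junk where f is not real-differentiable. *)

definition dx :: "(complex \<Rightarrow> complex) \<Rightarrow> complex \<Rightarrow> complex" where
  "dx f z = frechet_derivative f (at z) 1"

definition dy :: "(complex \<Rightarrow> complex) \<Rightarrow> complex \<Rightarrow> complex" where
  "dy f z = frechet_derivative f (at z) \<i>"

definition wirtinger :: "(complex \<Rightarrow> complex) \<Rightarrow> complex \<Rightarrow> complex" where
  "wirtinger f z = (dx f z - \<i> * dy f z) / 2"

definition wirtinger_bar :: "(complex \<Rightarrow> complex) \<Rightarrow> complex \<Rightarrow> complex" where
  "wirtinger_bar f z = (dx f z + \<i> * dy f z) / 2"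

definition laplacian :: "(complex \<Rightarrow> complex) \<Rightarrow> complex \<Rightarrow> complex" where
  "laplacian f z = 4 * wirtinger_bar (wirtinger f) z"

(* "onorm" is the supremum of |Df(z) h| / |h|, i.e. of |Df(z) h| over |h| = 1. *)
definition grad_norm :: "(complex \<Rightarrow> complex) \<Rightarrow> complex \<Rightarrow> real" where
  "grad_norm f z = onorm (frechet_derivative f (at z))"

definition C1_map_on :: "(complex \<Rightarrow> complex) \<Rightarrow> complex set \<Rightarrow> bool" where
  "C1_map_on f S \<longleftrightarrow> (\<forall>z\<in>S. f differentiable (at z)) \<and>
     continuous_on S (dx f) \<and> continuous_on S (dy f)"

definition C2_map_on :: "(complex \<Rightarrow> complex) \<Rightarrow> complex set \<Rightarrow> bool" where
  "C2_map_on f S \<longleftrightarrow> C1_map_on f S \<and> C1_map_on (dx f) S \<and> C1_map_on (dy f) S"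

(* Topological orientation (no differentiability is involved): the image of every positively
   oriented circle bounding a closed disk in S winds once, positively, around the image
   of its centre. *)
definition orientation_preserving_on :: "(complex \<Rightarrow> complex) \<Rightarrow> complex set \<Rightarrow> bool" where
  "orientation_preserving_on f S \<longleftrightarrow>
     (\<forall>z r. 0 < r \<and> cball z r \<subseteq> S \<longrightarrow> winding_number (f \<circ> circlepath z r) (f z) = 1)"

(* K = (1 + k) / (1 - k) is solved for k = (K - 1) / (K + 1). The differential may vanish. *)
definition C2_quasiconformal_on ::
    "real \<Rightarrow> (complex \<Rightarrow> complex) \<Rightarrow> complex set \<Rightarrow> bool" where
  "C2_quasiconformal_on K f S \<longleftrightarrow>
     C2_map_on f S \<and>
     (\<exists>g. homeomorphism S (f ` S) f g) \<and>
     orientation_preserving_on f S \<and>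
     (\<forall>z\<in>S. norm (wirtinger_bar f z) \<le> (K - 1) / (K + 1) * norm (wirtinger f z))"

end

theory Submission
  imports Defs
begin

text \<open>
  Write \<open>f = \<partial>w/\<partial>z\<close>, \<open>q = \<partial>w/\<partial>zbar\<close>, so \<open>|q| \<le> k|f|\<close>, \<open>|\<partial>f/\<partial>zbar| \<le> B|f|\<^sup>2\<close>.

  Upper bound. The squared modulus \<open>\<rho> = |w|\<^sup>2\<close> satisfies \<open>|\<Delta>\<rho>| \<le> const |\<nabla>\<rho>|\<^sup>2\<close> near the boundary by
  quasiconformality, so \<open>exp (\<plusminus>A(1 - \<rho>))\<close> is subharmonic there for a large constant \<open>A\<close>. As \<open>|w| \<longlonglongrightarrow> 1\<close> at the
  boundary, comparison with polynomials in \<open>|z|\<^sup>2\<close> makes \<open>1 - \<rho>\<close> comparable to \<open>1 - |z|\<close>. An interior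
  gradient estimate for \<open>\<rho>\<close> on discs of radius proportional to \<open>1 - |z|\<close> then bounds \<open>f\<close>.

  Lower bound. A version of Cauchy's formula approximates functions with small antiholomorphic
  derivative by holomorphic ones. It shows that a zero of \<open>f\<close> has an order \<open>n \<ge> 1\<close>, whence \<open>w\<close> would wind
  \<open>n + 1\<close> times around its value there; so \<open>f\<close> has no zeros. The function \<open>1/f\<close> has antiholomorphic
  derivative bounded by \<open>B\<close>, so it is nearly a zero-free holomorphic function near the boundary, and
  Harnack's inequality together with \<open>1 - \<rho> \<ge> c(1 - |z|)\<close> bounds \<open>|f|\<close> from below.
\<close>

subsection \<open>Second derivatives along lines and the maximum principle\<close>

text \<open>The differential may vanish a priori, and the inverse map inherits no inequality of the
  assumed kind in any evident way: its Laplacian involves all second derivatives of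
  \<open>w\<close>, not only the mixed one. Hence the lower bound is not obtained by applying the
  upper bound to the inverse; \<open>f\<close> itself must be kept away from 0. The quadratic
  right-hand side suits this exactly, since \<partial>(1/f)/\<partial>zbar =
  -(\<partial>f/\<partial>zbar)/f^2 has modulus at most B however small \<open>f\<close> is. The
  quadratic form also suits the exponential substitution: the Laplacian of exp(A(1 - \<rho>))
  contains A^2 |\<nabla>\<rho>|^2, and k < 1 makes |\<nabla>\<rho>| at least a multiple of |f| where
  |w| \<ge> 1/2, so this term dominates \<Delta>\<rho> for large A. The positive exponent yields 1 -
  \<rho> \<le> C(1 - |z|), which serves both bounds on \<open>f\<close>; the negative one yields 1 -
  \<rho> \<ge> c(1 - |z|), which serves the lower bound.\<close>

definition has_deriv2 :: "(real \<Rightarrow> real) \<Rightarrow> real \<Rightarrow> bool" where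
  "has_deriv2 \<phi> A \<longleftrightarrow> (\<exists>d. (\<forall>\<^sub>F s in nhds 0. (\<phi> has_real_derivative d s) (at s)) \<and>
     (d has_real_derivative A) (at 0))"

text \<open>Second derivatives are taken along the two coordinate lines only, which is all that the
  maximum principle uses. \<open>has_deriv2\<close> asks for a first derivative near 0 but for a
  second one only at 0.\<close>

definition has_laplacian :: "(complex \<Rightarrow> real) \<Rightarrow> complex \<Rightarrow> real \<Rightarrow> bool" where
  "has_laplacian u z L \<longleftrightarrow> (\<exists>A C. has_deriv2 (\<lambda>s. u (z + of_real s)) A \<and>
     has_deriv2 (\<lambda>s. u (z + \<i> * of_real s)) C \<and> L = A + C)"

lemma has_deriv2I:
  assumes "\<And>s. (\<phi> has_real_derivative d s) (at s)" "(d has_real_derivative A) (at 0)"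
  shows "has_deriv2 \<phi> A"
  unfolding has_deriv2_def using assms by (intro exI[of _ d]) auto

lemma has_deriv2_add:
  assumes "has_deriv2 \<phi> A" "has_deriv2 \<psi> C"
  shows "has_deriv2 (\<lambda>s. \<phi> s + \<psi> s) (A + C)"
proof -
  obtain d e where "\<forall>\<^sub>F s in nhds 0. (\<phi> has_real_derivative d s) (at s)" "(d has_real_derivative A) (at 0)"
    "\<forall>\<^sub>F s in nhds 0. (\<psi> has_real_derivative e s) (at s)" "(e has_real_derivative C) (at 0)"
    using assms unfolding has_deriv2_def by auto
  note de = this
  from de(1,3) have "\<forall>\<^sub>F s in nhds 0. ((\<lambda>s. \<phi> s + \<psi> s) has_real_derivative d s + e s) (at s)"
    by eventually_elim (rule DERIV_add)
  with DERIV_add[OF de(2,4)] show ?thesis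
    unfolding has_deriv2_def by (intro exI[of _ "\<lambda>s. d s + e s"]) simp
qed

lemma has_deriv2_cmult:
  assumes "has_deriv2 \<phi> A"
  shows "has_deriv2 (\<lambda>s. c * \<phi> s) (c * A)"
proof -
  obtain d where "\<forall>\<^sub>F s in nhds 0. (\<phi> has_real_derivative d s) (at s)" "(d has_real_derivative A) (at 0)"
    using assms unfolding has_deriv2_def by auto
  then show ?thesis
    unfolding has_deriv2_def
    by (intro exI[of _ "\<lambda>s. c * d s"]) (auto elim!: eventually_mono intro!: derivative_eq_intros)
qed

lemma has_deriv2_reflect:
  assumes "has_deriv2 \<phi> A"
  shows "has_deriv2 (\<lambda>s. \<phi> (- s)) A"
proof -
  obtain d where d: "\<forall>\<^sub>F s in nhds 0. (\<phi> has_real_derivative d s) (at s)" "(d has_real_derivative A) (at 0)"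
    using assms unfolding has_deriv2_def by auto
  have "filterlim uminus (nhds 0) (nhds (0::real))"
    using tendsto_minus[OF filterlim_ident[of "nhds (0::real)"]] by simp
  from d(1) this have "\<forall>\<^sub>F s in nhds 0. (\<phi> has_real_derivative d (- s)) (at (- s))"
    by (rule eventually_compose_filterlim)
  then have "\<forall>\<^sub>F s in nhds 0. ((\<lambda>s. \<phi> (- s)) has_real_derivative - d (- s)) (at s)"
    by eventually_elim (use DERIV_chain2[OF _ DERIV_minus[OF DERIV_ident]] in fastforce)
  moreover have "((\<lambda>s. - d (- s)) has_real_derivative A) (at 0)"
    using d(2) by (auto intro!: derivative_eq_intros DERIV_chain2[where g = uminus])
  ultimately show ?thesis
    unfolding has_deriv2_def by (intro exI[of _ "\<lambda>s. - d (- s)"]) simp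
qed

text \<open>If \<open>A\<close> were positive, the first derivative, which vanishes at the maximum,
  would be positive just to the right of 0, and the mean value theorem would produce a larger value
  there.\<close>

lemma has_deriv2_local_max:
  assumes "has_deriv2 \<phi> A" "\<forall>\<^sub>F s in nhds 0. \<phi> s \<le> \<phi> 0"
  shows "A \<le> 0"
proof (rule ccontr)
  assume "\<not> A \<le> 0"
  obtain d where d: "\<forall>\<^sub>F s in nhds 0. (\<phi> has_real_derivative d s) (at s)" "(d has_real_derivative A) (at 0)"
    using assms unfolding has_deriv2_def by auto
  have "\<forall>\<^sub>F s in nhds 0. (\<phi> has_real_derivative d s) (at s) \<and> \<phi> s \<le> \<phi> 0"
    using d(1) assms(2) by (rule eventually_conj)
  then obtain e where e: "e > 0" "\<And>s. \<bar>s\<bar> < e \<Longrightarrow> (\<phi> has_real_derivative d s) (at s) \<and> \<phi> s \<le> \<phi> 0"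
    unfolding eventually_nhds_metric by (auto simp: dist_real_def)
  have "d 0 = 0"
    using DERIV_local_max[of \<phi> "d 0" 0 e] e by simp
  obtain \<delta> where \<delta>: "\<delta> > 0" "\<And>h. 0 < h \<Longrightarrow> h < \<delta> \<Longrightarrow> d 0 < d (0 + h)"
    using DERIV_pos_inc_right[OF d(2)] \<open>\<not> A \<le> 0\<close> by auto
  define h where "h = min e \<delta> / 2"
  have h: "0 < h" "h < e" "h < \<delta>"
    using e(1) \<delta>(1) by (auto simp: h_def)
  obtain s where s: "0 < s" "s < h" "\<phi> h - \<phi> 0 = (h - 0) * d s"
    using MVT2[of 0 h \<phi> d] h e(2) by auto
  have "d s > 0"
    using \<delta>(2)[of s] s h \<open>d 0 = 0\<close> by simp
  then have "\<phi> h > \<phi> 0"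
    using s(3) h(1) by (smt (verit) mult_pos_pos)
  moreover have "\<phi> h \<le> \<phi> 0"
    using e(2)[of h] h by simp
  ultimately show False by simp
qed

lemma has_laplacian_add:
  assumes "has_laplacian u z L" "has_laplacian v z M"
  shows "has_laplacian (\<lambda>\<zeta>. u \<zeta> + v \<zeta>) z (L + M)"
proof -
  obtain A C A' C' where *: "has_deriv2 (\<lambda>s. u (z + of_real s)) A" "has_deriv2 (\<lambda>s. u (z + \<i> * of_real s)) C"
    "has_deriv2 (\<lambda>s. v (z + of_real s)) A'" "has_deriv2 (\<lambda>s. v (z + \<i> * of_real s)) C'"
    "L = A + C" "M = A' + C'"
    using assms unfolding has_laplacian_def by blast
  show ?thesis
    unfolding has_laplacian_def
    using has_deriv2_add[OF *(1,3)] has_deriv2_add[OF *(2,4)] *(5,6)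
    by (intro exI[of _ "A + A'"] exI[of _ "C + C'"]) auto
qed

lemma has_laplacian_cmult:
  assumes "has_laplacian u z L"
  shows "has_laplacian (\<lambda>\<zeta>. c * u \<zeta>) z (c * L)"
proof -
  obtain A C where *: "has_deriv2 (\<lambda>s. u (z + of_real s)) A" "has_deriv2 (\<lambda>s. u (z + \<i> * of_real s)) C"
    "L = A + C"
    using assms unfolding has_laplacian_def by blast
  show ?thesis
    unfolding has_laplacian_def
    using has_deriv2_cmult[OF *(1), of c] has_deriv2_cmult[OF *(2), of c] *(3)
    by (intro exI[of _ "c * A"] exI[of _ "c * C"]) (auto simp: algebra_simps)
qed

lemma has_laplacian_translate:
  assumes "has_laplacian u (p + z) L"
  shows "has_laplacian (\<lambda>\<zeta>. u (p + \<zeta>)) z L"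
  using assms unfolding has_laplacian_def by (simp add: add.assoc)

text \<open>A quarter turn exchanges the coordinate lines and reverses one of them. It turns an
  estimate for the x-derivative into one for the y-derivative.\<close>

lemma has_laplacian_rotate:
  assumes "has_laplacian u (\<i> * z) L"
  shows "has_laplacian (\<lambda>\<zeta>. u (\<i> * \<zeta>)) z L"
proof -
  obtain A C where *: "has_deriv2 (\<lambda>s. u (\<i> * z + of_real s)) A" "has_deriv2 (\<lambda>s. u (\<i> * z + \<i> * of_real s)) C"
    "L = A + C"
    using assms unfolding has_laplacian_def by blast
  have "has_deriv2 (\<lambda>s. u (\<i> * (z + \<i> * of_real s))) A"
    using has_deriv2_reflect[OF *(1)] by (simp add: algebra_simps)
  moreover have "has_deriv2 (\<lambda>s. u (\<i> * (z + of_real s))) C"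
    using *(2) by (simp add: algebra_simps)
  ultimately show ?thesis
    unfolding has_laplacian_def using *(3) by (auto simp: add.commute)
qed

text \<open>\<open>- cnj \<zeta>\<close> is the mirror image of \<zeta> in the imaginary axis; this
  symmetry produces the odd part in the first variable.\<close>

lemma has_laplacian_reflect:
  assumes "has_laplacian u (- cnj z) L"
  shows "has_laplacian (\<lambda>\<zeta>. u (- cnj \<zeta>)) z L"
proof -
  obtain A C where *: "has_deriv2 (\<lambda>s. u (- cnj z + of_real s)) A" "has_deriv2 (\<lambda>s. u (- cnj z + \<i> * of_real s)) C"
    "L = A + C"
    using assms unfolding has_laplacian_def by blast
  have "has_deriv2 (\<lambda>s. u (- cnj (z + of_real s))) A"
    using has_deriv2_reflect[OF *(1)] by (simp add: algebra_simps)
  moreover have "has_deriv2 (\<lambda>s. u (- cnj (z + \<i> * of_real s))) C"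
    using *(2) by (simp add: algebra_simps)
  ultimately show ?thesis
    unfolding has_laplacian_def using *(3) by auto
qed

lemma has_laplacian_local_max:
  assumes "has_laplacian u z L" "open S" "z \<in> S" "\<And>\<zeta>. \<zeta> \<in> S \<Longrightarrow> u \<zeta> \<le> u z"
  shows "L \<le> 0"
proof -
  obtain A C where *: "has_deriv2 (\<lambda>s. u (z + of_real s)) A" "has_deriv2 (\<lambda>s. u (z + \<i> * of_real s)) C"
    "L = A + C"
    using assms(1) unfolding has_laplacian_def by blast
  have ev: "\<forall>\<^sub>F s in nhds 0. u (z + e * of_real s) \<le> u (z + e * of_real 0)" for e
  proof -
    have "((\<lambda>s::real. z + e * of_real s) \<longlongrightarrow> z + e * of_real 0) (nhds 0)"
      by (intro tendsto_intros filterlim_ident)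
    then have "\<forall>\<^sub>F s in nhds (0::real). z + e * of_real s \<in> S"
      using assms(2,3) by (intro topological_tendstoD) auto
    then show ?thesis
      by eventually_elim (use assms(4) in auto)
  qed
  show ?thesis
    using has_deriv2_local_max[OF *(1)] has_deriv2_local_max[OF *(2)] ev[of 1] ev[of \<i>] *(3) by simp
qed

text \<open>\<open>g\<close> need not extend to the unit circle, so its maximum is taken over closed
  annuli exhausting the region, and the outer boundary value is replaced by an asymptotic bound.
  Strict positivity of the Laplacian excludes an interior maximum without any perturbation.\<close>

lemma strict_max_principle_exhaustion:
  fixes g :: "complex \<Rightarrow> real"
  assumes r0: "0 < r0" "r0 < 1"
    and cont: "continuous_on (ball 0 1 - ball 0 r0) g"
    and lap: "\<And>z. r0 < norm z \<Longrightarrow> norm z < 1 \<Longrightarrow> \<exists>L>0. has_laplacian g z L"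
    and inner: "\<And>z. norm z = r0 \<Longrightarrow> g z \<le> c"
    and outer: "\<And>e. e > 0 \<Longrightarrow> \<exists>R<1. \<forall>z. R \<le> norm z \<and> norm z < 1 \<longrightarrow> g z \<le> c + e"
    and z: "r0 \<le> norm z" "norm z < 1"
  shows "g z \<le> c"
proof (rule field_le_epsilon)
  fix e :: real assume "e > 0"
  then obtain R where R: "R < 1" "\<And>z. R \<le> norm z \<Longrightarrow> norm z < 1 \<Longrightarrow> g z \<le> c + e"
    using outer by blast
  \<comment> \<open>The annulus is enlarged so as to contain \<open>z\<close>; its outer circle
    still lies where \<open>g\<close> is at most c + e.\<close>
  define R' where "R' = max R (norm z)"
  have R': "R' < 1" "norm z \<le> R'" "R \<le> R'"
    using R z by (auto simp: R'_def)
  define T where "T = cball (0::complex) R' - ball 0 r0"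
  have "compact T"
    unfolding T_def by (intro compact_diff) auto
  moreover have "z \<in> T"
    using z R' by (auto simp: T_def)
  moreover have "continuous_on T g"
    by (rule continuous_on_subset[OF cont]) (use R' in \<open>auto simp: T_def\<close>)
  ultimately obtain m where m: "m \<in> T" "\<And>\<zeta>. \<zeta> \<in> T \<Longrightarrow> g \<zeta> \<le> g m"
    using continuous_attains_sup[of T g] by blast
  have "g m \<le> c + e"
  proof (cases "r0 < norm m \<and> norm m < R'")
    case True
    then obtain L where L: "L > 0" "has_laplacian g m L"
      using lap[of m] R' by auto
    have "L \<le> 0"
    proof (rule has_laplacian_local_max[OF L(2)])
      show "open (ball 0 R' - cball (0::complex) r0)" by (intro open_Diff) auto
      show "m \<in> ball 0 R' - cball 0 r0" using True by auto
      show "g \<zeta> \<le> g m" if "\<zeta> \<in> ball 0 R' - cball 0 r0" for \<zeta>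
        using m(2)[of \<zeta>] that by (auto simp: T_def)
    qed
    then show ?thesis using L by simp
  next
    case False
    then have "norm m = r0 \<or> norm m = R'"
      using m(1) by (auto simp: T_def)
    then show ?thesis
      using inner[of m] R(2)[of m] R' \<open>e > 0\<close> by auto
  qed
  then show "g z \<le> c + e"
    using m(2)[OF \<open>z \<in> T\<close>] by simp
qed

subsection \<open>An interior gradient estimate\<close>

lemma has_laplacian_quadratic:
  "has_laplacian (\<lambda>\<zeta>. a * (Re \<zeta>)\<^sup>2 + b * (Im \<zeta>)\<^sup>2 + c * Re \<zeta>) z (2 * a + 2 * b)"
proof -
  have "has_deriv2 (\<lambda>s. a * (Re z + s)\<^sup>2 + b * (Im z)\<^sup>2 + c * (Re z + s)) (2 * a)"
    by (rule has_deriv2I[where d = "\<lambda>s. a * 2 * (Re z + s) + c"]) (auto intro!: derivative_eq_intros)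
  moreover have "has_deriv2 (\<lambda>s. a * (Re z)\<^sup>2 + b * (Im z + s)\<^sup>2 + c * Re z) (2 * b)"
    by (rule has_deriv2I[where d = "\<lambda>s. b * 2 * (Im z + s)"]) (auto intro!: derivative_eq_intros)
  ultimately show ?thesis
    unfolding has_laplacian_def by auto
qed

text \<open>The odd part of \<open>u\<close> in the first variable is compared with a quadratic polynomial on half of
  the square (Gilbarg--Trudinger, Section 3.4).\<close>

lemma x_derivative_le_square:
  fixes u :: "complex \<Rightarrow> real"
  assumes d: "d > 0"
    and cont: "continuous_on {\<zeta>. \<bar>Re \<zeta>\<bar> \<le> d \<and> \<bar>Im \<zeta>\<bar> \<le> d} u"
    and bd: "\<And>\<zeta>. \<bar>Re \<zeta>\<bar> \<le> d \<Longrightarrow> \<bar>Im \<zeta>\<bar> \<le> d \<Longrightarrow> \<bar>u \<zeta>\<bar> \<le> M"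
    and lap: "\<And>\<zeta>. \<bar>Re \<zeta>\<bar> < d \<Longrightarrow> \<bar>Im \<zeta>\<bar> < d \<Longrightarrow> \<exists>L. has_laplacian u \<zeta> L \<and> \<bar>L\<bar> < N"
    and der: "((\<lambda>t. u (of_real t)) has_real_derivative D) (at 0)"
  shows "D \<le> 2 * M / d + d * N / 2"
proof -
  define T where "T = {\<zeta>. 0 \<le> Re \<zeta> \<and> Re \<zeta> \<le> d \<and> \<bar>Im \<zeta>\<bar> \<le> d}"
  define \<phi> where "\<phi> = (\<lambda>\<zeta>. (1/2) * u \<zeta> + (-1/2) * u (- cnj \<zeta>))"
  \<comment> \<open>\<open>- \<psi>\<close> is the barrier (M/d^2)(y^2 + x(2d - x)) + (N/2) x(d -
    x). It is nonnegative on the half square, at least M on the sides x = d and |y| = d, and has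
    Laplacian -N. Its x-derivative at 0 is the asserted bound.\<close>
  define \<psi> where "\<psi> = (\<lambda>\<zeta>. (M / d\<^sup>2 + N / 2) * (Re \<zeta>)\<^sup>2 + (- M / d\<^sup>2) * (Im \<zeta>)\<^sup>2 + (- 2 * M / d - N * d / 2) * Re \<zeta>)"
  define g where "g = (\<lambda>\<zeta>. \<phi> \<zeta> + \<psi> \<zeta>)"
  have M: "M \<ge> 0" using bd[of 0] d by simp
  have N: "N > 0" using lap[of 0] d by auto
  have \<psi>_alt: "\<psi> \<zeta> = - ((M / d\<^sup>2) * ((Im \<zeta>)\<^sup>2 + Re \<zeta> * (2 * d - Re \<zeta>)) + (N / 2) * (Re \<zeta> * (d - Re \<zeta>)))" for \<zeta>
    using d by (simp add: \<psi>_def field_simps power2_eq_square)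
  have T_eq: "T = cbox (Complex 0 (- d)) (Complex d d)"
    by (auto simp: T_def in_cbox_complex_iff)
  have "compact T"
    unfolding T_eq by simp
  have contg: "continuous_on T g"
    unfolding g_def \<phi>_def \<psi>_def
    by (intro continuous_intros continuous_on_compose2[OF cont]) (auto simp: T_def)
  have "0 \<in> T" using d by (simp add: T_def)
  then obtain m where m: "m \<in> T" "\<And>\<zeta>. \<zeta> \<in> T \<Longrightarrow> g \<zeta> \<le> g m"
    using continuous_attains_sup[OF \<open>compact T\<close> _ contg] by blast
  have "g m \<le> 0"
  proof (cases "0 < Re m \<and> Re m < d \<and> \<bar>Im m\<bar> < d")
    case True
    obtain L L' where L: "has_laplacian u m L" "\<bar>L\<bar> < N" "has_laplacian u (- cnj m) L'" "\<bar>L'\<bar> < N"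
      using lap[of m] lap[of "- cnj m"] True by auto
    have "has_laplacian g m ((1/2) * L + (-1/2) * L' + (2 * (M / d\<^sup>2 + N / 2) + 2 * (- M / d\<^sup>2)))"
      unfolding g_def \<phi>_def \<psi>_def
      by (intro has_laplacian_add has_laplacian_cmult has_laplacian_reflect has_laplacian_quadratic L)
    then have "(1/2) * L + (-1/2) * L' + (2 * (M / d\<^sup>2 + N / 2) + 2 * (- M / d\<^sup>2)) \<le> 0"
    proof (rule has_laplacian_local_max)
      show "open (box (Complex 0 (- d)) (Complex d d))" by (rule open_box)
      show "m \<in> box (Complex 0 (- d)) (Complex d d)" using True by (auto simp: in_box_complex_iff)
      show "g \<zeta> \<le> g m" if "\<zeta> \<in> box (Complex 0 (- d)) (Complex d d)" for \<zeta>
        using m(2)[of \<zeta>] that by (auto simp: T_eq in_box_complex_iff in_cbox_complex_iff)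
    qed
    then show ?thesis using L by (simp add: field_simps)
  next
    case False
    have um: "\<bar>u m\<bar> \<le> M" "\<bar>u (- cnj m)\<bar> \<le> M"
      using m(1) by (auto simp: T_def intro!: bd)
    have nn: "0 \<le> N / 2 * (Re m * (d - Re m))" "0 \<le> Re m * (2 * d - Re m)"
      using m(1) N d by (auto simp: T_def)
    consider "Re m = 0" | "Re m = d" | "\<bar>Im m\<bar> = d"
      using False m(1) by (fastforce simp: T_def)
    then show ?thesis
    proof cases
      case 1
      then have "- cnj m = m" by (simp add: complex_eq_iff)
      then have "\<phi> m = 0" by (simp add: \<phi>_def)
      moreover have "\<psi> m \<le> 0" using 1 M by (simp add: \<psi>_alt)
      ultimately show ?thesis by (simp add: g_def)
    next
      case 2
      have "M = M / d\<^sup>2 * d\<^sup>2" using d by simp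
      also have "\<dots> \<le> M / d\<^sup>2 * ((Im m)\<^sup>2 + Re m * (2 * d - Re m))"
        using M 2 by (intro mult_left_mono) (auto simp: power2_eq_square)
      finally have "\<psi> m \<le> - M" using nn unfolding \<psi>_alt by linarith
      then show ?thesis using um by (simp add: g_def \<phi>_def)
    next
      case 3
      then have "(Im m)\<^sup>2 = d\<^sup>2" by (metis power2_abs)
      have "M = M / d\<^sup>2 * d\<^sup>2" using d by simp
      also have "\<dots> \<le> M / d\<^sup>2 * ((Im m)\<^sup>2 + Re m * (2 * d - Re m))"
        using M \<open>(Im m)\<^sup>2 = d\<^sup>2\<close> nn by (intro mult_left_mono) auto
      finally have "\<psi> m \<le> - M" using nn unfolding \<psi>_alt by linarith
      then show ?thesis using um by (simp add: g_def \<phi>_def)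
    qed
  qed
  have key: "\<phi> (of_real t) / t \<le> 2 * M / d + d * N / 2" if t: "0 < t" "t < d" for t
  proof -
    have "\<phi> (of_real t) \<le> - \<psi> (of_real t)"
      using m(2)[of "of_real t"] t \<open>g m \<le> 0\<close> by (simp add: T_def g_def)
    also have "\<dots> = (2 * M / d + N * d / 2) * t - (M / d\<^sup>2 + N / 2) * t\<^sup>2"
      by (simp add: \<psi>_def algebra_simps)
    also have "\<dots> \<le> (2 * M / d + N * d / 2) * t"
      using M N d by simp
    finally show ?thesis using t by (simp add: field_simps)
  qed
  \<comment> \<open>Passing to the odd part keeps the x-derivative at 0, so the barrier bounds
    \<open>D\<close> itself.\<close>
  have "((\<lambda>t. \<phi> (of_real t)) has_real_derivative (1/2) * D + (-1/2) * (D * - 1)) (at 0)"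
    unfolding \<phi>_def using der
    by (auto intro!: derivative_eq_intros DERIV_chain2[where g = uminus and f = "\<lambda>t. u (of_real t)", simplified])
  then have "((\<lambda>t. \<phi> (of_real t)) has_real_derivative D) (at 0)" by simp
  moreover have "\<phi> (of_real 0) = 0" by (simp add: \<phi>_def)
  ultimately have "((\<lambda>t. \<phi> (of_real t) / t) \<longlongrightarrow> D) (at 0)"
    unfolding has_field_derivative_iff by simp
  then have "((\<lambda>t. \<phi> (of_real t) / t) \<longlongrightarrow> D) (at_right 0)"
    by (rule filterlim_mono) (auto simp: at_within_le_at)
  moreover have "\<forall>\<^sub>F t in at_right 0. \<phi> (of_real t) / t \<le> 2 * M / d + d * N / 2"
    using eventually_at_right_less[of "0::real"] eventually_at_right_real[OF d]
    by eventually_elim (auto intro: key)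
  ultimately show ?thesis
    by (rule tendsto_upperbound) auto
qed

text \<open>Translation moves the centre, a quarter turn handles the second variable, and
  \<open>u\<close> together with \<open>- u\<close> gives absolute values. The side \<open>d\<close>
  stays free so that the two terms can be balanced later.\<close>

lemma gradient_bound_square:
  fixes u :: "complex \<Rightarrow> real"
  assumes d: "d > 0"
    and cont: "continuous_on {\<zeta>. \<bar>Re (\<zeta> - p)\<bar> \<le> d \<and> \<bar>Im (\<zeta> - p)\<bar> \<le> d} u"
    and bd: "\<And>\<zeta>. \<bar>Re (\<zeta> - p)\<bar> \<le> d \<Longrightarrow> \<bar>Im (\<zeta> - p)\<bar> \<le> d \<Longrightarrow> \<bar>u \<zeta>\<bar> \<le> M"
    and lap: "\<And>\<zeta>. \<bar>Re (\<zeta> - p)\<bar> < d \<Longrightarrow> \<bar>Im (\<zeta> - p)\<bar> < d \<Longrightarrow> \<exists>L. has_laplacian u \<zeta> L \<and> \<bar>L\<bar> < N"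
    and derx: "((\<lambda>t. u (p + of_real t)) has_real_derivative D) (at 0)"
    and dery: "((\<lambda>t. u (p + \<i> * of_real t)) has_real_derivative E) (at 0)"
  shows "\<bar>D\<bar> \<le> 2 * M / d + d * N / 2" "\<bar>E\<bar> \<le> 2 * M / d + d * N / 2"
proof -
  have lap': "\<exists>L. has_laplacian (\<lambda>\<zeta>. c * u \<zeta>) \<zeta> L \<and> \<bar>L\<bar> < N"
    if "\<bar>Re (\<zeta> - p)\<bar> < d" and "\<bar>Im (\<zeta> - p)\<bar> < d" and "c = 1 \<or> c = - 1" for \<zeta> and c :: real
  proof -
    obtain L where L: "has_laplacian u \<zeta> L" "\<bar>L\<bar> < N"
      using lap[OF \<open>\<bar>Re (\<zeta> - p)\<bar> < d\<close> \<open>\<bar>Im (\<zeta> - p)\<bar> < d\<close>] by blast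
    show ?thesis
      using has_laplacian_cmult[OF L(1), of c] L(2) \<open>c = 1 \<or> c = - 1\<close>
      by (intro exI[of _ "c * L"]) (auto simp: abs_mult)
  qed
  have x: "c * D \<le> 2 * M / d + d * N / 2" if c: "c = 1 \<or> c = - 1" for c :: real
  proof (rule x_derivative_le_square[OF d, where u = "\<lambda>\<zeta>. c * u (p + \<zeta>)"])
    show "continuous_on {\<zeta>. \<bar>Re \<zeta>\<bar> \<le> d \<and> \<bar>Im \<zeta>\<bar> \<le> d} (\<lambda>\<zeta>. c * u (p + \<zeta>))"
      by (intro continuous_intros continuous_on_compose2[OF cont]) auto
    show "\<bar>c * u (p + \<zeta>)\<bar> \<le> M" if *: "\<bar>Re \<zeta>\<bar> \<le> d" "\<bar>Im \<zeta>\<bar> \<le> d" for \<zeta>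
      using bd[of "p + \<zeta>"] * c by auto
    show "\<exists>L. has_laplacian (\<lambda>\<zeta>. c * u (p + \<zeta>)) \<zeta> L \<and> \<bar>L\<bar> < N" if *: "\<bar>Re \<zeta>\<bar> < d" "\<bar>Im \<zeta>\<bar> < d" for \<zeta>
      using lap'[of "p + \<zeta>" c] * c has_laplacian_translate[of "\<lambda>\<zeta>. c * u \<zeta>" p \<zeta>] by auto
    show "((\<lambda>t. c * u (p + of_real t)) has_real_derivative c * D) (at 0)"
      by (intro DERIV_cmult derx)
  qed
  have y: "c * E \<le> 2 * M / d + d * N / 2" if c: "c = 1 \<or> c = - 1" for c :: real
  proof (rule x_derivative_le_square[OF d, where u = "\<lambda>\<zeta>. c * u (p + \<i> * \<zeta>)"])
    show "continuous_on {\<zeta>. \<bar>Re \<zeta>\<bar> \<le> d \<and> \<bar>Im \<zeta>\<bar> \<le> d} (\<lambda>\<zeta>. c * u (p + \<i> * \<zeta>))"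
      by (intro continuous_intros continuous_on_compose2[OF cont]) auto
    show "\<bar>c * u (p + \<i> * \<zeta>)\<bar> \<le> M" if *: "\<bar>Re \<zeta>\<bar> \<le> d" "\<bar>Im \<zeta>\<bar> \<le> d" for \<zeta>
      using bd[of "p + \<i> * \<zeta>"] * c by auto
    show "\<exists>L. has_laplacian (\<lambda>\<zeta>. c * u (p + \<i> * \<zeta>)) \<zeta> L \<and> \<bar>L\<bar> < N" if *: "\<bar>Re \<zeta>\<bar> < d" "\<bar>Im \<zeta>\<bar> < d" for \<zeta>
      using lap'[of "p + \<i> * \<zeta>" c] * c
        has_laplacian_rotate[OF has_laplacian_translate[of "\<lambda>\<zeta>. c * u \<zeta>" p "\<i> * \<zeta>"]] by auto
    show "((\<lambda>t. c * u (p + \<i> * of_real t)) has_real_derivative c * E) (at 0)"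
      by (intro DERIV_cmult dery)
  qed
  show "\<bar>D\<bar> \<le> 2 * M / d + d * N / 2" "\<bar>E\<bar> \<le> 2 * M / d + d * N / 2"
    using x[of 1] x[of "-1"] y[of 1] y[of "-1"] by auto
qed

subsection \<open>Wirtinger derivatives\<close>

text \<open>Every real differential has the form \<open>a h + b cnj h\<close>, so \<open>a\<close>
  and \<open>b\<close> are the values of \<partial>f/\<partial>z and \<partial>f/\<partial>zbar, and
  real differentiability is part of the relation.\<close>

definition has_wirtinger :: "(complex \<Rightarrow> complex) \<Rightarrow> complex \<Rightarrow> complex \<Rightarrow> complex \<Rightarrow> bool" where
  "has_wirtinger f a b z \<longleftrightarrow> (f has_derivative (\<lambda>h. a * h + b * cnj h)) (at z)"

lemma has_wirtinger_imp_isCont: "has_wirtinger f a b z \<Longrightarrow> isCont f z"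
  unfolding has_wirtinger_def by (rule has_derivative_continuous)

lemma has_wirtinger_imp_continuous_on:
  "(\<And>z. z \<in> S \<Longrightarrow> has_wirtinger f (a z) (b z) z) \<Longrightarrow> continuous_on S f"
  by (meson continuous_at_imp_continuous_on has_wirtinger_imp_isCont)

text \<open>Cauchy kernels and powers of \<open>\<zeta> - p\<close> enter through this rule: a
  holomorphic factor adds no new antiholomorphic term.\<close>

lemma has_wirtinger_mult_holomorphic:
  assumes "has_wirtinger f a b z" "(g has_field_derivative g') (at z)"
  shows "has_wirtinger (\<lambda>\<zeta>. f \<zeta> * g \<zeta>) (a * g z + f z * g') (b * g z) z"
proof -
  have "(g has_derivative (\<lambda>h. g' * h)) (at z)"
    using assms(2) by (simp add: has_field_derivative_def)
  from has_derivative_mult[OF assms(1)[unfolded has_wirtinger_def] this]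
  show ?thesis
    unfolding has_wirtinger_def by (rule has_derivative_eq_rhs) (auto simp: algebra_simps)
qed

lemma has_wirtinger_compose_holomorphic:
  assumes "has_wirtinger f a b z" "(g has_field_derivative g') (at (f z))"
  shows "has_wirtinger (\<lambda>\<zeta>. g (f \<zeta>)) (g' * a) (g' * b) z"
proof -
  have "(g has_derivative (\<lambda>h. g' * h)) (at (f z))"
    using assms(2) by (simp add: has_field_derivative_def)
  from diff_chain_at[OF assms(1)[unfolded has_wirtinger_def] this]
  show ?thesis
    unfolding has_wirtinger_def o_def by (rule has_derivative_eq_rhs) (auto simp: algebra_simps)
qed

lemma has_wirtinger_along_path:
  assumes "has_wirtinger f a b (\<gamma> t)" "(\<gamma> has_vector_derivative d) (at t within T)"
  shows "((\<lambda>t. f (\<gamma> t)) has_vector_derivative a * d + b * cnj d) (at t within T)"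
proof -
  have "(f has_derivative (\<lambda>h. a * h + b * cnj h)) (at (\<gamma> t) within \<gamma> ` T)"
    using assms(1) unfolding has_wirtinger_def by (rule has_derivative_at_withinI)
  from diff_chain_within[OF assms(2)[unfolded has_vector_derivative_def] this]
  show ?thesis
    unfolding has_vector_derivative_def o_def
    by (rule has_derivative_eq_rhs) (auto simp: algebra_simps)
qed

subsection \<open>Cauchy's formula up to a bounded antiholomorphic derivative\<close>

text \<open>Green's theorem on the annular region swept out by the curves \<open>z + s c\<close> becomes
  differentiation in \<open>s\<close> under the integral sign.\<close>

lemma contour_family_derivative:
  fixes \<phi> a b :: "complex \<Rightarrow> complex" and c c' :: "real \<Rightarrow> complex"
  assumes wd: "\<And>\<zeta>. \<zeta> \<in> S \<Longrightarrow> has_wirtinger \<phi> (a \<zeta>) (b \<zeta>) \<zeta>"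
    and conta: "continuous_on S a" and contb: "continuous_on S b"
    and c: "\<And>t. t \<in> {0..1} \<Longrightarrow> (c has_vector_derivative c' t) (at t within {0..1})"
    and contc': "continuous_on {0..1} c'" and closed: "c 0 = c 1"
    and inS: "\<And>s t. s \<in> {\<alpha><..<\<beta>} \<Longrightarrow> t \<in> {0..1} \<Longrightarrow> z + of_real s * c t \<in> S"
    and s: "s \<in> {\<alpha><..<\<beta>}"
  shows "((\<lambda>s. integral {0..1} (\<lambda>t. \<phi> (z + of_real s * c t) * (of_real s * c' t))) has_vector_derivative
           integral {0..1} (\<lambda>t. of_real s * b (z + of_real s * c t) * (cnj (c t) * c' t - cnj (c' t) * c t)))
         (at s)"
proof -
  define U where "U = {\<alpha><..<\<beta>}"
  have contc: "continuous_on {0..1} c"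
    using c by (meson continuous_on_eq_continuous_within has_vector_derivative_continuous)
  have cont\<phi>: "continuous_on S \<phi>"
    using wd by (rule has_wirtinger_imp_continuous_on)
  have c2: "continuous_on (U \<times> {0..1}) (\<lambda>x. c (snd x))"
    by (rule continuous_on_compose2[OF contc]) (auto intro: continuous_intros)
  have c2': "continuous_on (U \<times> {0..1}) (\<lambda>x. c' (snd x))"
    by (rule continuous_on_compose2[OF contc']) (auto intro: continuous_intros)
  have cP: "continuous_on (U \<times> {0..1}) (\<lambda>x. z + complex_of_real (fst x) * c (snd x))"
    by (intro continuous_intros c2)
  have PS: "(\<lambda>x. z + complex_of_real (fst x) * c (snd x)) ` (U \<times> {0..1}) \<subseteq> S"
    using inS by (auto simp: U_def)
  note cc = continuous_on_compose2[OF conta cP PS] continuous_on_compose2[OF contb cP PS]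
    continuous_on_compose2[OF cont\<phi> cP PS]
  define fx where "fx = (\<lambda>s t. \<phi> (z + of_real s * c t) * c' t
      + (a (z + of_real s * c t) * c t + b (z + of_real s * c t) * cnj (c t)) * (of_real s * c' t))"
  have contfx: "continuous_on (U \<times> {0..1}) (\<lambda>(s, t). fx s t)"
    unfolding fx_def case_prod_beta by (intro continuous_intros c2 c2' cc)
  have contJ: "continuous_on (U \<times> {0..1}) (\<lambda>(s, t). \<phi> (z + of_real s * c t) * (of_real s * c' t))"
    unfolding case_prod_beta by (intro continuous_intros c2 c2' cc)
  have "((\<lambda>s. integral (cbox 0 1) (\<lambda>t. \<phi> (z + of_real s * c t) * (of_real s * c' t))) has_vector_derivative
      integral (cbox 0 1) (fx s)) (at s within U)"
  proof (rule leibniz_rule_vector_derivative[where fx = fx])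
    show "s \<in> U" "convex U" using s by (auto simp: U_def)
    show "continuous_on (U \<times> cbox 0 1) (\<lambda>(s, t). fx s t)" using contfx by simp
    show "(\<lambda>t. \<phi> (z + of_real s * c t) * (of_real s * c' t)) integrable_on cbox 0 1" if "s \<in> U" for s
    proof -
      have "continuous_on {0..1} (\<lambda>t. case (s, t) of (s, t) \<Rightarrow> \<phi> (z + of_real s * c t) * (of_real s * c' t))"
        by (rule continuous_on_compose2[OF contJ]) (use that in \<open>auto intro!: continuous_intros\<close>)
      then show ?thesis by (auto intro: integrable_continuous_interval)
    qed
    fix s t :: real assume st: "s \<in> U" "t \<in> cbox 0 1"
    have "((\<lambda>s. z + complex_of_real s * c t) has_vector_derivative c t) (at s within U)"
      by (auto intro!: derivative_eq_intros simp: has_vector_derivative_def scaleR_conv_of_real)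
    then have "((\<lambda>s. \<phi> (z + of_real s * c t)) has_vector_derivative
        a (z + of_real s * c t) * c t + b (z + of_real s * c t) * cnj (c t)) (at s within U)"
      by (intro has_wirtinger_along_path wd inS) (use st in \<open>auto simp: U_def\<close>)
    moreover have "((\<lambda>s. complex_of_real s * c' t) has_vector_derivative c' t) (at s within U)"
      by (auto intro!: derivative_eq_intros simp: has_vector_derivative_def scaleR_conv_of_real)
    ultimately have "((\<lambda>s. \<phi> (z + of_real s * c t) * (of_real s * c' t)) has_vector_derivative
        \<phi> (z + of_real s * c t) * c' t + 
        (a (z + of_real s * c t) * c t + b (z + of_real s * c t) * cnj (c t)) * (of_real s * c' t)) (at s within U)"
      by (rule has_vector_derivative_mult)
    then show "((\<lambda>s. \<phi> (z + of_real s * c t) * (of_real s * c' t)) has_vector_derivative fx s t) (at s within U)"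
      by (simp only: fx_def)
  qed
  then have 1: "((\<lambda>s. integral {0..1} (\<lambda>t. \<phi> (z + of_real s * c t) * (of_real s * c' t))) has_vector_derivative
      integral {0..1} (fx s)) (at s)"
    using s at_within_open[of s U] by (simp add: U_def)
  \<comment> \<open>\<open>gt\<close> is the t-derivative of \<open>\<phi> c\<close>, whose integral
    vanishes because the curve is closed. Subtracting it removes every term with \<open>a\<close>
    and leaves \<open>b\<close> against the area element of Green's theorem.\<close>
  define gt where "gt = (\<lambda>t. \<phi> (z + of_real s * c t) * c' t
      + (a (z + of_real s * c t) * (of_real s * c' t) + b (z + of_real s * c t) * cnj (of_real s * c' t)) * c t)"
  have "(gt has_integral \<phi> (z + of_real s * c 1) * c 1 - \<phi> (z + of_real s * c 0) * c 0) {0..1}"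
  proof (rule fundamental_theorem_of_calculus)
    fix t :: real assume t: "t \<in> {0..1}"
    have "((\<lambda>t. z + complex_of_real s * c t) has_vector_derivative of_real s * c' t) (at t within {0..1})"
      using has_vector_derivative_add[OF has_vector_derivative_const has_vector_derivative_mult_right[OF c[OF t]]]
      by simp
    then have "((\<lambda>t. \<phi> (z + of_real s * c t)) has_vector_derivative
        a (z + of_real s * c t) * (of_real s * c' t) + b (z + of_real s * c t) * cnj (of_real s * c' t)) (at t within {0..1})"
      by (intro has_wirtinger_along_path wd inS) (use s t in auto)
    from has_vector_derivative_mult[OF this c[OF t]]
    show "((\<lambda>t. \<phi> (z + of_real s * c t) * c t) has_vector_derivative gt t) (at t within {0..1})"
      by (simp add: gt_def)
  qed simp
  then have gt0: "(gt has_integral 0) {0..1}" using closed by simp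
  have "continuous_on {0..1} (\<lambda>t. case (s, t) of (s, t) \<Rightarrow> fx s t)"
    by (rule continuous_on_compose2[OF contfx]) (use s in \<open>auto intro!: continuous_intros simp: U_def\<close>)
  then have "(fx s has_integral integral {0..1} (fx s)) {0..1}"
    by (auto intro: integrable_integral integrable_continuous_interval)
  from has_integral_diff[OF this gt0]
  have "((\<lambda>t. of_real s * b (z + of_real s * c t) * (cnj (c t) * c' t - cnj (c' t) * c t))
     has_integral integral {0..1} (fx s)) {0..1}"
    by (simp add: fx_def gt_def algebra_simps)
  then show ?thesis
    using 1 by (metis (no_types, lifting) integral_unique)
qed

text \<open>The mean value inequality in \<open>s\<close>. The formula for \<open>K\<close> is asked
  only on the open interval, with mere continuity at the ends, so the curves may shrink to a
  singular point or reach a circle where \<phi> is not differentiable.\<close>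

lemma contour_family_bound:
  fixes \<phi> a b :: "complex \<Rightarrow> complex" and c c' :: "real \<Rightarrow> complex"
  assumes wd: "\<And>\<zeta>. \<zeta> \<in> S \<Longrightarrow> has_wirtinger \<phi> (a \<zeta>) (b \<zeta>) \<zeta>"
    and conta: "continuous_on S a" and contb: "continuous_on S b"
    and c: "\<And>t. t \<in> {0..1} \<Longrightarrow> (c has_vector_derivative c' t) (at t within {0..1})"
    and contc': "continuous_on {0..1} c'" and closed: "c 0 = c 1"
    and inS: "\<And>s t. s \<in> {\<alpha><..<\<beta>} \<Longrightarrow> t \<in> {0..1} \<Longrightarrow> z + of_real s * c t \<in> S"
    and \<alpha>: "0 \<le> \<alpha>" "\<alpha> \<le> \<beta>"
    and contK: "continuous_on {\<alpha>..\<beta>} K"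
    and K: "\<And>s. s \<in> {\<alpha><..<\<beta>} \<Longrightarrow> K s = integral {0..1} (\<lambda>t. \<phi> (z + of_real s * c t) * (of_real s * c' t))"
    and bd: "\<And>s t. s \<in> {\<alpha><..<\<beta>} \<Longrightarrow> t \<in> {0..1} \<Longrightarrow>
        2 * s * norm (b (z + of_real s * c t)) * norm (c t) * norm (c' t) \<le> M"
  shows "norm (K \<beta> - K \<alpha>) \<le> M * (\<beta> - \<alpha>)"
proof (cases "\<alpha> = \<beta>")
  case False
  then have "\<alpha> < \<beta>" using \<alpha> by simp
  define D where "D = (\<lambda>s. integral {0..1} (\<lambda>t. of_real s * b (z + of_real s * c t) * (cnj (c t) * c' t - cnj (c' t) * c t)))"
  have contc: "continuous_on {0..1} c"
    using c by (meson continuous_on_eq_continuous_within has_vector_derivative_continuous)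
  have der: "(K has_derivative (\<lambda>h. h *\<^sub>R D s)) (at s)" if "\<alpha> < s" "s < \<beta>" for s
  proof -
    have "((\<lambda>s. integral {0..1} (\<lambda>t. \<phi> (z + of_real s * c t) * (of_real s * c' t))) has_vector_derivative D s) (at s)"
      unfolding D_def
      by (rule contour_family_derivative[OF wd conta contb c contc' closed inS]) (use that in auto)
    then have "(K has_vector_derivative D s) (at s)"
      by (rule has_vector_derivative_transform_within_open[where S = "{\<alpha><..<\<beta>}"]) (use that K in auto)
    then show ?thesis by (simp add: has_vector_derivative_def)
  qed
  obtain s where s: "s \<in> {\<alpha><..<\<beta>}" "norm (K \<beta> - K \<alpha>) \<le> norm ((\<beta> - \<alpha>) *\<^sub>R D s)"
    using mvt_general[OF \<open>\<alpha> < \<beta>\<close> contK der] by blast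
  have "norm (D s) \<le> M * (1 - 0)"
    unfolding D_def
  proof (rule integral_bound)
    have "continuous_on {0..1} (\<lambda>t. z + of_real s * c t)"
      by (intro continuous_intros contc)
    then have "continuous_on {0..1} (\<lambda>t. b (z + of_real s * c t))"
      by (rule continuous_on_compose2[OF contb]) (use inS s in auto)
    then show "continuous_on {0..1} (\<lambda>t. of_real s * b (z + of_real s * c t) * (cnj (c t) * c' t - cnj (c' t) * c t))"
      by (intro continuous_intros contc contc')
    fix t :: real assume t: "t \<in> {0..1}"
    have "norm (cnj (c t) * c' t - cnj (c' t) * c t) \<le> norm (cnj (c t) * c' t) + norm (cnj (c' t) * c t)"
      by (rule norm_triangle_ineq4)
    also have "\<dots> = 2 * (norm (c t) * norm (c' t))" by (simp add: norm_mult)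
    finally have "norm (of_real s * b (z + of_real s * c t) * (cnj (c t) * c' t - cnj (c' t) * c t))
        \<le> s * norm (b (z + of_real s * c t)) * (2 * (norm (c t) * norm (c' t)))"
      using s \<alpha> unfolding norm_mult by (intro mult_mono) auto
    also have "\<dots> \<le> M" using bd[OF s(1) t] by (simp add: algebra_simps)
    finally show "norm (of_real s * b (z + of_real s * c t) * (cnj (c t) * c' t - cnj (c' t) * c t)) \<le> M" .
  qed simp
  then have "norm ((\<beta> - \<alpha>) *\<^sub>R D s) \<le> (\<beta> - \<alpha>) * M"
    using \<open>\<alpha> < \<beta>\<close> by (simp add: mult_left_mono)
  then show ?thesis using s(2) by (simp add: algebra_simps)
qed simp

lemma contour_integral_circlepath_eq:
  "contour_integral (circlepath p R) g = integral {0..1}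
     (\<lambda>t. g (p + of_real R * exp (2 * of_real pi * \<i> * of_real t)) *
        (2 * of_real pi * \<i> * of_real R * exp (2 * of_real pi * \<i> * of_real t)))"
  unfolding contour_integral_integral vector_derivative_circlepath by (simp add: circlepath)

lemma exp_circle_vector_derivative:
  "((\<lambda>t. p + of_real R * exp (2 * of_real pi * \<i> * of_real t)) has_vector_derivative
     2 * of_real pi * \<i> * of_real R * exp (2 * of_real pi * \<i> * of_real t)) (at t within T)"
  using has_vector_derivative_circlepath[of p R t T] by (simp add: circlepath)

lemma norm_exp_circle [simp]: "norm (exp (2 * of_real pi * \<i> * of_real t)) = 1"
  by (simp add: norm_exp_eq_Re)

text \<open>The circle is contracted to \<open>z\<close> through the curves \<open>z + s c\<close>:
  at s = 1 one has the Cauchy integral, at s = 0 the value 2 pi i f(z). In the s-derivative the pole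
  is cancelled by the factor \<open>s |c|\<close>, which leaves 2 |b| |c'|, at most 4 pi R eps. The
  exceptional point \<open>e\<close> admits functions that are only extended continuously across a
  puncture.\<close>

lemma cauchy_approximation:
  fixes f a b :: "complex \<Rightarrow> complex"
  assumes R: "0 < R" and contf: "continuous_on (cball p R) f"
    and wd: "\<And>\<zeta>. \<zeta> \<in> ball p R - {e} \<Longrightarrow> has_wirtinger f (a \<zeta>) (b \<zeta>) \<zeta>"
    and conta: "continuous_on (ball p R - {e}) a" and contb: "continuous_on (ball p R - {e}) b"
    and bd: "\<And>\<zeta>. \<zeta> \<in> ball p R - {e} \<Longrightarrow> norm (b \<zeta>) \<le> eps"
    and z: "z \<in> ball p R"
  shows "norm (contour_integral (circlepath p R) (\<lambda>\<zeta>. f \<zeta> / (\<zeta> - z)) - 2 * of_real pi * \<i> * f z) \<le> 4 * pi * R * eps"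
proof -
  define E where "E = (\<lambda>t::real. exp (2 * of_real pi * \<i> * of_real t))"
  define c where "c = (\<lambda>t. p - z + of_real R * E t)"
  define c' where "c' = (\<lambda>t. 2 * of_real pi * \<i> * of_real R * E t)"
  define K where "K = (\<lambda>s. integral {0..1} (\<lambda>t. f (z + of_real s * c t) * (c' t / c t)))"
  have normE: "norm (E t) = 1" for t by (simp add: E_def)
  have c: "(c has_vector_derivative c' t) (at t within {0..1})" for t
    unfolding c_def c'_def E_def by (rule exp_circle_vector_derivative)
  have contc: "continuous_on T c" "continuous_on T c'" for T
    unfolding c_def c'_def E_def by (intro continuous_intros)+
  have zc: "z + c t \<in> sphere p R" for t
    using R by (simp add: c_def dist_norm norm_mult normE)
  have c0: "c t \<noteq> 0" for t
    using zc[of t] z by auto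
  have norm_pt: "z + of_real s * c t \<in> ball p R" if "0 \<le> s" "s < 1" for s t
  proof -
    have "z + of_real s * c t - p = of_real (1 - s) * (z - p) + of_real s * (z + c t - p)"
      by (simp add: algebra_simps)
    also have "norm \<dots> \<le> norm (of_real (1 - s) * (z - p)) + norm (of_real s * (z + c t - p))"
      by (rule norm_triangle_ineq)
    also have "\<dots> = (1 - s) * norm (z - p) + s * norm (z + c t - p)"
      using that by (simp add: norm_mult del: of_real_diff)
    also have "\<dots> < (1 - s) * R + s * R"
      using z zc[of t] that by (intro add_less_le_mono mult_strict_left_mono) (auto simp: dist_norm norm_minus_commute)
    finally show ?thesis by (simp add: dist_norm norm_minus_commute algebra_simps)
  qed
  have norm_pt': "z + of_real s * c t \<in> cball p R" if "0 \<le> s" "s \<le> 1" for s t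
    using norm_pt[of s t] zc[of t] that by (cases "s = 1") (auto simp: less_imp_le)
  have cont2: "continuous_on ({0..1} \<times> {0..1}) (\<lambda>(s, t). f (z + of_real s * c t) * (c' t / c t))"
    unfolding case_prod_beta using c0 norm_pt'
    by (intro continuous_intros continuous_on_compose2[OF contf] continuous_on_compose2[OF contc(1)[of UNIV]]
        continuous_on_compose2[OF contc(2)[of UNIV]]) auto
  have contK: "continuous_on {0..1} K"
    using integral_continuous_on_param[of "{0..1}" 0 1 "\<lambda>s t. f (z + of_real s * c t) * (c' t / c t)"] cont2
    unfolding K_def by simp
  have K1: "K 1 = contour_integral (circlepath p R) (\<lambda>\<zeta>. f \<zeta> / (\<zeta> - z))"
    unfolding contour_integral_circlepath_eq K_def by (simp add: c_def c'_def E_def algebra_simps)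
  have "((\<lambda>u. 1 / (u - z)) has_contour_integral 2 * of_real pi * \<i> * 1) (circlepath p R)"
    by (rule Cauchy_integral_circlepath_simple) (use z in \<open>auto simp: dist_norm norm_minus_commute\<close>)
  then have "integral {0..1} (\<lambda>t. c' t / c t) = 2 * of_real pi * \<i>"
    unfolding contour_integral_unique[symmetric] contour_integral_circlepath_eq c_def c'_def E_def
    by (auto dest!: contour_integral_unique simp: contour_integral_circlepath_eq algebra_simps)
  then have K0: "K 0 = 2 * of_real pi * \<i> * f z"
    unfolding K_def by (simp add: mult.commute del: times_divide_eq_right)
  have piece: "norm (K \<beta> - K \<alpha>) \<le> 4 * pi * R * eps * (\<beta> - \<alpha>)"
    if ab: "0 \<le> \<alpha>" "\<alpha> \<le> \<beta>" "\<beta> \<le> 1"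
      and avoid: "\<And>s t. s \<in> {\<alpha><..<\<beta>} \<Longrightarrow> z + of_real s * c t \<noteq> e" for \<alpha> \<beta>
  proof (rule contour_family_bound[where S = "ball p R - {e} - {z}" and \<phi> = "\<lambda>\<zeta>. f \<zeta> * inverse (\<zeta> - z)"
      and a = "\<lambda>\<zeta>. a \<zeta> * inverse (\<zeta> - z) + f \<zeta> * (- inverse (\<zeta> - z) * inverse (\<zeta> - z))"
      and b = "\<lambda>\<zeta>. b \<zeta> * inverse (\<zeta> - z)" and c = c and c' = c' and z = z])
    show "has_wirtinger (\<lambda>\<zeta>. f \<zeta> * inverse (\<zeta> - z)) (a \<zeta> * inverse (\<zeta> - z) + f \<zeta> * (- inverse (\<zeta> - z) * inverse (\<zeta> - z)))
        (b \<zeta> * inverse (\<zeta> - z)) \<zeta>" if "\<zeta> \<in> ball p R - {e} - {z}" for \<zeta>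
      using that by (intro has_wirtinger_mult_holomorphic wd) (auto intro!: derivative_eq_intros)
    have contf': "continuous_on (ball p R - {e} - {z}) f"
      by (rule continuous_on_subset[OF contf]) auto
    show "continuous_on (ball p R - {e} - {z}) (\<lambda>\<zeta>. a \<zeta> * inverse (\<zeta> - z) + f \<zeta> * (- inverse (\<zeta> - z) * inverse (\<zeta> - z)))"
      by (intro continuous_intros contf' continuous_on_subset[OF conta]) auto
    show "continuous_on (ball p R - {e} - {z}) (\<lambda>\<zeta>. b \<zeta> * inverse (\<zeta> - z))"
      by (intro continuous_intros continuous_on_subset[OF contb]) auto
    show "c 0 = c 1" by (simp add: c_def E_def exp_eq_1)
    show inS: "z + of_real s * c t \<in> ball p R - {e} - {z}" if "s \<in> {\<alpha><..<\<beta>}" for s t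
      using norm_pt[of s t] avoid[OF that, of t] that ab c0[of t] by auto
    show "continuous_on {\<alpha>..\<beta>} K"
      using contK by (rule continuous_on_subset) (use ab in auto)
    show "K s = integral {0..1} (\<lambda>t. f (z + of_real s * c t) * inverse (z + of_real s * c t - z) * (of_real s * c' t))"
      if "s \<in> {\<alpha><..<\<beta>}" for s
      unfolding K_def using that ab c0 by (intro integral_cong) (auto simp: field_simps)
    show "2 * s * norm (b (z + of_real s * c t) * inverse (z + of_real s * c t - z)) * norm (c t) * norm (c' t) \<le> 4 * pi * R * eps"
      if s: "s \<in> {\<alpha><..<\<beta>}" for s t
    proof -
      have "2 * s * norm (b (z + of_real s * c t) * inverse (z + of_real s * c t - z)) * norm (c t) * norm (c' t)
          = 4 * pi * R * norm (b (z + of_real s * c t))"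
        using c0[of t] s ab R by (simp add: norm_mult norm_inverse c'_def normE)
      also have "\<dots> \<le> 4 * pi * R * eps"
        using inS[OF s, of t] R by (intro mult_left_mono bd) auto
      finally show ?thesis .
    qed
  qed (use ab c contc in auto)
  \<comment> \<open>Contracted circles for different \<open>s\<close> are disjoint: otherwise a
    point of the original circle would be the contraction, by a factor below 1, of another one and
    would lie in the open disc. So \<open>e\<close> is met for one \<open>s\<close> at most, and the
    interval is split there.\<close>
  have uniq: False if "s1 < s2" "0 < s1" "z + of_real s1 * c t1 = e" "z + of_real s2 * c t2 = e" for s1 s2 t1 t2
  proof -
    define l where "l = s1 / s2"
    have l: "0 \<le> l" "l < 1" using that by (auto simp: l_def)
    have "of_real s1 * c t1 = of_real s2 * c t2"
      using that(3,4) by (metis add_left_cancel)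
    then have "c t2 = of_real l * c t1"
      using that by (simp add: l_def field_simps)
    then have "z + c t2 \<in> ball p R"
      using norm_pt[OF l, of t1] by simp
    then show False using zc[of t2] by simp
  qed
  have "norm (K 1 - K 0) \<le> 4 * pi * R * eps"
  proof (cases "\<exists>s t. 0 < s \<and> s < 1 \<and> z + of_real s * c t = e")
    case True
    then obtain s t where s: "0 < s" "s < 1" "z + of_real s * c t = e" by blast
    have "norm (K s - K 0) \<le> 4 * pi * R * eps * (s - 0)"
      by (rule piece) (use s uniq in auto)
    moreover have "norm (K 1 - K s) \<le> 4 * pi * R * eps * (1 - s)"
      by (rule piece) (use s uniq in auto)
    ultimately have "norm ((K 1 - K s) + (K s - K 0)) \<le> 4 * pi * R * eps * (1 - s) + 4 * pi * R * eps * (s - 0)"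
      by (intro norm_triangle_mono)
    then show ?thesis by (simp add: algebra_simps)
  next
    case False
    have "norm (K 1 - K 0) \<le> 4 * pi * R * eps * (1 - 0)"
      by (rule piece) (use False in auto)
    then show ?thesis by simp
  qed
  then show ?thesis using K0 K1 by simp
qed

text \<open>The limit hypothesis makes \<open>(\<zeta> - p) F\<close> continuous at
  \<open>p\<close>, so \<open>F\<close> may be unbounded and still has no residue. On the circle of
  radius \<rho> = 2|z - p| the unpunctured estimate is applied to \<open>(\<zeta> - p) F\<close>; as
  \<rho> is comparable to |z - p|, dividing by \<open>z - p\<close> costs only a factor. The annulus
  from \<rho> to \<open>R\<close> is then swept directly.\<close>

lemma cauchy_approximation_punctured:
  fixes F a b :: "complex \<Rightarrow> complex"
  assumes contF: "continuous_on (cball p R - {p}) F"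
    and wd: "\<And>\<zeta>. \<zeta> \<in> ball p R - {p} \<Longrightarrow> has_wirtinger F (a \<zeta>) (b \<zeta>) \<zeta>"
    and conta: "continuous_on (ball p R - {p}) a" and contb: "continuous_on (ball p R - {p}) b"
    and bd: "\<And>\<zeta>. \<zeta> \<in> ball p R - {p} \<Longrightarrow> norm (b \<zeta>) \<le> eps"
    and lim: "((\<lambda>\<zeta>. (\<zeta> - p) * F \<zeta>) \<longlongrightarrow> 0) (at p)"
    and z: "z \<noteq> p" "norm (z - p) \<le> R / 2"
  shows "norm (contour_integral (circlepath p R) (\<lambda>\<zeta>. F \<zeta> / (\<zeta> - z)) - 2 * of_real pi * \<i> * F z) \<le> 16 * pi * R * eps"
proof -
  define E where "E = (\<lambda>t::real. exp (2 * of_real pi * \<i> * of_real t))"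
  define \<rho> where "\<rho> = 2 * norm (z - p)"
  define G where "G = (\<lambda>\<zeta>. if \<zeta> = p then 0 else (\<zeta> - p) * F \<zeta>)"
  have \<rho>: "0 < \<rho>" "\<rho> \<le> R" using z by (auto simp: \<rho>_def)
  have R: "R > 0" using \<rho> by simp
  have normE: "norm (E t) = 1" for t by (simp add: E_def)
  have E0: "E t \<noteq> 0" for t by (simp add: E_def)
  have contE: "continuous_on T E" for T unfolding E_def by (intro continuous_intros)
  have contE2: "continuous_on T (\<lambda>x. E (snd x))" for T :: "(real \<times> real) set"
    by (rule continuous_on_compose2[OF contE[of UNIV]]) (auto intro: continuous_intros)
  have E': "(E has_vector_derivative 2 * of_real pi * \<i> * E t) (at t within T)" for t T
    using exp_circle_vector_derivative[of 0 1 t T] by (simp add: E_def)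
  have "norm (b (p + of_real (R / 2))) \<le> eps"
    using R by (intro bd) (auto simp: dist_norm)
  then have eps: "eps \<ge> 0" using norm_ge_zero order_trans by blast
  have contG: "continuous_on (cball p R) G"
    unfolding continuous_on_eq_continuous_within
  proof
    fix \<zeta> assume \<zeta>: "\<zeta> \<in> cball p R"
    show "continuous (at \<zeta> within cball p R) G"
    proof (cases "\<zeta> = p")
      case True
      have "(G \<longlongrightarrow> 0) (at p)"
        by (rule Lim_transform_eventually[OF lim]) (auto simp: G_def eventually_at_filter)
      then show ?thesis
        using True by (auto simp: continuous_within G_def intro: filterlim_mono at_le)
    next
      case False
      have "continuous_on (cball p R - {p}) (\<lambda>\<zeta>. (\<zeta> - p) * F \<zeta>)"
        by (intro continuous_intros contF)
      then have "continuous_on (cball p R - {p}) G"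
        by (rule continuous_on_eq) (auto simp: G_def)
      then have "continuous (at \<zeta> within cball p R - {p}) G"
        using \<zeta> False by (auto simp: continuous_on_eq_continuous_within)
      then show ?thesis
        using at_within_nhd[of \<zeta> "- {p}" "cball p R" "cball p R - {p}"] False
        by (simp add: Diff_eq Int_assoc open_Compl)
    qed
  qed
  define B1 where "B1 = contour_integral (circlepath p \<rho>) F"
  define B2 where "B2 = contour_integral (circlepath p \<rho>) (\<lambda>\<zeta>. F \<zeta> / (\<zeta> - z))"
  define B3 where "B3 = contour_integral (circlepath p R) (\<lambda>\<zeta>. F \<zeta> / (\<zeta> - z))"
  \<comment> \<open>Contracting to \<open>p\<close> leads to 0, because on these circles
    \<open>F\<close> times \<open>s E\<close> is \<open>G\<close>, and \<open>G\<close> vanishes at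
    \<open>p\<close>.\<close>
  have B1: "norm B1 \<le> 4 * pi * \<rho> * eps * \<rho>"
  proof -
    define K where "K = (\<lambda>s. integral {0..1} (\<lambda>t. G (p + of_real s * E t) * (2 * of_real pi * \<i>)))"
    have "continuous_on ({0..\<rho>} \<times> {0..1}) (\<lambda>(s, t). G (p + of_real s * E t) * (2 * of_real pi * \<i>))"
      unfolding case_prod_beta using \<rho>
      by (intro continuous_intros continuous_on_compose2[OF contG] contE2) (auto simp: dist_norm norm_mult normE)
    then have contK: "continuous_on {0..\<rho>} K"
      using integral_continuous_on_param[of "{0..\<rho>}" 0 1 "\<lambda>s t. G (p + of_real s * E t) * (2 * of_real pi * \<i>)"]
      unfolding K_def by simp
    have "norm (K \<rho> - K 0) \<le> 4 * pi * \<rho> * eps * (\<rho> - 0)"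
    proof (rule contour_family_bound[OF wd conta contb, where c = E and c' = "\<lambda>t. 2 * of_real pi * \<i> * E t" and z = p])
      show "E 0 = E 1" by (simp add: E_def exp_eq_1)
      show inS: "p + of_real s * E t \<in> ball p R - {p}" if "s \<in> {0<..<\<rho>}" for s t
        using that \<rho> E0[of t] by (auto simp: dist_norm norm_mult normE)
      show "K s = integral {0..1} (\<lambda>t. F (p + of_real s * E t) * (of_real s * (2 * of_real pi * \<i> * E t)))"
        if "s \<in> {0<..<\<rho>}" for s
        unfolding K_def G_def using that E0 by (intro integral_cong) auto
      show "2 * s * norm (b (p + of_real s * E t)) * norm (E t) * norm (2 * of_real pi * \<i> * E t) \<le> 4 * pi * \<rho> * eps"
        if s: "s \<in> {0<..<\<rho>}" for s t
      proof -
        have "s * norm (b (p + of_real s * E t)) \<le> \<rho> * eps"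
          using s inS[OF s, of t] by (intro mult_mono bd) (auto simp: \<rho>_def)
        then show ?thesis using pi_gt_zero by (simp add: norm_mult normE)
      qed
    qed (use \<rho> contK E' in \<open>auto intro!: continuous_intros contE\<close>)
    moreover have "K 0 = 0" by (simp add: K_def G_def)
    moreover have "K \<rho> = B1"
      unfolding K_def B1_def contour_integral_circlepath_eq G_def
      using \<rho> E0 by (intro integral_cong) (auto simp: E_def)
    ultimately show ?thesis by simp
  qed
  \<comment> \<open>From (\<zeta> - p)/(\<zeta> - z) = (z - p)/(\<zeta> - z) + 1.\<close>
  have G_int: "contour_integral (circlepath p \<rho>) (\<lambda>\<zeta>. G \<zeta> / (\<zeta> - z)) = (z - p) * B2 + B1"
  proof -
    have sph: "path_image (circlepath p \<rho>) = sphere p \<rho>" using \<rho> by simp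
    have ne: "\<zeta> \<noteq> z" "\<zeta> \<noteq> p" if "\<zeta> \<in> sphere p \<rho>" for \<zeta>
      using that \<rho> z by (auto simp: \<rho>_def dist_norm norm_minus_commute)
    have cF: "continuous_on (sphere p \<rho>) F"
      by (rule continuous_on_subset[OF contF]) (use \<rho> in auto)
    have i1: "F contour_integrable_on circlepath p \<rho>"
      using \<rho> cF by (intro contour_integrable_continuous_circlepath) (auto simp: sph)
    have "continuous_on (sphere p \<rho>) (\<lambda>\<zeta>. F \<zeta> / (\<zeta> - z))"
      using ne(1) by (intro continuous_intros cF) force
    then have i2: "(\<lambda>\<zeta>. F \<zeta> / (\<zeta> - z)) contour_integrable_on circlepath p \<rho>"
      using \<rho> by (intro contour_integrable_continuous_circlepath) (auto simp: sph)
    have "contour_integral (circlepath p \<rho>) (\<lambda>\<zeta>. G \<zeta> / (\<zeta> - z)) =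
        contour_integral (circlepath p \<rho>) (\<lambda>\<zeta>. (z - p) * (F \<zeta> / (\<zeta> - z)) + F \<zeta>)"
    proof (rule contour_integral_eq)
      fix \<zeta> assume "\<zeta> \<in> path_image (circlepath p \<rho>)"
      then have "\<zeta> \<in> sphere p \<rho>" by (simp only: sph)
      from ne[OF this] have "\<zeta> - z \<noteq> 0" "\<zeta> \<noteq> p" by simp_all
      then show "G \<zeta> / (\<zeta> - z) = (z - p) * (F \<zeta> / (\<zeta> - z)) + F \<zeta>"
        by (simp add: G_def divide_simps) (simp add: algebra_simps)
    qed
    also have "\<dots> = (z - p) * B2 + B1"
      unfolding B1_def B2_def
      by (simp only: contour_integral_add[OF contour_integrable_lmul[OF i2] i1] contour_integral_lmul[OF i2])
    finally show ?thesis .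
  qed
  have "norm ((z - p) * B2 + B1 - 2 * of_real pi * \<i> * G z) \<le> 4 * pi * \<rho> * (\<rho> * eps)"
    unfolding G_int[symmetric]
  proof (rule cauchy_approximation[where e = p and a = "\<lambda>\<zeta>. a \<zeta> * (\<zeta> - p) + F \<zeta> * 1" and b = "\<lambda>\<zeta>. b \<zeta> * (\<zeta> - p)"])
    show "continuous_on (cball p \<rho>) G" by (rule continuous_on_subset[OF contG]) (use \<rho> in auto)
    show "has_wirtinger G (a \<zeta> * (\<zeta> - p) + F \<zeta> * 1) (b \<zeta> * (\<zeta> - p)) \<zeta>" if "\<zeta> \<in> ball p \<rho> - {p}" for \<zeta>
    proof -
      have "has_wirtinger (\<lambda>\<zeta>. F \<zeta> * (\<zeta> - p)) (a \<zeta> * (\<zeta> - p) + F \<zeta> * 1) (b \<zeta> * (\<zeta> - p)) \<zeta>"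
        by (intro has_wirtinger_mult_holomorphic wd) (use that \<rho> in \<open>auto intro!: derivative_eq_intros\<close>)
      then show ?thesis
        unfolding has_wirtinger_def
        by (rule has_derivative_transform_within_open[where s = "- {p}"]) (use that in \<open>auto simp: G_def\<close>)
    qed
    have sub: "ball p \<rho> - {p} \<subseteq> ball p R - {p}" "ball p \<rho> - {p} \<subseteq> cball p R - {p}" using \<rho> by auto
    show "continuous_on (ball p \<rho> - {p}) (\<lambda>\<zeta>. a \<zeta> * (\<zeta> - p) + F \<zeta> * 1)"
      by (intro continuous_intros continuous_on_subset[OF conta sub(1)] continuous_on_subset[OF contF sub(2)])
    show "continuous_on (ball p \<rho> - {p}) (\<lambda>\<zeta>. b \<zeta> * (\<zeta> - p))"
      by (intro continuous_intros continuous_on_subset[OF contb sub(1)])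
    show "norm (b \<zeta> * (\<zeta> - p)) \<le> \<rho> * eps" if "\<zeta> \<in> ball p \<rho> - {p}" for \<zeta>
    proof -
      have "norm (b \<zeta>) * norm (\<zeta> - p) \<le> eps * \<rho>"
        using that \<rho> eps by (intro mult_mono bd) (auto simp: dist_norm norm_minus_commute)
      then show ?thesis by (simp add: norm_mult mult.commute)
    qed
  qed (use \<rho> z in \<open>auto simp: \<rho>_def dist_norm norm_minus_commute\<close>)
  then have "norm ((z - p) * B2 + B1 - 2 * of_real pi * \<i> * G z) + norm B1 \<le> 8 * pi * \<rho> * \<rho> * eps"
    using B1 by (simp add: algebra_simps)
  moreover have "(z - p) * (B2 - 2 * of_real pi * \<i> * F z) = ((z - p) * B2 + B1 - 2 * of_real pi * \<i> * G z) - B1"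
    using z by (simp add: G_def algebra_simps)
  ultimately have "norm (z - p) * norm (B2 - 2 * of_real pi * \<i> * F z) \<le> 8 * pi * \<rho> * \<rho> * eps"
    by (metis norm_mult norm_triangle_ineq4 order_trans)
  then have "norm (z - p) * norm (B2 - 2 * of_real pi * \<i> * F z) \<le> norm (z - p) * (16 * pi * \<rho> * eps)"
    by (simp add: \<rho>_def algebra_simps)
  then have C2: "norm (B2 - 2 * of_real pi * \<i> * F z) \<le> 16 * pi * \<rho> * eps"
    using z by simp
  \<comment> \<open>On a circle of radius s \<ge> \<rho> = 2|z - p| the distance to \<open>z\<close>
    is at least s/2, which bounds the kernel by 2/s.\<close>
  have C3: "norm (B3 - B2) \<le> 8 * pi * eps * (R - \<rho>)"
  proof -
    define K where "K = (\<lambda>s. integral {0..1} (\<lambda>t. F (p + of_real s * E t) * inverse (p + of_real s * E t - z) * (of_real s * (2 * of_real pi * \<i> * E t))))"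
    have far: "s / 2 \<le> norm (p + of_real s * E t - z)" if "\<rho> \<le> s" for s t
    proof -
      have "norm (of_real s * E t) \<le> norm (p + of_real s * E t - z) + norm (z - p)"
        using norm_triangle_ineq[of "p + of_real s * E t - z" "z - p"] by simp
      moreover have "norm (of_real s * E t) = s" using that \<rho> by (simp add: norm_mult normE)
      ultimately show ?thesis using that by (simp add: \<rho>_def)
    qed
    then have nz: "p + of_real s * E t - z \<noteq> 0" if "\<rho> \<le> s" for s t
      using that \<rho> by (metis half_gt_zero_iff norm_eq_zero not_less order_less_le_trans)
    have "continuous_on ({\<rho>..R} \<times> {0..1}) (\<lambda>(s, t). F (p + of_real s * E t) * inverse (p + of_real s * E t - z) * (of_real s * (2 * of_real pi * \<i> * E t)))"
      unfolding case_prod_beta using \<rho> nz E0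
      by (intro continuous_intros continuous_on_compose2[OF contF] contE2) (auto simp: dist_norm norm_mult normE)
    then have contK: "continuous_on {\<rho>..R} K"
      using integral_continuous_on_param[of "{\<rho>..R}" 0 1 "\<lambda>s t. F (p + of_real s * E t) * inverse (p + of_real s * E t - z) * (of_real s * (2 * of_real pi * \<i> * E t))"]
      unfolding K_def by simp
    have "norm (K R - K \<rho>) \<le> 8 * pi * eps * (R - \<rho>)"
    proof (rule contour_family_bound[where S = "ball p R - {p} - {z}" and \<phi> = "\<lambda>\<zeta>. F \<zeta> * inverse (\<zeta> - z)"
      and a = "\<lambda>\<zeta>. a \<zeta> * inverse (\<zeta> - z) + F \<zeta> * (- inverse (\<zeta> - z) * inverse (\<zeta> - z))"
      and b = "\<lambda>\<zeta>. b \<zeta> * inverse (\<zeta> - z)" and c = E and c' = "\<lambda>t. 2 * of_real pi * \<i> * E t" and z = p])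
      show "has_wirtinger (\<lambda>\<zeta>. F \<zeta> * inverse (\<zeta> - z)) (a \<zeta> * inverse (\<zeta> - z) + F \<zeta> * (- inverse (\<zeta> - z) * inverse (\<zeta> - z)))
        (b \<zeta> * inverse (\<zeta> - z)) \<zeta>" if "\<zeta> \<in> ball p R - {p} - {z}" for \<zeta>
        using that by (intro has_wirtinger_mult_holomorphic wd) (auto intro!: derivative_eq_intros)
      show "continuous_on (ball p R - {p} - {z}) (\<lambda>\<zeta>. a \<zeta> * inverse (\<zeta> - z) + F \<zeta> * (- inverse (\<zeta> - z) * inverse (\<zeta> - z)))"
        by (intro continuous_intros continuous_on_subset[OF contF] continuous_on_subset[OF conta]) auto
      show "continuous_on (ball p R - {p} - {z}) (\<lambda>\<zeta>. b \<zeta> * inverse (\<zeta> - z))"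
        by (intro continuous_intros continuous_on_subset[OF contb]) auto
      show "E 0 = E 1" by (simp add: E_def exp_eq_1)
      show inS: "p + of_real s * E t \<in> ball p R - {p} - {z}" if "s \<in> {\<rho><..<R}" for s t
        using that \<rho> E0[of t] nz[of s t] by (auto simp: dist_norm norm_mult normE)
      show "2 * s * norm (b (p + of_real s * E t) * inverse (p + of_real s * E t - z)) * norm (E t) * norm (2 * of_real pi * \<i> * E t) \<le> 8 * pi * eps"
        if s: "s \<in> {\<rho><..<R}" for s t
      proof -
        have "norm (b (p + of_real s * E t)) \<le> eps" using inS[OF s, of t] by (intro bd) auto
        moreover have "s * inverse (norm (p + of_real s * E t - z)) \<le> 2"
          using far[of s t] s nz[of s t] by (simp add: field_simps)
        ultimately have "norm (b (p + of_real s * E t)) * (s * inverse (norm (p + of_real s * E t - z))) \<le> eps * 2"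
          using s \<rho> eps by (intro mult_mono) auto
        then show ?thesis using pi_gt_zero by (simp add: norm_mult norm_inverse normE algebra_simps)
      qed
    qed (use \<rho> contK E' K_def in \<open>auto intro!: continuous_intros contE\<close>)
    moreover have "K R = B3" "K \<rho> = B2"
      unfolding K_def B2_def B3_def contour_integral_circlepath_eq by (auto simp: E_def field_simps)
    ultimately show ?thesis by simp
  qed
  have "norm (B3 - 2 * of_real pi * \<i> * F z) \<le> norm (B3 - B2) + norm (B2 - 2 * of_real pi * \<i> * F z)"
    using norm_triangle_ineq[of "B3 - B2" "B2 - 2 * of_real pi * \<i> * F z"] by simp
  also have "\<dots> \<le> 8 * pi * eps * (R - \<rho>) + 16 * pi * \<rho> * eps"
    using C2 C3 by simp
  also have "\<dots> \<le> 16 * pi * eps * (R - \<rho>) + 16 * pi * \<rho> * eps"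
    using eps \<rho> by (intro add_right_mono mult_right_mono) auto
  finally show ?thesis unfolding B3_def by (simp add: algebra_simps)
qed

lemma has_wirtinger_lipschitz:
  assumes "convex S" and wd: "\<And>z. z \<in> S \<Longrightarrow> has_wirtinger f (a z) (b z) z"
    and bd: "\<And>z. z \<in> S \<Longrightarrow> norm (a z) + norm (b z) \<le> M" and "x \<in> S" "y \<in> S"
  shows "norm (f x - f y) \<le> M * norm (x - y)"
proof (rule differentiable_bound[OF \<open>convex S\<close> _ _ \<open>x \<in> S\<close> \<open>y \<in> S\<close>])
  show "(f has_derivative (\<lambda>h. a z * h + b z * cnj h)) (at z within S)" if "z \<in> S" for z
    using wd[OF that] unfolding has_wirtinger_def by (rule has_derivative_at_withinI)
  show "onorm (\<lambda>h. a z * h + b z * cnj h) \<le> M" if "z \<in> S" for z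
  proof (rule onorm_bound)
    show "M \<ge> 0" using bd[OF that] by (meson add_nonneg_nonneg norm_ge_zero order_trans)
    fix h
    have "norm (a z * h + b z * cnj h) \<le> (norm (a z) + norm (b z)) * norm h"
      by (metis complex_mod_cnj distrib_right norm_mult norm_triangle_ineq)
    also have "\<dots> \<le> M * norm h" using bd[OF that] by (intro mult_right_mono) auto
    finally show "norm (a z * h + b z * cnj h) \<le> M * norm h" .
  qed
qed

subsection \<open>Vanishing order\<close>

text \<open>Division by the holomorphic \<open>(\<zeta> - p)^n\<close> divides \<open>b\<close> by
  the same power; the growth condition on \<open>b\<close> is what keeps the result bounded.\<close>

lemma quotient_approximation:
  fixes f a b :: "complex \<Rightarrow> complex"
  assumes sub: "cball p R \<subseteq> S"
    and wd: "\<And>\<zeta>. \<zeta> \<in> S \<Longrightarrow> has_wirtinger f (a \<zeta>) (b \<zeta>) \<zeta>"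
    and conta: "continuous_on S a" and contb: "continuous_on S b"
    and bd: "\<And>\<zeta>. \<zeta> \<in> ball p R - {p} \<Longrightarrow> norm (b \<zeta>) \<le> eps * norm (\<zeta> - p) ^ n"
    and lim: "((\<lambda>\<zeta>. (\<zeta> - p) * (f \<zeta> / (\<zeta> - p) ^ n)) \<longlongrightarrow> 0) (at p)"
    and z: "z \<noteq> p" "norm (z - p) \<le> R / 2"
  shows "norm (contour_integral (circlepath p R) (\<lambda>\<zeta>. f \<zeta> / (\<zeta> - p) ^ n / (\<zeta> - z)) - 2 * of_real pi * \<i> * (f z / (z - p) ^ n)) \<le> 16 * pi * R * eps"
proof (rule cauchy_approximation_punctured[where b = "\<lambda>\<zeta>. b \<zeta> * inverse ((\<zeta> - p) ^ n)"
      and a = "\<lambda>\<zeta>. a \<zeta> * inverse ((\<zeta> - p) ^ n) + f \<zeta> * (- (of_nat n * (\<zeta> - p) ^ (n - 1)) * inverse ((\<zeta> - p) ^ n) * inverse ((\<zeta> - p) ^ n))", OF _ _ _ _ _ lim z])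
  have S: "ball p R - {p} \<subseteq> S" "cball p R - {p} \<subseteq> S" using sub ball_subset_cball by blast+
  have contf: "continuous_on S f" using wd by (rule has_wirtinger_imp_continuous_on)
  show "continuous_on (cball p R - {p}) (\<lambda>\<zeta>. f \<zeta> / (\<zeta> - p) ^ n)"
    by (intro continuous_intros continuous_on_subset[OF contf S(2)]) auto
  show "has_wirtinger (\<lambda>\<zeta>. f \<zeta> / (\<zeta> - p) ^ n)
      (a \<zeta> * inverse ((\<zeta> - p) ^ n) + f \<zeta> * (- (of_nat n * (\<zeta> - p) ^ (n - 1)) * inverse ((\<zeta> - p) ^ n) * inverse ((\<zeta> - p) ^ n)))
      (b \<zeta> * inverse ((\<zeta> - p) ^ n)) \<zeta>" if "\<zeta> \<in> ball p R - {p}" for \<zeta>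
    unfolding divide_inverse using that S
    by (intro has_wirtinger_mult_holomorphic wd) (auto intro!: derivative_eq_intros)
  show "continuous_on (ball p R - {p}) (\<lambda>\<zeta>. b \<zeta> * inverse ((\<zeta> - p) ^ n))"
    by (intro continuous_intros continuous_on_subset[OF contb S(1)]) auto
  show "continuous_on (ball p R - {p}) (\<lambda>\<zeta>. a \<zeta> * inverse ((\<zeta> - p) ^ n) + f \<zeta> * (- (of_nat n * (\<zeta> - p) ^ (n - 1)) * inverse ((\<zeta> - p) ^ n) * inverse ((\<zeta> - p) ^ n)))"
    by (intro continuous_intros continuous_on_subset[OF conta S(1)] continuous_on_subset[OF contf S(1)]) auto
  show "norm (b \<zeta> * inverse ((\<zeta> - p) ^ n)) \<le> eps" if "\<zeta> \<in> ball p R - {p}" for \<zeta>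
    using bd[OF that] that
    by (simp add: divide_inverse[symmetric] norm_divide norm_power pos_divide_le_eq)
qed

lemma cauchy_integral_holomorphic:
  assumes R: "0 < R" and cont: "continuous_on (sphere p R) g"
  shows "(\<lambda>z. contour_integral (circlepath p R) (\<lambda>\<zeta>. g \<zeta> / (\<zeta> - z))) holomorphic_on ball p R"
  unfolding holomorphic_on_def
proof
  fix z assume z: "z \<in> ball p R"
  let ?I = "\<lambda>z. contour_integral (circlepath p R) (\<lambda>\<zeta>. g \<zeta> / (\<zeta> - z))"
  have "((\<lambda>u. g u / (u - x) ^ 1) has_contour_integral ?I x) (circlepath p R)" if "x \<in> ball p R" for x
  proof -
    have "u - x \<noteq> 0" if "u \<in> sphere p R" for u using that \<open>x \<in> ball p R\<close> by auto
    then have "continuous_on (sphere p R) (\<lambda>u. g u / (u - x))"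
      by (intro continuous_intros cont) auto
    then have "(\<lambda>u. g u / (u - x)) contour_integrable_on circlepath p R"
      using R by (intro contour_integrable_continuous_circlepath) simp
    then show ?thesis by (simp add: has_contour_integral_integral)
  qed
  then have "\<exists>d. (?I has_field_derivative d) (at z)"
    using Cauchy_next_derivative_circlepath(2)[of p R g 1 ?I z] cont R z by auto
  then show "?I field_differentiable (at z within ball p R)"
    unfolding field_differentiable_def using has_field_derivative_at_within by blast
qed

lemma cauchy_integral_norm_bound:
  assumes "R > 0" "continuous_on (sphere p R) g" "\<And>\<zeta>. \<zeta> \<in> sphere p R \<Longrightarrow> norm (g \<zeta>) \<le> m" "norm (z - p) \<le> R / 2"
  shows "norm (contour_integral (circlepath p R) (\<lambda>\<zeta>. g \<zeta> / (\<zeta> - z))) \<le> 4 * pi * m"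
proof -
  have far: "R / 2 \<le> norm (\<zeta> - z)" if "\<zeta> \<in> sphere p R" for \<zeta>
  proof -
    have "norm (\<zeta> - p) \<le> norm (\<zeta> - z) + norm (z - p)"
      using norm_triangle_ineq[of "\<zeta> - z" "z - p"] by simp
    then show ?thesis using that assms(4) by (simp add: dist_norm norm_minus_commute)
  qed
  have ne: "\<zeta> - z \<noteq> 0" if "\<zeta> \<in> sphere p R" for \<zeta>
    using far[OF that] assms(1) by force
  have "norm (g (p + of_real R)) \<le> m" using assms(1) by (intro assms(3)) (simp add: dist_norm)
  then have m: "m \<ge> 0" using norm_ge_zero order_trans by blast
  have "continuous_on (sphere p R) (\<lambda>\<zeta>. g \<zeta> / (\<zeta> - z))"
    using ne by (intro continuous_intros assms) force
  then have "((\<lambda>\<zeta>. g \<zeta> / (\<zeta> - z)) has_contour_integral contour_integral (circlepath p R) (\<lambda>\<zeta>. g \<zeta> / (\<zeta> - z))) (circlepath p R)"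
    using assms(1) by (intro has_contour_integral_integral contour_integrable_continuous_circlepath) simp
  then have "norm (contour_integral (circlepath p R) (\<lambda>\<zeta>. g \<zeta> / (\<zeta> - z))) \<le> (m / (R / 2)) * (2 * pi * R)"
  proof (rule has_contour_integral_bound_circlepath)
    fix \<zeta> assume "norm (\<zeta> - p) = R"
    then have s: "\<zeta> \<in> sphere p R" by (simp add: dist_norm norm_minus_commute)
    show "norm (g \<zeta> / (\<zeta> - z)) \<le> m / (R / 2)"
      unfolding norm_divide using far[OF s] assms(1) assms(3)[OF s] m by (intro frac_le) auto
  qed (use assms(1) m in auto)
  then show ?thesis using assms(1) by (simp add: field_simps)
qed

text \<open>The Cauchy criterion with a centre that may change with \<open>e\<close>. The centres
  will come from Cauchy integrals over circles whose radius shrinks with \<open>e\<close>.\<close>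

lemma cauchy_tendsto_metric:
  fixes f :: "'a \<Rightarrow> complex"
  assumes "F \<noteq> bot" "\<And>e. e > 0 \<Longrightarrow> \<exists>c. \<forall>\<^sub>F x in F. dist (f x) c < e"
  shows "\<exists>l. (f \<longlongrightarrow> l) F"
proof -
  have "cauchy_filter (filtermap f F)"
    unfolding cauchy_filter_metric_filtermap
  proof (intro allI impI)
    fix e :: real assume "e > 0"
    then obtain c where "\<forall>\<^sub>F x in F. dist (f x) c < e / 2" using assms(2)[of "e / 2"] by auto
    moreover have "dist (f x) (f y) < e" if "dist (f x) c < e / 2" "dist (f y) c < e / 2" for x y
      using that by (rule dist_triangle_half_l)
    ultimately show "\<exists>P. eventually P F \<and> (\<forall>x y. P x \<and> P y \<longrightarrow> dist (f x) (f y) < e)" by blast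
  qed
  then show ?thesis
    using cauchy_filter_complete_converges[of "filtermap f F" UNIV] assms(1)
    by (auto simp: complete_UNIV filterlim_def filtermap_bot_iff)
qed

text \<open>The hypothesis is quadratic in \<open>f\<close>, hence each division by \<open>\<zeta> - p\<close> leaves a function with
  bounded antiholomorphic derivative; this rules out fractional vanishing orders.\<close>

lemma vanishing_order:
  fixes f a b :: "complex \<Rightarrow> complex"
  assumes "open S" "p \<in> S"
    and wd: "\<And>\<zeta>. \<zeta> \<in> S \<Longrightarrow> has_wirtinger f (a \<zeta>) (b \<zeta>) \<zeta>"
    and conta: "continuous_on S a" and contb: "continuous_on S b"
    and bd: "\<And>\<zeta>. \<zeta> \<in> S \<Longrightarrow> norm (b \<zeta>) \<le> \<beta> * (norm (f \<zeta>))\<^sup>2"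
    and \<beta>: "\<beta> \<ge> 0" and fp: "f p = 0"
  shows "(\<forall>\<^sub>F \<zeta> in nhds p. f \<zeta> = 0) \<or>
    (\<exists>n\<ge>1. \<exists>c. c \<noteq> 0 \<and> ((\<lambda>\<zeta>. f \<zeta> / (\<zeta> - p) ^ n) \<longlongrightarrow> c) (at p))"
proof -
  obtain r0' where r0': "r0' > 0" "cball p r0' \<subseteq> S" using assms(1,2) open_contains_cball by blast
  \<comment> \<open>A radius of at most 1 makes higher powers of \<open>|\<zeta> - p|\<close> the
    smaller ones.\<close>
  define r0 where "r0 = min r0' 1"
  have r0: "r0 > 0" "cball p r0 \<subseteq> S" "r0 \<le> 1" using r0' by (auto simp: r0_def)
  have contf: "continuous_on S f" using wd by (rule has_wirtinger_imp_continuous_on)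
  have "compact (f ` cball p r0)"
    by (intro compact_continuous_image continuous_on_subset[OF contf r0(2)] compact_cball)
  then have "bounded (f ` cball p r0)" by (rule compact_imp_bounded)
  then obtain m where "m > 0" "\<forall>x\<in>f ` cball p r0. norm x \<le> m" unfolding bounded_pos by blast
  then have m: "m > 0" "\<And>\<zeta>. \<zeta> \<in> cball p r0 \<Longrightarrow> norm (f \<zeta>) \<le> m" by blast+
  define Od where "Od = (\<lambda>n. \<exists>C r. 0 < r \<and> r \<le> r0 \<and> (\<forall>\<zeta>\<in>cball p r. norm (f \<zeta>) \<le> C * norm (\<zeta> - p) ^ n))"
  have Od0: "Od 0" unfolding Od_def using r0 m by (intro exI[of _ m] exI[of _ r0]) auto
  have Od1: "Od 1"
  proof -
    have "compact ((\<lambda>\<zeta>. norm (a \<zeta>) + norm (b \<zeta>)) ` cball p r0)"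
      by (intro compact_continuous_image continuous_intros continuous_on_subset[OF conta r0(2)]
          continuous_on_subset[OF contb r0(2)] compact_cball)
    then have "bounded ((\<lambda>\<zeta>. norm (a \<zeta>) + norm (b \<zeta>)) ` cball p r0)" by (rule compact_imp_bounded)
    then obtain M where "\<forall>x\<in>(\<lambda>\<zeta>. norm (a \<zeta>) + norm (b \<zeta>)) ` cball p r0. norm x \<le> M"
      unfolding bounded_iff by blast
    then have M: "norm (a \<zeta>) + norm (b \<zeta>) \<le> M" if "\<zeta> \<in> cball p r0" for \<zeta>
      using that by force
    have "norm (f \<zeta> - f p) \<le> M * norm (\<zeta> - p)" if "\<zeta> \<in> cball p r0" for \<zeta>
      by (rule has_wirtinger_lipschitz[OF convex_cball, of p r0 f a b]) (use that r0 wd M in \<open>auto simp: subset_iff\<close>)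
    then show ?thesis unfolding Od_def using r0 fp by (intro exI[of _ M] exI[of _ r0]) auto
  qed
  have approx: "norm (contour_integral (circlepath p R) (\<lambda>\<zeta>. f \<zeta> / (\<zeta> - p) ^ n / (\<zeta> - z)) - 2 * of_real pi * \<i> * (f z / (z - p) ^ n)) \<le> 16 * pi * R * eps"
    if "R \<le> r0" "\<And>\<zeta>. \<zeta> \<in> ball p R - {p} \<Longrightarrow> norm (b \<zeta>) \<le> eps * norm (\<zeta> - p) ^ n"
      "((\<lambda>\<zeta>. (\<zeta> - p) * (f \<zeta> / (\<zeta> - p) ^ n)) \<longlongrightarrow> 0) (at p)"
      "z \<noteq> p" "norm (z - p) \<le> R / 2" for n R eps z
    by (rule quotient_approximation[OF _ wd conta contb that(2-5)]) (use that(1) r0(2) in auto)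
  have lim0: "((\<lambda>\<zeta>. (\<zeta> - p) * (f \<zeta> / (\<zeta> - p) ^ n)) \<longlongrightarrow> 0) (at p)" if "Od n" for n
  proof -
    obtain C r where C: "0 < r" "\<And>\<zeta>. \<zeta> \<in> cball p r \<Longrightarrow> norm (f \<zeta>) \<le> C * norm (\<zeta> - p) ^ n"
      using \<open>Od n\<close> unfolding Od_def by blast
    have ev: "\<forall>\<^sub>F \<zeta> in at p. norm ((\<zeta> - p) * (f \<zeta> / (\<zeta> - p) ^ n)) \<le> C * norm (\<zeta> - p)"
      unfolding eventually_at
    proof (intro exI conjI ballI impI)
      fix \<zeta> assume "\<zeta> \<noteq> p \<and> dist \<zeta> p < r"
      then have "\<zeta> \<noteq> p" "norm (f \<zeta>) \<le> C * norm (\<zeta> - p) ^ n" by (auto intro!: C simp: dist_commute less_imp_le)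
      then have "norm (f \<zeta>) / norm (\<zeta> - p) ^ n \<le> C" by (simp add: pos_divide_le_eq)
      then have "norm (\<zeta> - p) * (norm (f \<zeta>) / norm (\<zeta> - p) ^ n) \<le> norm (\<zeta> - p) * C" by (intro mult_left_mono) auto
      then show "norm ((\<zeta> - p) * (f \<zeta> / (\<zeta> - p) ^ n)) \<le> C * norm (\<zeta> - p)"
        by (simp add: norm_mult norm_divide norm_power mult.commute)
    qed (rule C(1))
    have "((\<lambda>\<zeta>. C * norm (\<zeta> - p)) \<longlongrightarrow> C * norm (p - p)) (at p)"
      by (intro tendsto_intros)
    then have "((\<lambda>\<zeta>. C * norm (\<zeta> - p)) \<longlongrightarrow> 0) (at p)" by simp
    then show ?thesis by (rule Lim_null_comparison[OF ev])
  qed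
  \<comment> \<open>The Cauchy integral contributes 4 pi M/R^n on the half disc and the
    approximation error 16 pi R eps; both are divided by 2 pi.\<close>
  have quot: "norm (f z / (z - p) ^ n) \<le> 2 * (M / R ^ n) + 8 * R * eps"
    if "0 < R" "R \<le> r0" "\<And>\<zeta>. \<zeta> \<in> ball p R - {p} \<Longrightarrow> norm (b \<zeta>) \<le> eps * norm (\<zeta> - p) ^ n"
      "((\<lambda>\<zeta>. (\<zeta> - p) * (f \<zeta> / (\<zeta> - p) ^ n)) \<longlongrightarrow> 0) (at p)"
      "z \<noteq> p" "norm (z - p) \<le> R / 2" "\<And>\<zeta>. \<zeta> \<in> sphere p R \<Longrightarrow> norm (f \<zeta>) \<le> M" for n R eps z M
  proof -
    let ?I = "contour_integral (circlepath p R) (\<lambda>\<zeta>. f \<zeta> / (\<zeta> - p) ^ n / (\<zeta> - z))"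
    have "norm ?I \<le> 4 * pi * (M / R ^ n)"
    proof (rule cauchy_integral_norm_bound[OF \<open>0 < R\<close> _ _ that(6)])
      have "sphere p R \<subseteq> S" using r0(2) that(2) by auto
      then show "continuous_on (sphere p R) (\<lambda>\<zeta>. f \<zeta> / (\<zeta> - p) ^ n)"
        using that(1) by (intro continuous_intros continuous_on_subset[OF contf]) auto
      show "norm (f \<zeta> / (\<zeta> - p) ^ n) \<le> M / R ^ n" if "\<zeta> \<in> sphere p R" for \<zeta>
      proof -
        have "norm (\<zeta> - p) = R" using that by (simp add: dist_norm norm_minus_commute)
        then show ?thesis
          using \<open>0 < R\<close> \<open>\<And>\<zeta>. \<zeta> \<in> sphere p R \<Longrightarrow> norm (f \<zeta>) \<le> M\<close>[OF that]
          by (simp add: norm_divide norm_power divide_right_mono)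
      qed
    qed
    moreover have "norm (?I - 2 * of_real pi * \<i> * (f z / (z - p) ^ n)) \<le> 16 * pi * R * eps"
      by (rule approx[OF that(2-6)])
    ultimately have "norm (2 * of_real pi * \<i> * (f z / (z - p) ^ n)) \<le> 4 * pi * (M / R ^ n) + 16 * pi * R * eps"
      by (smt (verit) norm_triangle_sub norm_minus_commute)
    moreover have "norm (2 * of_real pi * \<i> * x) = 2 * pi * norm x" for x
      by (simp add: norm_mult)
    ultimately have "2 * pi * norm (f z / (z - p) ^ n) \<le> 4 * pi * (M / R ^ n) + 16 * pi * R * eps"
      by (simp only:)
    then have "2 * pi * norm (f z / (z - p) ^ n) \<le> 2 * pi * (2 * (M / R ^ n) + 8 * R * eps)"
      by (simp only: distrib_left mult_ac)
    then show ?thesis by (rule mult_left_le_imp_le) simp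
  qed
  show ?thesis
  proof (cases "\<forall>n. Od n")
    case True
    \<comment> \<open>Infinite order forces f = 0 near \<open>p\<close>. The radius, independent of
      \<open>n\<close>, gives 16 R \<beta> m \<le> 1; in the estimate of the supremum
      \<open>s\<close> of |f|/|\<zeta> - p|^n the error term is proportional to \<open>s\<close>,
      hence at most s/2, and can be absorbed.\<close>
    define R where "R = min r0 (1 / (16 * \<beta> * m + 1))"
    have R: "0 < R" "R \<le> r0" "16 * R * \<beta> * m \<le> 1"
    proof -
      have pos: "16 * \<beta> * m + 1 > 0" using \<beta> m by (intro add_nonneg_pos mult_nonneg_nonneg) auto
      show "0 < R" "R \<le> r0" using r0 pos by (auto simp: R_def)
      have "R * (16 * \<beta> * m) \<le> R * (16 * \<beta> * m + 1)" using \<open>0 < R\<close> by (intro mult_left_mono) auto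
      also have "\<dots> \<le> 1 / (16 * \<beta> * m + 1) * (16 * \<beta> * m + 1)"
        using pos by (intro mult_right_mono) (auto simp: R_def)
      finally show "16 * R * \<beta> * m \<le> 1" using pos by (simp add: algebra_simps)
    qed
    have est: "norm (f z) \<le> 4 * m * (2 * norm (z - p) / R) ^ n" if z: "z \<noteq> p" "norm (z - p) \<le> R / 2" for n z
    proof -
      define A where "A = (\<lambda>\<zeta>. norm (f \<zeta>) / norm (\<zeta> - p) ^ n) ` (cball p R - {p})"
      obtain C r where C: "0 < r" "\<And>\<zeta>. \<zeta> \<in> cball p r \<Longrightarrow> norm (f \<zeta>) \<le> C * norm (\<zeta> - p) ^ n"
        using True unfolding Od_def by blast
      have "x \<le> max C (m / r ^ n)" if x: "x \<in> A" for x
      proof -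
        obtain \<zeta> where \<zeta>: "x = norm (f \<zeta>) / norm (\<zeta> - p) ^ n" "\<zeta> \<in> cball p R" "\<zeta> \<noteq> p"
          using x unfolding A_def by blast
        show ?thesis
        proof (cases "\<zeta> \<in> cball p r")
          case True
          then have "x \<le> C" using C(2)[OF True] \<zeta> by (simp add: pos_divide_le_eq)
          then show ?thesis by simp
        next
          case False
          have "x \<le> m / r ^ n"
            unfolding \<zeta>(1) using False C(1) m R \<zeta>
            by (intro frac_le power_mono) (auto simp: dist_norm norm_minus_commute)
          then show ?thesis by simp
        qed
      qed
      \<comment> \<open>Finiteness, from \<open>Od n\<close> near \<open>p\<close> and from the
        bound \<open>m\<close> elsewhere, is what permits subtracting s/2 from both sides
        below.\<close>
      then have bdd: "bdd_above A" by (auto simp: bdd_above_def)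
      define s where "s = Sup A"
      have s: "norm (f \<zeta>) / norm (\<zeta> - p) ^ n \<le> s" if "\<zeta> \<in> cball p R - {p}" for \<zeta>
        unfolding s_def using that by (intro cSup_upper bdd) (auto simp: A_def)
      have s0: "s \<ge> 0"
        by (rule order_trans[OF _ s[of "p + of_real R"]]) (use R in \<open>auto simp: dist_norm\<close>)
      have "\<xi> \<le> 2 ^ n * (2 * (m / R ^ n)) + s / 2" if \<xi>: "\<xi> \<in> A" for \<xi>
      proof -
        obtain \<zeta> where \<zeta>: "\<xi> = norm (f \<zeta>) / norm (\<zeta> - p) ^ n" "\<zeta> \<in> cball p R" "\<zeta> \<noteq> p"
          using \<xi> unfolding A_def by blast
        have one: "1 * (2 * (m / R ^ n)) \<le> 2 ^ n * (2 * (m / R ^ n))"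
          using m R by (intro mult_right_mono one_le_power) auto
        show ?thesis
        proof (cases "norm (\<zeta> - p) \<le> R / 2")
          case True
          have "norm (f \<zeta> / (\<zeta> - p) ^ n) \<le> 2 * (m / R ^ n) + 8 * R * (\<beta> * m * s)"
          proof (rule quot[OF R(1,2) _ lim0 \<zeta>(3) True])
            show "Od n" using \<open>\<forall>n. Od n\<close> by blast
            show "norm (f \<zeta>) \<le> m" if "\<zeta> \<in> sphere p R" for \<zeta> using that R m by auto
            show "norm (b \<zeta>) \<le> \<beta> * m * s * norm (\<zeta> - p) ^ n" if \<zeta>: "\<zeta> \<in> ball p R - {p}" for \<zeta>
            proof -
              \<comment> \<open>One factor of |f|^2 is bounded by the constant \<open>m\<close>, the
                other by \<open>s\<close>, which makes the error linear in \<open>s\<close>.\<close>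
              have fm: "norm (f \<zeta>) \<le> m" using \<zeta> R by (intro m) auto
              have fs: "norm (f \<zeta>) \<le> s * norm (\<zeta> - p) ^ n"
                using s[of \<zeta>] \<zeta> R by (simp add: pos_divide_le_eq)
              have "norm (b \<zeta>) \<le> \<beta> * (norm (f \<zeta>) * norm (f \<zeta>))"
                using bd[of \<zeta>] \<zeta> R subsetD[OF r0(2), of \<zeta>] by (simp add: power2_eq_square)
              also have "\<dots> \<le> \<beta> * (m * (s * norm (\<zeta> - p) ^ n))"
                using fm fs m \<beta> by (intro mult_left_mono mult_mono) auto
              finally show ?thesis by (simp add: mult_ac)
            qed
          qed
          moreover have "8 * R * (\<beta> * m * s) \<le> s / 2"
          proof -
            have "(16 * R * \<beta> * m) * s \<le> 1 * s" by (intro mult_right_mono R(3) s0)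
            then show ?thesis by (simp add: mult_ac)
          qed
          ultimately show ?thesis using one \<zeta>(1) by (simp add: norm_divide norm_power)
        next
          case False
          have "\<xi> \<le> m / (R / 2) ^ n"
            unfolding \<zeta>(1) using False m R \<zeta> by (intro frac_le power_mono) auto
          also have "\<dots> = 2 ^ n * (m / R ^ n)" by (simp add: power_divide)
          also have "\<dots> \<le> 2 ^ n * (2 * (m / R ^ n))"
          proof (rule mult_left_mono)
            have "0 \<le> m / R ^ n" using m R by simp
            then show "m / R ^ n \<le> 2 * (m / R ^ n)" by linarith
          qed simp
          finally show ?thesis using s0 by simp
        qed
      qed
      moreover have zR: "z \<in> cball p R - {p}" using z R by (simp add: dist_norm norm_minus_commute)
      then have "A \<noteq> {}" unfolding A_def by blast
      ultimately have "s \<le> 2 ^ n * (2 * (m / R ^ n)) + s / 2"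
        unfolding s_def by (intro cSup_least) auto
      then have "s \<le> 2 * (2 ^ n * (2 * (m / R ^ n)))" by linarith
      also have "\<dots> = 2 ^ n * (4 * (m / R ^ n))" by simp
      finally have "s \<le> 2 ^ n * (4 * (m / R ^ n))" .
      moreover have "norm (f z) / norm (z - p) ^ n \<le> s" by (rule s[OF zR])
      ultimately have "norm (f z) / norm (z - p) ^ n \<le> 2 ^ n * (4 * (m / R ^ n))" by simp
      then have "norm (f z) \<le> 2 ^ n * (4 * (m / R ^ n)) * norm (z - p) ^ n"
        using z by (simp add: pos_divide_le_eq)
      then show ?thesis by (simp add: power_divide power_mult_distrib mult_ac)
    qed
    have "f z = 0" if z: "dist z p < R / 2" for z
    proof (cases "z = p")
      case False
      have "(\<lambda>n. 4 * m * (2 * norm (z - p) / R) ^ n) \<longlonglongrightarrow> 4 * m * 0"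
        using z R by (intro tendsto_intros LIMSEQ_power_zero) (auto simp: dist_norm)
      moreover have "\<exists>N. \<forall>n\<ge>N. norm (f z) \<le> 4 * m * (2 * norm (z - p) / R) ^ n"
        using est[OF False] z by (auto simp: dist_norm)
      ultimately have "norm (f z) \<le> 4 * m * 0" by (rule LIMSEQ_le_const)
      then show ?thesis by simp
    qed (use fp in simp)
    then have "\<forall>\<^sub>F \<zeta> in nhds p. f \<zeta> = 0"
      unfolding eventually_nhds_metric using R(1) by (intro exI[of _ "R / 2"]) auto
    then show ?thesis by (rule disjI1)
  next
    case False
    define N where "N = (LEAST N. \<not> Od N)"
    have N: "\<not> Od N" using LeastI_ex[of "\<lambda>N. \<not> Od N"] False unfolding N_def by blast
    have N': "Od n" if "n < N" for n using not_less_Least[of n "\<lambda>N. \<not> Od N"] that unfolding N_def by blast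
    have "N \<noteq> 0" using N Od0 by metis
    moreover have "N \<noteq> 1" using N Od1 by metis
    ultimately have n: "N = Suc (N - 1)" "N - 1 \<ge> 1" by linarith+
    define n where "n = N - 1"
    note n = n[folded n_def]
    then have "Od n" using N' by simp
    then obtain C r where C: "0 < r" "r \<le> r0" "\<And>\<zeta>. \<zeta> \<in> cball p r \<Longrightarrow> norm (f \<zeta>) \<le> C * norm (\<zeta> - p) ^ n"
      unfolding Od_def by blast
    have bC: "norm (b \<zeta>) \<le> \<beta> * C\<^sup>2 * norm (\<zeta> - p) ^ (2 * n)" if "\<zeta> \<in> cball p r" for \<zeta>
    proof -
      have "norm (b \<zeta>) \<le> \<beta> * (norm (f \<zeta>))\<^sup>2" using that C(2) r0 by (intro bd) auto
      also have "\<dots> \<le> \<beta> * (C * norm (\<zeta> - p) ^ n)\<^sup>2"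
        using C(3)[OF that] \<beta> by (intro mult_left_mono power_mono) auto
      finally show ?thesis by (simp add: power_mult_distrib power_mult[symmetric] mult_ac)
    qed
    \<comment> \<open>Since n \<ge> 1, the exponent 2n in \<open>bC\<close> is at least n + 1; on
      this disc it can be lowered to \<open>n\<close> or to n + 1.\<close>
    have small: "norm (\<zeta> - p) \<le> 1" if "\<zeta> \<in> cball p r" for \<zeta>
      using that C(2) r0(3) by (auto simp: dist_norm norm_minus_commute)
    have \<beta>C: "0 \<le> \<beta> * C\<^sup>2" using \<beta> by simp
    \<comment> \<open>Up to an error O(R) the quotient is a Cauchy integral, which is holomorphic
      and hence continuous at \<open>p\<close>. Letting \<open>R\<close> shrink with
      \<open>e\<close> gives the Cauchy condition.\<close>
    have "\<exists>l. ((\<lambda>\<zeta>. f \<zeta> / (\<zeta> - p) ^ n) \<longlongrightarrow> l) (at p)"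
    proof (rule cauchy_tendsto_metric)
      show "at p \<noteq> bot" by simp
      fix e :: real assume "e > 0"
      define R where "R = min r (e / (2 * (8 * (\<beta> * C\<^sup>2) + 1)))"
      have pos: "8 * (\<beta> * C\<^sup>2) + 1 > 0" using \<beta>C by simp
      have R: "0 < R" "R \<le> r" using C(1) \<open>e > 0\<close> pos by (auto simp: R_def)
      have Re: "8 * R * (\<beta> * C\<^sup>2) < e / 2"
      proof -
        have "R * (8 * (\<beta> * C\<^sup>2)) < R * (8 * (\<beta> * C\<^sup>2) + 1)" using R by simp
        also have "\<dots> \<le> e / (2 * (8 * (\<beta> * C\<^sup>2) + 1)) * (8 * (\<beta> * C\<^sup>2) + 1)"
          using pos by (intro mult_right_mono) (auto simp: R_def)
        also have "\<dots> = e / 2" using pos by (simp add: field_simps)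
        finally show ?thesis by (simp add: mult_ac)
      qed
      define I where "I = (\<lambda>z. contour_integral (circlepath p R) (\<lambda>\<zeta>. f \<zeta> / (\<zeta> - p) ^ n / (\<zeta> - z)))"
      have ap: "norm (I z - 2 * of_real pi * \<i> * (f z / (z - p) ^ n)) \<le> 16 * pi * R * (\<beta> * C\<^sup>2)"
        if "z \<noteq> p" "norm (z - p) \<le> R / 2" for z
        unfolding I_def
      proof (rule approx[OF _ _ lim0[OF \<open>Od n\<close>] that])
        show "R \<le> r0" using R C by simp
        fix \<zeta> assume "\<zeta> \<in> ball p R - {p}"
        then have \<zeta>: "\<zeta> \<in> cball p r" using R by auto
        have "norm (\<zeta> - p) ^ (2 * n) \<le> norm (\<zeta> - p) ^ n"
          using small[OF \<zeta>] by (intro power_decreasing) auto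
        then show "norm (b \<zeta>) \<le> \<beta> * C\<^sup>2 * norm (\<zeta> - p) ^ n"
          using bC[OF \<zeta>] \<beta>C by (meson mult_left_mono order_trans)
      qed
      have "isCont I p"
      proof -
        have "sphere p R \<subseteq> S" using r0(2) R C by auto
        then have "continuous_on (sphere p R) (\<lambda>\<zeta>. f \<zeta> / (\<zeta> - p) ^ n)"
          using R by (intro continuous_intros continuous_on_subset[OF contf]) auto
        then have "I holomorphic_on ball p R"
          unfolding I_def by (rule cauchy_integral_holomorphic[OF R(1)])
        then show ?thesis
          using holomorphic_on_imp_continuous_on continuous_on_eq_continuous_at[OF open_ball] R(1)
          by (metis centre_in_ball)
      qed
      then have "(I \<longlongrightarrow> I p) (at p)" by (simp add: isCont_def)
      then have "\<forall>\<^sub>F z in at p. dist (I z) (I p) < pi * e"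
        using \<open>e > 0\<close> by (intro tendstoD) auto
      moreover have "\<forall>\<^sub>F z in at p. z \<noteq> p \<and> norm (z - p) \<le> R / 2"
        unfolding eventually_at using R by (intro exI[of _ "R / 2"]) (auto simp: dist_norm)
      ultimately have "\<forall>\<^sub>F z in at p. dist (f z / (z - p) ^ n) (I p / (2 * of_real pi * \<i>)) < e"
      proof eventually_elim
        case (elim z)
        have "16 * pi * R * (\<beta> * C\<^sup>2) < pi * e" using Re pi_gt_zero by (simp add: mult_ac)
        then have "norm (I z - 2 * of_real pi * \<i> * (f z / (z - p) ^ n)) < pi * e"
          using ap[of z] elim(2) by linarith
        then have "norm (2 * of_real pi * \<i> * (f z / (z - p) ^ n) - I z) + norm (I z - I p) < 2 * pi * e"
          using elim(1) by (simp add: dist_norm norm_minus_commute)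
        then have "norm ((2 * of_real pi * \<i> * (f z / (z - p) ^ n) - I z) + (I z - I p)) < 2 * pi * e"
          using norm_triangle_ineq order_le_less_trans by blast
        moreover have "(2 * of_real pi * \<i> * (f z / (z - p) ^ n) - I z) + (I z - I p)
            = 2 * of_real pi * \<i> * (f z / (z - p) ^ n - I p / (2 * of_real pi * \<i>))"
          by (simp add: right_diff_distrib)
        ultimately show ?case using pi_gt_zero by (simp add: norm_mult dist_norm)
      qed
      then show "\<exists>c. \<forall>\<^sub>F z in at p. dist (f z / (z - p) ^ n) c < e" by blast
    qed
    then obtain l where l: "((\<lambda>\<zeta>. f \<zeta> / (\<zeta> - p) ^ n) \<longlongrightarrow> l) (at p)" by blast
    \<comment> \<open>With l = 0 the quotient by the next power satisfies the limit hypothesis of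
      the punctured estimate and is therefore bounded. That is \<open>Od (Suc n)\<close>, against
      the choice of \<open>N\<close>.\<close>
    have "l \<noteq> 0"
    proof
      assume "l = 0"
      have "((\<lambda>\<zeta>. (\<zeta> - p) * (f \<zeta> / (\<zeta> - p) ^ Suc n)) \<longlongrightarrow> 0) (at p)"
        by (rule Lim_transform_eventually[OF l[unfolded \<open>l = 0\<close>]]) (auto simp: eventually_at_filter)
      have q: "norm (f z / (z - p) ^ Suc n) \<le> 2 * (m / r ^ Suc n) + 8 * r * (\<beta> * C\<^sup>2)"
        if "z \<noteq> p" "norm (z - p) \<le> r / 2" for z
      proof (rule quot[OF C(1,2) _ \<open>((\<lambda>\<zeta>. (\<zeta> - p) * (f \<zeta> / (\<zeta> - p) ^ Suc n)) \<longlongrightarrow> 0) (at p)\<close> that])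
        show "norm (f \<zeta>) \<le> m" if "\<zeta> \<in> sphere p r" for \<zeta> using that C m by auto
        fix \<zeta> assume "\<zeta> \<in> ball p r - {p}"
        then have \<zeta>: "\<zeta> \<in> cball p r" by auto
        have "norm (\<zeta> - p) ^ (2 * n) \<le> norm (\<zeta> - p) ^ Suc n"
          using small[OF \<zeta>] n by (intro power_decreasing) auto
        then show "norm (b \<zeta>) \<le> \<beta> * C\<^sup>2 * norm (\<zeta> - p) ^ Suc n"
          using bC[OF \<zeta>] \<beta>C by (meson mult_left_mono order_trans)
      qed
      have "Od (Suc n)"
        unfolding Od_def
      proof (intro exI conjI ballI)
        show "0 < r / 2" "r / 2 \<le> r0" using C by auto
        fix z assume z: "z \<in> cball p (r / 2)"
        show "norm (f z) \<le> (2 * (m / r ^ Suc n) + 8 * r * (\<beta> * C\<^sup>2)) * norm (z - p) ^ Suc n"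
        proof (cases "z = p")
          case False
          then have "norm (f z) / norm (z - p) ^ Suc n \<le> 2 * (m / r ^ Suc n) + 8 * r * (\<beta> * C\<^sup>2)"
            using q[of z] z by (simp add: norm_divide norm_power norm_mult dist_norm norm_minus_commute)
          moreover have "norm (z - p) ^ Suc n > 0" using False by simp
          ultimately show ?thesis by (simp only: pos_divide_le_eq)
        qed (simp add: fp)
      qed
      then show False using N n by simp
    qed
    then show ?thesis using l n by blast
  qed
qed

subsection \<open>Winding number at a zero of the holomorphic derivative\<close>

text \<open>Integration along radii turns the asymptotics of \<open>f\<close> into w(p + h) - w(p) =
  c h^(n+1)/(n+1) with an error of at most M |h|^(n+1)/(n+1), where M < |c| because k < 1. The image
  of a small circle is thus linearly homotopic, away from w(p), to a circle run through n + 1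
  times.\<close>

lemma winding_number_dominant_power:
  fixes w f q :: "complex \<Rightarrow> complex"
  assumes "open S" "p \<in> S"
    and wd: "\<And>\<zeta>. \<zeta> \<in> S \<Longrightarrow> has_wirtinger w (f \<zeta>) (q \<zeta>) \<zeta>"
    and k: "0 \<le> k" "k < 1" and qc: "\<And>\<zeta>. \<zeta> \<in> S \<Longrightarrow> norm (q \<zeta>) \<le> k * norm (f \<zeta>)"
    and lim: "((\<lambda>\<zeta>. f \<zeta> / (\<zeta> - p) ^ n) \<longlongrightarrow> c) (at p)" and c: "c \<noteq> 0"
  shows "\<exists>r>0. cball p r \<subseteq> S \<and> winding_number (w \<circ> circlepath p r) (w p) = of_nat (n + 1)"
proof -
  \<comment> \<open>\<delta> bounds the relative error of \<open>f\<close> and k(1 + \<delta>) the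
    relative size of \<open>q\<close>; this choice keeps their sum at most (1 + k)/2 < 1.\<close>
  define \<delta> where "\<delta> = (1 - k) / 4"
  have \<delta>: "\<delta> > 0" using k by (simp add: \<delta>_def)
  define M where "M = (\<delta> + k * (1 + \<delta>)) * norm c"
  have "\<delta> * k \<le> \<delta> * 1" using k \<delta> by (intro mult_left_mono) auto
  then have "\<delta> + k * (1 + \<delta>) \<le> k + 2 * \<delta>" by (simp add: algebra_simps)
  also have "\<dots> < 1" using k by (simp add: \<delta>_def field_simps)
  finally have "\<delta> + k * (1 + \<delta>) < 1" .
  then have M: "M < norm c" "0 \<le> M" using c \<delta> k by (auto simp: M_def)
  have "\<forall>\<^sub>F \<zeta> in at p. dist (f \<zeta> / (\<zeta> - p) ^ n) c < \<delta> * norm c"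
    using lim \<delta> c by (intro tendstoD) auto
  moreover have "\<forall>\<^sub>F \<zeta> in at p. \<zeta> \<in> S"
    using assms(1,2) by (intro eventually_at_in_open') auto
  ultimately have "\<forall>\<^sub>F \<zeta> in at p. dist (f \<zeta> / (\<zeta> - p) ^ n) c < \<delta> * norm c \<and> \<zeta> \<in> S"
    by (rule eventually_conj)
  then obtain r' where r': "r' > 0" "\<And>\<zeta>. \<zeta> \<noteq> p \<Longrightarrow> dist \<zeta> p < r' \<Longrightarrow> dist (f \<zeta> / (\<zeta> - p) ^ n) c < \<delta> * norm c \<and> \<zeta> \<in> S"
    unfolding eventually_at by auto
  define r where "r = r' / 2"
  have r: "r > 0" "cball p r \<subseteq> S"
  proof -
    show "r > 0" using r' by (simp add: r_def)
    show "cball p r \<subseteq> S"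
    proof
      fix \<zeta> assume "\<zeta> \<in> cball p r"
      then show "\<zeta> \<in> S" using r' assms(2) by (cases "\<zeta> = p") (auto simp: r_def dist_commute)
    qed
  qed
  have fc: "norm (f \<zeta> - c * (\<zeta> - p) ^ n) + norm (q \<zeta>) \<le> M * norm (\<zeta> - p) ^ n"
    if "\<zeta> \<noteq> p" "\<zeta> \<in> cball p r" for \<zeta>
  proof -
    have nz: "(\<zeta> - p) ^ n \<noteq> 0" using that by simp
    have "dist \<zeta> p < r'" using that(2) r' by (simp add: r_def dist_commute)
    then have "norm (f \<zeta> / (\<zeta> - p) ^ n - c) \<le> \<delta> * norm c"
      using r'(2)[OF that(1)] by (simp add: dist_norm less_imp_le)
    moreover have "f \<zeta> - c * (\<zeta> - p) ^ n = (f \<zeta> / (\<zeta> - p) ^ n - c) * (\<zeta> - p) ^ n"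
      using nz by (simp add: field_simps)
    ultimately have 1: "norm (f \<zeta> - c * (\<zeta> - p) ^ n) \<le> \<delta> * norm c * norm (\<zeta> - p) ^ n"
      by (simp only: norm_mult norm_power mult_right_mono zero_le_power norm_ge_zero)
    have "norm (f \<zeta>) \<le> norm (f \<zeta> - c * (\<zeta> - p) ^ n) + norm (c * (\<zeta> - p) ^ n)"
      by (metis add.commute norm_triangle_sub)
    also have "\<dots> \<le> (1 + \<delta>) * norm c * norm (\<zeta> - p) ^ n"
      using 1 by (simp add: norm_mult norm_power algebra_simps)
    finally have "k * norm (f \<zeta>) \<le> k * ((1 + \<delta>) * norm c * norm (\<zeta> - p) ^ n)"
      using k by (intro mult_left_mono) auto
    moreover have "norm (q \<zeta>) \<le> k * norm (f \<zeta>)" using that r by (intro qc) auto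
    ultimately show ?thesis using 1 by (simp add: M_def algebra_simps)
  qed
  have main: "norm (w (p + h) - w p - c / of_nat (Suc n) * h ^ Suc n) \<le> M * norm h ^ Suc n / real (Suc n)"
    if h: "norm h = r" for h
  proof -
    define V where "V = (\<lambda>s::real. w (p + of_real s * h) - c / of_nat (Suc n) * (of_real s * h) ^ Suc n)"
    have inS: "p + of_real s * h \<in> cball p r" if "0 \<le> s" "s \<le> 1" for s :: real
      using that h r by (simp add: dist_norm norm_mult mult_left_le_one_le)
    have contw: "continuous_on S w" using wd by (rule has_wirtinger_imp_continuous_on)
    have "norm (V 1 - V 0) \<le> M * norm h ^ Suc n / real (Suc n) * 1 ^ Suc n - M * norm h ^ Suc n / real (Suc n) * 0 ^ Suc n"
    proof (rule differentiable_bound_general[where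
          f' = "\<lambda>s. (f (p + of_real s * h) * h + q (p + of_real s * h) * cnj h) - c * (of_real s * h) ^ n * h"
          and \<phi>' = "\<lambda>s. M * norm h ^ Suc n * s ^ n"])
      show "continuous_on {0..1} V"
        unfolding V_def using inS r(2) by (intro continuous_intros continuous_on_compose2[OF contw]) auto
      show "continuous_on {0..1} (\<lambda>s. M * norm h ^ Suc n / real (Suc n) * s ^ Suc n)"
        by (intro continuous_intros)
      fix s :: real assume s: "0 < s" "s < 1"
      have d1: "((\<lambda>s. p + complex_of_real s * h) has_vector_derivative h) (at s)"
        by (auto intro!: derivative_eq_intros simp: has_vector_derivative_def scaleR_conv_of_real)
      have d2: "((\<lambda>s. w (p + of_real s * h)) has_vector_derivative
          f (p + of_real s * h) * h + q (p + of_real s * h) * cnj h) (at s)"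
        by (rule has_wirtinger_along_path[OF wd d1]) (use inS[of s] s r(2) in auto)
      have "((\<lambda>x. c / of_nat (Suc n) * (x * h) ^ Suc n) has_field_derivative c * (of_real s * h) ^ n * h) (at (of_real s))"
        by (auto intro!: derivative_eq_intros simp del: power_Suc of_nat_Suc)
      then have d3: "((\<lambda>s. c / of_nat (Suc n) * (of_real s * h) ^ Suc n) has_vector_derivative c * (of_real s * h) ^ n * h) (at s)"
        by (rule has_vector_derivative_real_field)
      show "(V has_vector_derivative (f (p + of_real s * h) * h + q (p + of_real s * h) * cnj h) - c * (of_real s * h) ^ n * h) (at s)"
        unfolding V_def by (rule has_vector_derivative_diff[OF d2 d3])
      show "((\<lambda>s. M * norm h ^ Suc n / real (Suc n) * s ^ Suc n) has_vector_derivative M * norm h ^ Suc n * s ^ n) (at s)"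
        unfolding has_real_derivative_iff_has_vector_derivative[symmetric]
        by (auto intro!: derivative_eq_intros simp del: power_Suc of_nat_Suc)
      have "p + of_real s * h \<noteq> p" using s h r by auto
      from fc[OF this] have "norm (f (p + of_real s * h) - c * (of_real s * h) ^ n) + norm (q (p + of_real s * h)) \<le> M * (s * norm h) ^ n"
        using inS[of s] s by (simp add: norm_mult)
      then have "(norm (f (p + of_real s * h) - c * (of_real s * h) ^ n) + norm (q (p + of_real s * h))) * norm h \<le> M * (s * norm h) ^ n * norm h"
        by (intro mult_right_mono) auto
      moreover have "(f (p + of_real s * h) * h + q (p + of_real s * h) * cnj h) - c * (of_real s * h) ^ n * h
          = (f (p + of_real s * h) - c * (of_real s * h) ^ n) * h + q (p + of_real s * h) * cnj h"
        by (simp add: left_diff_distrib)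
      moreover have "norm (x * h + y * cnj h) \<le> (norm x + norm y) * norm h" for x y
        by (metis complex_mod_cnj distrib_right norm_mult norm_triangle_ineq)
      moreover have "M * (s * norm h) ^ n * norm h = M * norm h ^ Suc n * s ^ n"
        by (simp add: power_mult_distrib)
      ultimately show "norm ((f (p + of_real s * h) * h + q (p + of_real s * h) * cnj h) - c * (of_real s * h) ^ n * h) \<le> M * norm h ^ Suc n * s ^ n"
        by (metis (no_types, lifting) order_trans)
    qed simp
    then show ?thesis by (simp add: V_def algebra_simps)
  qed
  define A where "A = c / of_nat (Suc n) * of_real r ^ Suc n"
  have A0: "A \<noteq> 0" using c r by (simp add: A_def del: of_nat_Suc)
  define \<eta> where "\<eta> = (\<lambda>t::real. w p + A * exp (2 * of_real pi * \<i> * of_real t) ^ Suc n)"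
  have close: "norm (w (circlepath p r t) - \<eta> t) < norm (\<eta> t - w p)" for t
  proof -
    define h where "h = of_real r * exp (2 * of_real pi * \<i> * of_real t)"
    have h: "norm h = r" using r by (simp add: h_def norm_mult)
    have "\<eta> t = w p + c / of_nat (Suc n) * h ^ Suc n" by (simp only: \<eta>_def A_def h_def power_mult_distrib mult.assoc)
    moreover have "circlepath p r t = p + h" by (simp add: circlepath h_def)
    ultimately have "norm (w (circlepath p r t) - \<eta> t) \<le> M * norm h ^ Suc n / real (Suc n)"
      using main[OF h] by (simp add: algebra_simps)
    also have "\<dots> < norm c * norm h ^ Suc n / real (Suc n)"
      using M h r by (intro divide_strict_right_mono mult_strict_right_mono) auto
    also have "\<dots> = norm (\<eta> t - w p)"
      using \<open>\<eta> t = _\<close> by (simp add: norm_mult norm_divide norm_power del: of_nat_Suc)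
    finally show ?thesis .
  qed
  have "winding_number (w \<circ> circlepath p r) (w p) = winding_number \<eta> (w p)"
  proof (rule winding_number_homotopic_loops, rule homotopic_loops_linear)
    have "path_image (circlepath p r) \<subseteq> S" using r by auto
    then show "path (w \<circ> circlepath p r)"
      by (intro path_continuous_image path_circlepath continuous_on_subset[OF has_wirtinger_imp_continuous_on[of S w f q]] wd)
    show "path \<eta>" unfolding path_def \<eta>_def by (intro continuous_intros)
    show "pathfinish (w \<circ> circlepath p r) = pathstart (w \<circ> circlepath p r)"
      by (simp add: pathfinish_compose pathstart_compose)
    show "pathfinish \<eta> = pathstart \<eta>" by (simp add: pathfinish_def pathstart_def \<eta>_def)
    fix t x :: real assume "t \<in> {0..1}"
    show "closed_segment ((w \<circ> circlepath p r) t) (\<eta> t) \<subseteq> - {w p}"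
    proof
      fix y assume "y \<in> closed_segment ((w \<circ> circlepath p r) t) (\<eta> t)"
      then have "norm (y - \<eta> t) \<le> norm (w (circlepath p r t) - \<eta> t)"
        using segment_bound(2)[of y "(w \<circ> circlepath p r) t" "\<eta> t"] by (simp add: norm_minus_commute)
      then show "y \<in> - {w p}" using close[of t] by (auto simp: norm_minus_commute)
    qed
  qed
  also have "\<dots> = winding_number (\<lambda>t. \<eta> t - w p) 0" by (rule winding_number_offset)
  \<comment> \<open>A continuous logarithm of the model curve; its increment over the period is 2 pi
    i (n + 1).\<close>
  also have "(\<lambda>t. \<eta> t - w p) = exp \<circ> (\<lambda>t. Ln A + of_nat (Suc n) * (2 * of_real pi * \<i> * of_real t))"
    using A0 by (auto simp: \<eta>_def exp_add exp_of_nat_mult[symmetric] simp del: power_Suc of_nat_Suc)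
  also have "winding_number \<dots> 0 = of_nat (Suc n)"
    by (subst winding_number_compose_exp) (auto simp: path_def pathfinish_def pathstart_def intro!: continuous_intros)
  finally show ?thesis using r unfolding Suc_eq_plus1 by blast
qed

subsection \<open>Sub- and supersolutions built from the squared modulus\<close>

text \<open>\<open>f\<close> and \<open>q\<close> stand for w_z and w_zbar, and a trailing 1 or 2
  for a further \<partial>/\<partial>z or \<partial>/\<partial>zbar; \<open>mixed\<close> is the
  symmetry of second derivatives. \<open>proper\<close> says that |w| tends to 1 at the circle.
  Injectivity and orientation are left to the lemmas on zeros of \<open>f\<close> and on the
  inverse.\<close>

locale disk_qc =
  fixes w f q f1 f2 q1 q2 :: "complex \<Rightarrow> complex" and k b :: real
  assumes k: "0 \<le> k" "k < 1" and b: "0 \<le> b"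
    and w_wirt: "\<And>z. z \<in> ball 0 1 \<Longrightarrow> has_wirtinger w (f z) (q z) z"
    and f_wirt: "\<And>z. z \<in> ball 0 1 \<Longrightarrow> has_wirtinger f (f1 z) (f2 z) z"
    and q_wirt: "\<And>z. z \<in> ball 0 1 \<Longrightarrow> has_wirtinger q (q1 z) (q2 z) z"
    and mixed: "\<And>z. z \<in> ball 0 1 \<Longrightarrow> q1 z = f2 z"
    and cont_f1: "continuous_on (ball 0 1) f1" and cont_f2: "continuous_on (ball 0 1) f2"
    and dilatation: "\<And>z. z \<in> ball 0 1 \<Longrightarrow> norm (q z) \<le> k * norm (f z)"
    and pde: "\<And>z. z \<in> ball 0 1 \<Longrightarrow> norm (f2 z) \<le> b * (norm (f z))\<^sup>2"
    and norm_w: "\<And>z. z \<in> ball 0 1 \<Longrightarrow> norm (w z) < 1"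
    and proper: "\<And>e. 0 < e \<Longrightarrow> \<exists>R<1. \<forall>z. R \<le> norm z \<and> norm z < 1 \<longrightarrow> 1 - e \<le> norm (w z)"
begin

definition \<rho> :: "complex \<Rightarrow> real" where "\<rho> z = (norm (w z))\<^sup>2"

text \<open>The derivative of \<rho> at \<open>z\<close> in the direction \<open>e\<close>.\<close>

definition \<rho>_d :: "complex \<Rightarrow> complex \<Rightarrow> real" where
  "\<rho>_d e z = 2 * (w z \<bullet> (f z * e + q z * cnj e))"

text \<open>The Laplacian of |w|^2, written with \<Delta>w = 4 f2: a nonnegative gradient part and a
  part controlled by the differential inequality.\<close>

definition \<rho>_lap :: "complex \<Rightarrow> real" where
  "\<rho>_lap z = 4 * ((norm (f z))\<^sup>2 + (norm (q z))\<^sup>2) + 8 * (w z \<bullet> f2 z)"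

lemma cont_w: "continuous_on (ball 0 1) w" and cont_f: "continuous_on (ball 0 1) f"
  by (rule has_wirtinger_imp_continuous_on, erule w_wirt f_wirt)+

lemma norm_q_le: "z \<in> ball 0 1 \<Longrightarrow> norm (q z) \<le> norm (f z)"
  using dilatation[of z] k mult_right_mono[of k 1 "norm (f z)"] by simp

lemma cont_\<rho>: "continuous_on (ball 0 1) \<rho>"
  unfolding \<rho>_def by (intro continuous_intros cont_w)

lemma \<rho>_less_1: "z \<in> ball 0 1 \<Longrightarrow> \<rho> z < 1"
  using norm_w[of z] by (simp add: \<rho>_def power_less_one_iff)

lemma \<rho>_line_deriv:
  assumes "z + of_real s * e \<in> ball 0 1"
  shows "((\<lambda>s. \<rho> (z + of_real s * e)) has_real_derivative \<rho>_d e (z + of_real s * e)) (at s)"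
proof -
  have l: "((\<lambda>s. z + complex_of_real s * e) has_vector_derivative e) (at s)"
    by (auto intro!: derivative_eq_intros simp: has_vector_derivative_def scaleR_conv_of_real)
  note W = has_wirtinger_along_path[OF w_wirt[OF assms] l]
  show ?thesis
    using bounded_bilinear.has_vector_derivative[OF bounded_bilinear_inner W W]
    by (simp add: \<rho>_def \<rho>_d_def power2_norm_eq_inner has_real_derivative_iff_has_vector_derivative inner_commute)
qed

lemma \<rho>_d_line_deriv:
  assumes "z \<in> ball 0 1"
  shows "((\<lambda>s. \<rho>_d e (z + of_real s * e)) has_real_derivative
     2 * (norm (f z * e + q z * cnj e))\<^sup>2 +
     2 * (w z \<bullet> (f1 z * e * e + f2 z * cnj e * e + q1 z * e * cnj e + q2 z * cnj e * cnj e))) (at 0)"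
proof -
  have l: "((\<lambda>s. z + complex_of_real s * e) has_vector_derivative e) (at 0)"
    by (auto intro!: derivative_eq_intros simp: has_vector_derivative_def scaleR_conv_of_real)
  have z: "z + complex_of_real 0 * e \<in> ball 0 1" using assms by simp
  note W = has_wirtinger_along_path[OF w_wirt[OF z] l]
  note F = has_vector_derivative_mult_left[OF has_wirtinger_along_path[OF f_wirt[OF z] l], of e]
  note Q = has_vector_derivative_mult_left[OF has_wirtinger_along_path[OF q_wirt[OF z] l], of "cnj e"]
  have "((\<lambda>s. 2 *\<^sub>R (w (z + of_real s * e) \<bullet> (f (z + of_real s * e) * e + q (z + of_real s * e) * cnj e)))
      has_vector_derivative 2 *\<^sub>R (w z \<bullet> ((f1 z * e + f2 z * cnj e) * e + (q1 z * e + q2 z * cnj e) * cnj e)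
       + (f z * e + q z * cnj e) \<bullet> (f z * e + q z * cnj e))) (at 0)"
    using bounded_linear.has_vector_derivative[OF bounded_linear_scaleR_right 
        bounded_bilinear.has_vector_derivative[OF bounded_bilinear_inner W has_vector_derivative_add[OF F Q]], of 2]
    by simp
  then show ?thesis
    unfolding \<rho>_d_def has_real_derivative_iff_has_vector_derivative power2_norm_eq_inner
    by (simp add: algebra_simps)
qed

lemma eventually_line_in_disk:
  assumes "z \<in> ball (0::complex) 1"
  shows "\<forall>\<^sub>F s in nhds (0::real). z + of_real s * e \<in> ball 0 1"
proof -
  have "((\<lambda>s::real. z + of_real s * e) \<longlongrightarrow> z + of_real 0 * e) (nhds 0)"
    by (intro tendsto_intros filterlim_ident)
  then show ?thesis using assms by (intro topological_tendstoD) auto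
qed

text \<open>In the sum over e = 1 and e = \<i> the terms with \<open>f1\<close> and
  \<open>q2\<close> cancel because 1 + \<i>^2 = 0, those with \<open>f2\<close> and
  \<open>q1\<close> add up by \<open>mixed\<close>, and the cross terms of the squared norms drop
  out.\<close>

lemma second_derivative_sum:
  assumes "z \<in> ball 0 1"
  shows "(2 * (norm (f z * 1 + q z * cnj 1))\<^sup>2 +
       2 * (w z \<bullet> (f1 z * 1 * 1 + f2 z * cnj 1 * 1 + q1 z * 1 * cnj 1 + q2 z * cnj 1 * cnj 1))) +
     (2 * (norm (f z * \<i> + q z * cnj \<i>))\<^sup>2 +
       2 * (w z \<bullet> (f1 z * \<i> * \<i> + f2 z * cnj \<i> * \<i> + q1 z * \<i> * cnj \<i> + q2 z * cnj \<i> * cnj \<i>))) = \<rho>_lap z"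
  using mixed[OF assms] unfolding \<rho>_lap_def cmod_power2 inner_complex_def
  by (simp add: algebra_simps power2_eq_square)

lemma has_laplacian_\<rho>:
  assumes "z \<in> ball 0 1"
  shows "has_laplacian \<rho> z (\<rho>_lap z)"
proof -
  have "has_deriv2 (\<lambda>s. \<rho> (z + of_real s * e)) (2 * (norm (f z * e + q z * cnj e))\<^sup>2 +
     2 * (w z \<bullet> (f1 z * e * e + f2 z * cnj e * e + q1 z * e * cnj e + q2 z * cnj e * cnj e)))" for e
    unfolding has_deriv2_def
    using eventually_mono[OF eventually_line_in_disk[OF assms, of e] \<rho>_line_deriv] \<rho>_d_line_deriv[OF assms, of e]
    by (intro exI conjI)
  from this[of 1] this[of \<i>] show ?thesis
    unfolding has_laplacian_def second_derivative_sum[OF assms, symmetric]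
    by (intro exI conjI refl) (simp_all only: mult_1_right mult.commute[of \<i>])
qed

lemma \<rho>_lap_bound:
  assumes "z \<in> ball 0 1"
  shows "\<bar>\<rho>_lap z\<bar> \<le> (8 + 8 * b) * (norm (f z))\<^sup>2"
proof -
  have 1: "(norm (q z))\<^sup>2 \<le> (norm (f z))\<^sup>2"
    using norm_q_le[OF assms] by (intro power_mono) auto
  have "\<bar>w z \<bullet> f2 z\<bar> \<le> norm (w z) * norm (f2 z)" by (rule Cauchy_Schwarz_ineq2)
  also have "\<dots> \<le> 1 * norm (f2 z)" using norm_w[OF assms] by (intro mult_right_mono) auto
  also have "\<dots> \<le> b * (norm (f z))\<^sup>2" using pde[OF assms] by simp
  finally have "\<bar>8 * (w z \<bullet> f2 z)\<bar> \<le> 8 * (b * (norm (f z))\<^sup>2)" by simp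
  moreover have "\<bar>4 * ((norm (f z))\<^sup>2 + (norm (q z))\<^sup>2)\<bar> \<le> 8 * (norm (f z))\<^sup>2"
    using 1 by simp
  moreover have "(8 + 8 * b) * (norm (f z))\<^sup>2 = 8 * (norm (f z))\<^sup>2 + 8 * (b * (norm (f z))\<^sup>2)"
    by (simp add: algebra_simps)
  ultimately show ?thesis
    unfolding \<rho>_lap_def using abs_triangle_ineq order_trans by linarith
qed

text \<open>\<open>cnj w f + w cnj q\<close> is \<partial>\<rho>/\<partial>z, since \<partial>(cnj
  w)/\<partial>z = cnj q.\<close>

lemma gradient_\<rho>_eq: "\<rho>_d 1 z = 2 * Re (cnj (w z) * f z + w z * cnj (q z))"
    "\<rho>_d \<i> z = - 2 * Im (cnj (w z) * f z + w z * cnj (q z))"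
  by (simp_all add: \<rho>_d_def inner_complex_def algebra_simps)

text \<open>Quasiconformality enters here: |\<partial>\<rho>/\<partial>z| is at least |w|(|f| -
  |q|), and the second factor is at least (1 - k)|f|. Near the boundary \<rho> can therefore be
  stationary only at zeros of \<open>f\<close>.\<close>

lemma gradient_\<rho>_lower:
  assumes "z \<in> ball 0 1" "1 / 2 \<le> norm (w z)"
  shows "(1 - k) * norm (f z) \<le> 2 * norm (cnj (w z) * f z + w z * cnj (q z))"
proof -
  have "norm (w z) * norm (f z) - norm (w z) * norm (q z) \<le> norm (cnj (w z) * f z + w z * cnj (q z))"
    using norm_diff_ineq[of "cnj (w z) * f z" "w z * cnj (q z)"] by (simp add: norm_mult)
  moreover have "(1 / 2) * ((1 - k) * norm (f z)) \<le> norm (w z) * (norm (f z) - norm (q z))"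
  proof (rule mult_mono)
    show "(1 - k) * norm (f z) \<le> norm (f z) - norm (q z)"
      using dilatation[OF assms(1)] by (simp add: algebra_simps)
  qed (use assms(2) k in auto)
  ultimately show ?thesis by (simp add: algebra_simps)
qed

text \<open>The bounds on the Laplacian and on the gradient, combined so that
  \<open>A\<^sub>0\<close> |\<nabla>\<rho>|^2 \<ge> |\<Delta>\<rho>| where |w| \<ge> 1/2.\<close>

definition A\<^sub>0 :: real where "A\<^sub>0 = (8 + 8 * b) / (1 - k)\<^sup>2"

lemma A\<^sub>0_pos: "A\<^sub>0 > 0"
  using k b by (simp add: A\<^sub>0_def)

text \<open>The Laplacian is the function itself times A^2 |\<nabla>\<rho>|^2 - A \<Delta>\<rho>,
  and for |A| = \<open>A\<^sub>0\<close> the square term dominates whatever the sign of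
  \<open>A\<close>.\<close>

lemma has_laplacian_exp_\<rho>:
  assumes z: "z \<in> ball 0 1" and wz: "1 / 2 \<le> norm (w z)" and A: "\<bar>A\<bar> = A\<^sub>0"
  shows "\<exists>L\<ge>0. has_laplacian (\<lambda>\<zeta>. exp (A * (1 - \<rho> \<zeta>))) z L"
proof -
  define D2 where "D2 = (\<lambda>e. 2 * (norm (f z * e + q z * cnj e))\<^sup>2 +
     2 * (w z \<bullet> (f1 z * e * e + f2 z * cnj e * e + q1 z * e * cnj e + q2 z * cnj e * cnj e)))"
  define E where "E = exp (A * (1 - \<rho> z))"
  have line: "has_deriv2 (\<lambda>s. exp (A * (1 - \<rho> (z + of_real s * e)))) (E * (A\<^sup>2 * (\<rho>_d e z)\<^sup>2 - A * D2 e))" for e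
    unfolding has_deriv2_def
  proof (intro exI conjI)
    show "\<forall>\<^sub>F s in nhds 0. ((\<lambda>s. exp (A * (1 - \<rho> (z + of_real s * e)))) has_real_derivative
        exp (A * (1 - \<rho> (z + of_real s * e))) * (A * (- \<rho>_d e (z + of_real s * e)))) (at s)"
      using eventually_line_in_disk[OF z, of e]
      by eventually_elim (auto intro!: derivative_eq_intros \<rho>_line_deriv)
    have 0: "((\<lambda>s. \<rho> (z + of_real s * e)) has_real_derivative \<rho>_d e z) (at 0)"
      using \<rho>_line_deriv[of z 0 e] z by simp
    show "((\<lambda>s. exp (A * (1 - \<rho> (z + of_real s * e))) * (A * (- \<rho>_d e (z + of_real s * e)))) has_real_derivative
        (E * (A\<^sup>2 * (\<rho>_d e z)\<^sup>2 - A * D2 e))) (at 0)"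
      by (rule derivative_eq_intros refl 0 \<rho>_d_line_deriv[OF z])+
        (simp add: E_def D2_def algebra_simps power2_eq_square)
  qed
  define G where "G = (\<rho>_d 1 z)\<^sup>2 + (\<rho>_d \<i> z)\<^sup>2"
  have "has_laplacian (\<lambda>\<zeta>. exp (A * (1 - \<rho> \<zeta>))) z
      (E * (A\<^sup>2 * (\<rho>_d 1 z)\<^sup>2 - A * D2 1) + E * (A\<^sup>2 * (\<rho>_d \<i> z)\<^sup>2 - A * D2 \<i>))"
    unfolding has_laplacian_def using line[of 1] line[of \<i>]
    by (intro exI conjI refl) (simp_all only: mult_1_right mult.commute[of \<i>])
  also have "E * (A\<^sup>2 * (\<rho>_d 1 z)\<^sup>2 - A * D2 1) + E * (A\<^sup>2 * (\<rho>_d \<i> z)\<^sup>2 - A * D2 \<i>) = E * (A\<^sup>2 * G - A * (D2 1 + D2 \<i>))"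
    by (simp add: G_def algebra_simps)
  also have "D2 1 + D2 \<i> = \<rho>_lap z"
    unfolding D2_def by (rule second_derivative_sum[OF z])
  finally have lap: "has_laplacian (\<lambda>\<zeta>. exp (A * (1 - \<rho> \<zeta>))) z (E * (A\<^sup>2 * G - A * \<rho>_lap z))" .
  have G: "G = (2 * norm (cnj (w z) * f z + w z * cnj (q z)))\<^sup>2"
    unfolding G_def gradient_\<rho>_eq power_mult_distrib cmod_power2 by simp
  have "((1 - k) * norm (f z))\<^sup>2 \<le> G"
    unfolding G using gradient_\<rho>_lower[OF z wz] k by (intro power_mono) auto
  then have "A\<^sub>0 * ((1 - k) * norm (f z))\<^sup>2 \<le> A\<^sub>0 * G"
    using A\<^sub>0_pos by (intro mult_left_mono) auto
  moreover have "A\<^sub>0 * ((1 - k) * norm (f z))\<^sup>2 = (8 + 8 * b) * (norm (f z))\<^sup>2"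
    using k by (simp add: A\<^sub>0_def power_mult_distrib)
  ultimately have "\<bar>\<rho>_lap z\<bar> \<le> A\<^sub>0 * G" using \<rho>_lap_bound[OF z] by linarith
  then have "\<bar>A\<bar> * \<bar>\<rho>_lap z\<bar> \<le> A\<^sub>0 * (A\<^sub>0 * G)"
    using A\<^sub>0_pos unfolding A by (intro mult_left_mono) auto
  moreover have "A * \<rho>_lap z \<le> \<bar>A\<bar> * \<bar>\<rho>_lap z\<bar>" by (metis abs_ge_self abs_mult)
  moreover have "A\<^sup>2 = A\<^sub>0 * A\<^sub>0" by (metis A power2_abs power2_eq_square)
  ultimately have "0 \<le> A\<^sup>2 * G - A * \<rho>_lap z" by (simp add: mult.assoc)
  then have "0 \<le> E * (A\<^sup>2 * G - A * \<rho>_lap z)" by (simp add: E_def)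
  then show ?thesis using lap by blast
qed

text \<open>Building blocks of the barriers. The quartic term is there to give a polynomial that
  decreases to its value on the circle and yet has positive Laplacian nearby.\<close>

lemma has_laplacian_norm_power:
  "has_laplacian (\<lambda>\<zeta>. c * (norm \<zeta>)\<^sup>2) z (4 * c)"
  "has_laplacian (\<lambda>\<zeta>. c * ((norm \<zeta>)\<^sup>2)\<^sup>2) z (16 * c * (norm z)\<^sup>2)"
proof -
  show "has_laplacian (\<lambda>\<zeta>. c * (norm \<zeta>)\<^sup>2) z (4 * c)"
    using has_laplacian_quadratic[of c c 0 z] by (simp add: cmod_power2 distrib_left)
  define x y where "x = Re z" and "y = Im z"
  have "has_deriv2 (\<lambda>s. c * ((x + s)\<^sup>2 + y\<^sup>2)\<^sup>2) (c * (8 * x\<^sup>2 + 4 * (x\<^sup>2 + y\<^sup>2)))"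
    by (rule has_deriv2I[where d = "\<lambda>s. c * (2 * ((x + s)\<^sup>2 + y\<^sup>2) * (2 * (x + s)))"])
      (auto intro!: derivative_eq_intros simp: algebra_simps power2_eq_square)
  moreover have "has_deriv2 (\<lambda>s. c * (x\<^sup>2 + (y + s)\<^sup>2)\<^sup>2) (c * (8 * y\<^sup>2 + 4 * (x\<^sup>2 + y\<^sup>2)))"
    by (rule has_deriv2I[where d = "\<lambda>s. c * (2 * (x\<^sup>2 + (y + s)\<^sup>2) * (2 * (y + s)))"])
      (auto intro!: derivative_eq_intros simp: algebra_simps power2_eq_square)
  ultimately show "has_laplacian (\<lambda>\<zeta>. c * ((norm \<zeta>)\<^sup>2)\<^sup>2) z (16 * c * (norm z)\<^sup>2)"
    unfolding has_laplacian_def cmod_power2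
    by (intro exI[of _ "c * (8 * x\<^sup>2 + 4 * (x\<^sup>2 + y\<^sup>2))"] exI[of _ "c * (8 * y\<^sup>2 + 4 * (x\<^sup>2 + y\<^sup>2))"] conjI)
      (simp_all add: x_def y_def algebra_simps)
qed

subsection \<open>Boundary behaviour of the modulus\<close>

lemma proper_square:
  assumes "0 < e"
  shows "\<exists>R<1. \<forall>z. R \<le> norm z \<and> norm z < 1 \<longrightarrow> 1 - \<rho> z \<le> e"
proof -
  obtain R where R: "R < 1" "\<And>z. R \<le> norm z \<Longrightarrow> norm z < 1 \<Longrightarrow> 1 - e / 2 \<le> norm (w z)"
    using proper[of "e / 2"] assms by auto
  have "1 - \<rho> z \<le> e" if "R \<le> norm z" "norm z < 1" for z
  proof -
    have n: "norm (w z) < 1" using norm_w[of z] that by simp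
    have "1 - \<rho> z = (1 - norm (w z)) * (1 + norm (w z))"
      by (simp add: \<rho>_def algebra_simps power2_eq_square)
    also have "\<dots> \<le> (e / 2) * 2"
      using R(2)[OF that] n assms by (intro mult_mono) auto
    finally show ?thesis by simp
  qed
  then show ?thesis using R(1) by blast
qed

text \<open>The value 9/10 ensures |z|^2 > 3/4, the condition under which the barrier of
  \<open>boundary_lower\<close> is strictly subharmonic.\<close>

lemma boundary_annulus:
  obtains r0 where "9 / 10 \<le> r0" "r0 < 1" "\<And>z. r0 \<le> norm z \<Longrightarrow> norm z < 1 \<Longrightarrow> 1 / 2 \<le> norm (w z)"
proof -
  obtain R where R: "R < 1" "\<And>z. R \<le> norm z \<Longrightarrow> norm z < 1 \<Longrightarrow> 1 - 1 / 2 \<le> norm (w z)"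
    using proper[of "1 / 2"] by auto
  show ?thesis
    by (rule that[of "max R (9 / 10)"]) (use R in auto)
qed

text \<open>The subharmonic exponential tends to 1 at the unit circle, and C|z|^2 makes it strictly
  subharmonic. \<open>C\<close> is fixed by the inner circle, where the deficit C(1 - r0^2) must
  equal the trivial bound exp \<open>A\<^sub>0\<close>. The inequality 1 + x \<le> exp x then
  linearises the result.\<close>

lemma boundary_upper:
  assumes r0: "9 / 10 \<le> r0" "r0 < 1" "\<And>z. r0 \<le> norm z \<Longrightarrow> norm z < 1 \<Longrightarrow> 1 / 2 \<le> norm (w z)"
  shows "\<exists>C>0. \<forall>z. r0 \<le> norm z \<and> norm z < 1 \<longrightarrow> 1 - \<rho> z \<le> C * (1 - norm z)"
proof -
  have r02: "r0\<^sup>2 < 1" using r0 by (simp add: power_less_one_iff)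
  define C where "C = exp A\<^sub>0 / (1 - r0\<^sup>2)"
  have C: "C > 0" using r02 by (simp add: C_def)
  have "1 - \<rho> z \<le> (2 * C / A\<^sub>0) * (1 - norm z)" if z: "r0 \<le> norm z" "norm z < 1" for z
  proof -
    have "exp (A\<^sub>0 * (1 - \<rho> z)) + C * (norm z)\<^sup>2 \<le> 1 + C"
    proof (rule strict_max_principle_exhaustion[of r0 "\<lambda>\<zeta>. exp (A\<^sub>0 * (1 - \<rho> \<zeta>)) + C * (norm \<zeta>)\<^sup>2"])
      show "continuous_on (ball 0 1 - ball 0 r0) (\<lambda>\<zeta>. exp (A\<^sub>0 * (1 - \<rho> \<zeta>)) + C * (norm \<zeta>)\<^sup>2)"
        by (intro continuous_intros continuous_on_subset[OF cont_\<rho>]) auto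
      show "\<exists>L>0. has_laplacian (\<lambda>\<zeta>. exp (A\<^sub>0 * (1 - \<rho> \<zeta>)) + C * (norm \<zeta>)\<^sup>2) z L"
        if z: "r0 < norm z" "norm z < 1" for z
      proof -
        obtain L where L: "L \<ge> 0" "has_laplacian (\<lambda>\<zeta>. exp (A\<^sub>0 * (1 - \<rho> \<zeta>))) z L"
          using has_laplacian_exp_\<rho>[of z A\<^sub>0] r0(3)[of z] z A\<^sub>0_pos by auto
        show ?thesis
          using has_laplacian_add[OF L(2) has_laplacian_norm_power(1)[of C z]] L(1) C
          by (intro exI[of _ "L + 4 * C"]) auto
      qed
      show "exp (A\<^sub>0 * (1 - \<rho> z)) + C * (norm z)\<^sup>2 \<le> 1 + C" if "norm z = r0" for z
      proof -
        have "exp (A\<^sub>0 * (1 - \<rho> z)) \<le> exp A\<^sub>0" using A\<^sub>0_pos by (simp add: \<rho>_def)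
        also have "exp A\<^sub>0 = C * (1 - r0\<^sup>2)" using r02 by (simp add: C_def)
        finally show ?thesis using that by (simp add: algebra_simps)
      qed
      show "\<exists>R<1. \<forall>z. R \<le> norm z \<and> norm z < 1 \<longrightarrow> exp (A\<^sub>0 * (1 - \<rho> z)) + C * (norm z)\<^sup>2 \<le> 1 + C + e"
        if "e > 0" for e
      proof -
        have "ln (1 + e) / A\<^sub>0 > 0" using that A\<^sub>0_pos by simp
        from proper_square[OF this] obtain R where R: "R < 1"
          "\<And>z. R \<le> norm z \<Longrightarrow> norm z < 1 \<Longrightarrow> 1 - \<rho> z \<le> ln (1 + e) / A\<^sub>0" by blast
        have "exp (A\<^sub>0 * (1 - \<rho> z)) + C * (norm z)\<^sup>2 \<le> 1 + C + e" if "R \<le> norm z" "norm z < 1" for z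
        proof -
          have "A\<^sub>0 * (1 - \<rho> z) \<le> ln (1 + e)"
            using R(2)[OF that] A\<^sub>0_pos by (simp add: field_simps)
          then have "exp (A\<^sub>0 * (1 - \<rho> z)) \<le> exp (ln (1 + e))" by (simp only: exp_le_cancel_iff)
          also have "\<dots> = 1 + e" using \<open>e > 0\<close> by simp
          finally have "exp (A\<^sub>0 * (1 - \<rho> z)) \<le> 1 + e" .
          moreover have "C * (norm z)\<^sup>2 \<le> C * 1"
            using C that by (intro mult_left_mono) (auto simp: power_le_one)
          ultimately show ?thesis by simp
        qed
        then show ?thesis using R(1) by blast
      qed
    qed (use r0 z in auto)
    moreover have "1 + A\<^sub>0 * (1 - \<rho> z) \<le> exp (A\<^sub>0 * (1 - \<rho> z))" by (rule exp_ge_add_one_self)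
    ultimately have "A\<^sub>0 * (1 - \<rho> z) \<le> C * (1 - (norm z)\<^sup>2)" by (simp add: algebra_simps)
    also have "\<dots> \<le> C * (2 * (1 - norm z))"
    proof -
      have "0 \<le> (1 - norm z)\<^sup>2" by simp
      then show ?thesis using C by (intro mult_left_mono) (auto simp: power2_eq_square algebra_simps)
    qed
    finally show ?thesis using A\<^sub>0_pos by (simp add: field_simps)
  qed
  then show ?thesis using C A\<^sub>0_pos by (intro exI[of _ "2 * C / A\<^sub>0"]) auto
qed

text \<open>A Hopf-type estimate. With t = |z|^2, the barrier c((1 - t) + (1 - t)^2) vanishes on the
  unit circle, decreases linearly towards it and has Laplacian c(16t - 12), positive for t > 3/4;
  the plain 1 - t has the wrong sign. The negative exponent keeps the exponential at most 1, with a
  gap on the inner circle that leaves room for the barrier.\<close>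

lemma boundary_lower:
  assumes r0: "9 / 10 \<le> r0" "r0 < 1" "\<And>z. r0 \<le> norm z \<Longrightarrow> norm z < 1 \<Longrightarrow> 1 / 2 \<le> norm (w z)"
  shows "\<exists>c>0. \<forall>z. r0 \<le> norm z \<and> norm z < 1 \<longrightarrow> c * (1 - norm z) \<le> 1 - \<rho> z"
proof -
  have "sphere 0 r0 \<subseteq> ball (0::complex) 1" using r0 by auto
  moreover have "of_real r0 \<in> sphere (0::complex) r0" using r0 by simp
  ultimately obtain m where m: "m \<in> sphere 0 r0" "\<And>\<zeta>. \<zeta> \<in> sphere 0 r0 \<Longrightarrow> \<rho> \<zeta> \<le> \<rho> m"
    using continuous_attains_sup[OF compact_sphere _ continuous_on_subset[OF cont_\<rho>], of 0 r0] by blast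
  have \<rho>m: "\<rho> m < 1" using m(1) r0 by (intro \<rho>_less_1) auto
  \<comment> \<open>Half the gap on the inner circle, because the barrier takes values up to
    2c.\<close>
  define c where "c = (1 - exp (- A\<^sub>0 * (1 - \<rho> m))) / 2"
  have c: "0 < c" "c \<le> 1 / 2" using \<rho>m A\<^sub>0_pos by (auto simp: c_def)
  \<comment> \<open>The polynomial is the barrier minus the constant 2c, whence the bound 1 - 2c
    instead of 1.\<close>
  define g where "g = (\<lambda>\<zeta>. exp (- A\<^sub>0 * (1 - \<rho> \<zeta>)) + ((- 3 * c) * (norm \<zeta>)\<^sup>2 + c * ((norm \<zeta>)\<^sup>2)\<^sup>2))"
  have gz: "g z \<le> 1 - 2 * c" if z: "r0 \<le> norm z" "norm z < 1" for z
  proof (rule strict_max_principle_exhaustion[of r0 g])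
    show "continuous_on (ball 0 1 - ball 0 r0) g"
      unfolding g_def by (intro continuous_intros continuous_on_subset[OF cont_\<rho>]) auto
    show "\<exists>L>0. has_laplacian g z L" if z: "r0 < norm z" "norm z < 1" for z
    proof -
      obtain L where L: "L \<ge> 0" "has_laplacian (\<lambda>\<zeta>. exp (- A\<^sub>0 * (1 - \<rho> \<zeta>))) z L"
        using has_laplacian_exp_\<rho>[of z "- A\<^sub>0"] r0(3)[of z] z A\<^sub>0_pos by auto
      have "(9 / 10)\<^sup>2 \<le> (norm z)\<^sup>2" using z r0 by (intro power_mono) auto
      then have "3 / 4 < (norm z)\<^sup>2" by (simp add: power2_eq_square)
      then have "c * (3 / 4) < c * (norm z)\<^sup>2" using c by simp
      then have "0 < L + (4 * (- 3 * c) + 16 * c * (norm z)\<^sup>2)" using L(1) by simp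
      then show ?thesis
        using has_laplacian_add[OF L(2) has_laplacian_add[OF has_laplacian_norm_power(1)[of "- 3 * c" z]
              has_laplacian_norm_power(2)[of c z]]]
        unfolding g_def by blast
    qed
    have psi: "c * ((1 - (norm z)\<^sup>2) + (1 - (norm z)\<^sup>2)\<^sup>2) \<le> 2 * c * (1 - (norm z)\<^sup>2)" if "norm z \<le> 1" for z :: complex
    proof -
      have s: "0 \<le> 1 - (norm z)\<^sup>2" "1 - (norm z)\<^sup>2 \<le> 1" using that by (auto simp: power_le_one)
      then have "(1 - (norm z)\<^sup>2)\<^sup>2 \<le> 1 - (norm z)\<^sup>2"
        by (simp add: power2_eq_square mult_left_le)
      then have "c * ((1 - (norm z)\<^sup>2) + (1 - (norm z)\<^sup>2)\<^sup>2) \<le> c * (2 * (1 - (norm z)\<^sup>2))"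
        using c by (intro mult_left_mono) auto
      then show ?thesis by (simp only: mult_ac)
    qed
    have g_alt: "g z = exp (- A\<^sub>0 * (1 - \<rho> z)) + c * ((1 - (norm z)\<^sup>2) + (1 - (norm z)\<^sup>2)\<^sup>2) - 2 * c" for z
      by (simp add: g_def algebra_simps power2_eq_square)
    show "g z \<le> 1 - 2 * c" if z: "norm z = r0" for z
    proof -
      have "\<rho> z \<le> \<rho> m" using m(2)[of z] z by simp
      then have "exp (- A\<^sub>0 * (1 - \<rho> z)) \<le> exp (- A\<^sub>0 * (1 - \<rho> m))" using A\<^sub>0_pos by simp
      also have "\<dots> = 1 - 2 * c" by (simp add: c_def field_simps)
      finally have "exp (- A\<^sub>0 * (1 - \<rho> z)) \<le> 1 - 2 * c" .
      moreover have "2 * c * (1 - (norm z)\<^sup>2) \<le> 2 * c * 1" using c by (intro mult_left_mono) auto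
      ultimately show ?thesis using psi[of z] z r0 unfolding g_alt by linarith
    qed
    show "\<exists>R<1. \<forall>z. R \<le> norm z \<and> norm z < 1 \<longrightarrow> g z \<le> 1 - 2 * c + e" if "e > 0" for e
    proof (intro exI[of _ "1 - e / 2"] conjI allI impI)
      fix z :: complex assume z: "1 - e / 2 \<le> norm z \<and> norm z < 1"
      have "exp (- A\<^sub>0 * (1 - \<rho> z)) \<le> 1" using A\<^sub>0_pos \<rho>_less_1[of z] z by simp
      moreover have "2 * c * (1 - (norm z)\<^sup>2) \<le> 1 * e"
      proof (rule mult_mono)
        have "0 \<le> (1 - norm z)\<^sup>2" by simp
        then show "1 - (norm z)\<^sup>2 \<le> e" using z by (simp add: power2_eq_square algebra_simps)
      qed (use c z in \<open>auto simp: power_le_one\<close>)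
      ultimately show "g z \<le> 1 - 2 * c + e" using psi[of z] z unfolding g_alt by linarith
    qed (use that in auto)
  qed (use r0 z in auto)
  have "(c / A\<^sub>0) * (1 - norm z) \<le> 1 - \<rho> z" if z: "r0 \<le> norm z" "norm z < 1" for z
  proof -
    have "1 + - A\<^sub>0 * (1 - \<rho> z) \<le> exp (- A\<^sub>0 * (1 - \<rho> z))" by (rule exp_ge_add_one_self)
    moreover have "g z = exp (- A\<^sub>0 * (1 - \<rho> z)) + c * (1 - (norm z)\<^sup>2) + c * (1 - (norm z)\<^sup>2)\<^sup>2 - 2 * c"
      by (simp add: g_def algebra_simps power2_eq_square)
    moreover have "0 \<le> c * (1 - (norm z)\<^sup>2)\<^sup>2" using c by simp
    ultimately have "c * (1 - (norm z)\<^sup>2) \<le> A\<^sub>0 * (1 - \<rho> z)" using gz[OF z] by simp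
    moreover have "c * (1 - norm z) \<le> c * (1 - (norm z)\<^sup>2)"
      using c z by (intro mult_left_mono) (auto simp: power2_eq_square mult_left_le)
    ultimately show ?thesis using A\<^sub>0_pos by (simp add: field_simps)
  qed
  then show ?thesis using c A\<^sub>0_pos by (intro exI[of _ "c / A\<^sub>0"]) auto
qed

subsection \<open>Upper Lipschitz bound\<close>

lemma norm_f_le_gradient_\<rho>:
  assumes "z \<in> ball 0 1" "1 / 2 \<le> norm (w z)"
  shows "(1 - k) * norm (f z) \<le> \<bar>\<rho>_d 1 z\<bar> + \<bar>\<rho>_d \<i> z\<bar>"
proof -
  have "2 * norm (cnj (w z) * f z + w z * cnj (q z)) \<le> \<bar>\<rho>_d 1 z\<bar> + \<bar>\<rho>_d \<i> z\<bar>"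
    unfolding gradient_\<rho>_eq using cmod_le[of "cnj (w z) * f z + w z * cnj (q z)"]
    by (simp only: abs_mult)
  then show ?thesis using gradient_\<rho>_lower[OF assms] by simp
qed

text \<open>Heinz's device: \<open>(r / 2 - |\<zeta> - z\<^sub>1|) |f \<zeta>|\<close> is maximised over a disc and the gradient estimate is
  applied near the maximum point, where \<open>|f|\<close> is at most doubled.\<close>

lemma f_bound_near_boundary:
  assumes r0: "9 / 10 \<le> r0" "r0 < 1" "\<And>z. r0 \<le> norm z \<Longrightarrow> norm z < 1 \<Longrightarrow> 1 / 2 \<le> norm (w z)"
    and C: "C > 0" "\<And>z. r0 \<le> norm z \<Longrightarrow> norm z < 1 \<Longrightarrow> 1 - \<rho> z \<le> C * (1 - norm z)"
    and P: "P1 = 16 * C / (1 - k)" "P2 = 2 * (8 + 8 * b) * 4 / (1 - k)"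
    and r: "0 < r" "r \<le> (1 - r0) / 2" "4 * P1 * P2 * r < 1" and z1: "norm z1 = 1 - r"
  shows "norm (f z1) \<le> 16 * P1"
proof -
  have P0: "P1 > 0" "P2 > 0" using C k b by (auto simp: P)
  define g where "g = (\<lambda>\<zeta>. (r / 2 - dist z1 \<zeta>) * norm (f \<zeta>))"
  have disc: "r0 \<le> norm \<zeta> \<and> norm \<zeta> < 1 \<and> 1 - norm \<zeta> \<le> 3 * r / 2" if "dist z1 \<zeta> \<le> r / 2" for \<zeta>
  proof -
    have "norm \<zeta> \<le> norm z1 + dist z1 \<zeta>" "norm z1 \<le> norm \<zeta> + dist z1 \<zeta>"
      using norm_triangle_ineq2[of \<zeta> z1] norm_triangle_ineq2[of z1 \<zeta>] by (auto simp: dist_norm norm_minus_commute)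
    then show ?thesis using that z1 r by auto
  qed
  have "continuous_on (cball z1 (r / 2)) g"
    unfolding g_def using disc by (intro continuous_intros continuous_on_subset[OF cont_f]) auto
  moreover have "cball z1 (r / 2) \<noteq> {}" using r by simp
  ultimately obtain z0 where z0: "z0 \<in> cball z1 (r / 2)" "\<And>\<zeta>. \<zeta> \<in> cball z1 (r / 2) \<Longrightarrow> g \<zeta> \<le> g z0"
    using continuous_attains_sup[OF compact_cball] by metis
  define M where "M = g z0"
  define d where "d = r / 2 - dist z1 z0"
  have "M \<le> 8 * P1 * r"
  proof (rule ccontr)
    assume "\<not> M \<le> 8 * P1 * r"
    then have M: "M > 8 * P1 * r" by simp
    then have M0: "M > 0" using P0 r by (smt (verit) mult_pos_pos)
    have d0: "d > 0"
      using z0(1) M0 by (cases "d = 0") (auto simp: M_def g_def d_def)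
    have fM: "norm (f z0) = M / d" using d0 by (simp add: M_def g_def d_def)
    \<comment> \<open>The part of \<open>d\<close> used as half-side of the square. It makes the
      value term of the gradient estimate exactly (1 - k) M/4, and M > 8 P1 r is what gives \<theta>
      \<le> 1/4, so that the square stays within d/2 of \<open>z0\<close>.\<close>
    define \<theta> where "\<theta> = 2 * P1 * r / M"
    have \<theta>: "0 < \<theta>" "\<theta> \<le> 1 / 4" using M M0 P0 r by (auto simp: \<theta>_def field_simps)
    define \<delta> where "\<delta> = \<theta> * d"
    have \<delta>: "0 < \<delta>" "\<delta> \<le> d / 4" using \<theta> d0 by (auto simp: \<delta>_def)
    \<comment> \<open>Twice the bound on \<Delta>\<rho> that follows from |f| \<le> 2M/d; the factor
      2 supplies the strict inequality of the gradient estimate.\<close>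
    define N where "N = 2 * (8 + 8 * b) * 4 * M\<^sup>2 / d\<^sup>2"
    have sq: "dist z1 \<zeta> \<le> r / 2 \<and> norm (f \<zeta>) \<le> 2 * M / d"
      if "\<bar>Re (\<zeta> - z0)\<bar> \<le> \<delta>" "\<bar>Im (\<zeta> - z0)\<bar> \<le> \<delta>" for \<zeta>
    proof -
      have "dist z0 \<zeta> \<le> d / 2"
        using cmod_le[of "\<zeta> - z0"] that \<delta> by (simp add: dist_norm norm_minus_commute)
      then have e: "d / 2 \<le> r / 2 - dist z1 \<zeta>"
        using dist_triangle[of z1 \<zeta> z0] by (simp add: d_def)
      then have "dist z1 \<zeta> \<le> r / 2" using d0 by simp
      moreover have "(d / 2) * norm (f \<zeta>) \<le> g \<zeta>"
        unfolding g_def using e by (intro mult_right_mono) auto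
      ultimately have "(d / 2) * norm (f \<zeta>) \<le> M" using z0(2)[of \<zeta>] by (simp add: M_def)
      then show ?thesis using \<open>dist z1 \<zeta> \<le> r / 2\<close> d0 by (simp add: field_simps)
    qed
    have z0': "dist z1 z0 \<le> r / 2" using z0(1) by simp
    have lap: "\<exists>L. has_laplacian (\<lambda>\<zeta>. \<rho> \<zeta> - 1) \<zeta> L \<and> \<bar>L\<bar> < N"
      if "\<bar>Re (\<zeta> - z0)\<bar> < \<delta>" "\<bar>Im (\<zeta> - z0)\<bar> < \<delta>" for \<zeta>
    proof -
      have s: "dist z1 \<zeta> \<le> r / 2" "norm (f \<zeta>) \<le> 2 * M / d" using sq[of \<zeta>] that by auto
      have \<zeta>: "\<zeta> \<in> ball 0 1" using disc[OF s(1)] by simp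
      have "has_laplacian (\<lambda>\<zeta>. -1 * (norm (1::complex))\<^sup>2) \<zeta> 0"
        unfolding has_laplacian_def
        by (intro exI[of _ 0] conjI has_deriv2I[where d = "\<lambda>_. 0"]) (auto intro!: derivative_eq_intros)
      from has_laplacian_add[OF has_laplacian_\<rho>[OF \<zeta>] this]
      have 1: "has_laplacian (\<lambda>\<zeta>. \<rho> \<zeta> - 1) \<zeta> (\<rho>_lap \<zeta>)" by simp
      have "(norm (f \<zeta>))\<^sup>2 \<le> (2 * M / d)\<^sup>2" using s(2) by (intro power_mono) auto
      then have "(8 + 8 * b) * (norm (f \<zeta>))\<^sup>2 \<le> (8 + 8 * b) * (2 * M / d)\<^sup>2"
        using b by (intro mult_left_mono) auto
      also have "\<dots> = N / 2" using d0 by (simp add: N_def power_divide power_mult_distrib field_simps)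
      also have "\<dots> < N"
      proof -
        have "N > 0" using M0 d0 b by (simp add: N_def add_pos_nonneg)
        then show ?thesis by simp
      qed
      finally show ?thesis using 1 \<rho>_lap_bound[OF \<zeta>] by (intro exI[of _ "\<rho>_lap \<zeta>"]) auto
    qed
    \<comment> \<open>Subtracting 1 matters: 1 - \<rho> is O(r) by the boundary estimate, so the
      value term is of order r/\<delta> and not 1/\<delta>.\<close>
    have bd: "\<bar>\<rho> \<zeta> - 1\<bar> \<le> 2 * C * r" if "\<bar>Re (\<zeta> - z0)\<bar> \<le> \<delta>" "\<bar>Im (\<zeta> - z0)\<bar> \<le> \<delta>" for \<zeta>
    proof -
      have s: "dist z1 \<zeta> \<le> r / 2" using sq[of \<zeta>] that by auto
      note D = disc[OF s]
      have "1 - \<rho> \<zeta> \<le> C * (1 - norm \<zeta>)" using C(2)[of \<zeta>] D by simp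
      also have "\<dots> \<le> C * (2 * r)" using C D r by (intro mult_left_mono) auto
      finally show ?thesis using \<rho>_less_1[of \<zeta>] D by simp
    qed
    have cont: "continuous_on {\<zeta>. \<bar>Re (\<zeta> - z0)\<bar> \<le> \<delta> \<and> \<bar>Im (\<zeta> - z0)\<bar> \<le> \<delta>} (\<lambda>\<zeta>. \<rho> \<zeta> - 1)"
    proof (intro continuous_intros continuous_on_subset[OF cont_\<rho>] subsetI)
      fix \<zeta> assume "\<zeta> \<in> {\<zeta>. \<bar>Re (\<zeta> - z0)\<bar> \<le> \<delta> \<and> \<bar>Im (\<zeta> - z0)\<bar> \<le> \<delta>}"
      then show "\<zeta> \<in> ball 0 1" using sq[of \<zeta>] disc[of \<zeta>] by auto
    qed
    note D0 = disc[OF z0']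
    have z0b: "z0 \<in> ball 0 1" using D0 by simp
    have dx: "((\<lambda>t. \<rho> (z0 + of_real t) - 1) has_real_derivative \<rho>_d 1 z0) (at 0)"
      using \<rho>_line_deriv[of z0 0 1] z0b by (auto intro!: derivative_eq_intros)
    have dy: "((\<lambda>t. \<rho> (z0 + \<i> * of_real t) - 1) has_real_derivative \<rho>_d \<i> z0) (at 0)"
      using \<rho>_line_deriv[of z0 0 \<i>] z0b by (auto intro!: derivative_eq_intros simp: mult.commute[of \<i>])
    have g: "\<bar>\<rho>_d 1 z0\<bar> \<le> 2 * (2 * C * r) / \<delta> + \<delta> * N / 2" "\<bar>\<rho>_d \<i> z0\<bar> \<le> 2 * (2 * C * r) / \<delta> + \<delta> * N / 2"
      using gradient_bound_square[OF \<delta>(1) cont bd lap dx dy] by auto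
    have "(1 - k) * (M / d) \<le> \<bar>\<rho>_d 1 z0\<bar> + \<bar>\<rho>_d \<i> z0\<bar>"
      using norm_f_le_gradient_\<rho>[OF z0b] r0(3)[of z0] D0 fM by simp
    also have "\<dots> \<le> 8 * C * r / \<delta> + \<delta> * N" using g by simp
    finally have "(1 - k) * (M / d) * d \<le> (8 * C * r / \<delta> + \<delta> * N) * d"
      using d0 by (intro mult_right_mono) auto
    moreover have "(8 * C * r / \<delta> + \<delta> * N) * d = 8 * C * r / \<theta> + \<theta> * (2 * (8 + 8 * b) * 4 * M\<^sup>2)"
      using d0 \<theta> by (simp add: \<delta>_def N_def field_simps power2_eq_square)
    ultimately have "(1 - k) * M \<le> 8 * C * r / \<theta> + \<theta> * (2 * (8 + 8 * b) * 4 * M\<^sup>2)" using d0 by simp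
    moreover have "8 * C * r / \<theta> = (1 - k) * (M / 4)"
      using M0 C(1) r(1) k by (simp add: \<theta>_def P(1) field_simps)
    moreover have "\<theta> * (2 * (8 + 8 * b) * 4 * M\<^sup>2) = (1 - k) * (2 * P1 * P2 * r * M)"
      using M0 k by (simp add: \<theta>_def P(2) power2_eq_square)
    ultimately have "(1 - k) * M \<le> (1 - k) * (M / 4 + 2 * P1 * P2 * r * M)" by (simp only: distrib_left)
    then have "M \<le> M / 4 + 2 * P1 * P2 * r * M" using k by simp
    \<comment> \<open>The last term is thus below M/2, which leaves M < 3M/4.\<close>
    moreover have "(4 * P1 * P2 * r) * M < 1 * M" using r(3) M0 by (intro mult_strict_right_mono) auto
    ultimately show False using M0 by simp
  qed
  moreover have "(r / 2) * norm (f z1) \<le> M"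
    using z0(2)[of z1] r by (simp add: M_def g_def)
  ultimately have "(r / 2) * norm (f z1) \<le> (r / 2) * (16 * P1)" by simp
  then show ?thesis using r by simp
qed

lemma f_bounded: "\<exists>C>0. \<forall>z\<in>ball 0 1. norm (f z) \<le> C"
proof -
  obtain r0 where r0: "9 / 10 \<le> r0" "r0 < 1" "\<And>z. r0 \<le> norm z \<Longrightarrow> norm z < 1 \<Longrightarrow> 1 / 2 \<le> norm (w z)"
    using boundary_annulus by blast
  obtain C where C: "C > 0" "\<And>z. r0 \<le> norm z \<Longrightarrow> norm z < 1 \<Longrightarrow> 1 - \<rho> z \<le> C * (1 - norm z)"
    using boundary_upper[OF r0] by blast
  define P1 P2 where "P1 = 16 * C / (1 - k)" and "P2 = 2 * (8 + 8 * b) * 4 / (1 - k)"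
  have P: "P1 > 0" "P2 > 0" using C k b by (auto simp: P1_def P2_def)
  \<comment> \<open>The first bound keeps the discs of radius r/2 inside the annulus, the second
    gives 4 P1 P2 r \<le> 1/2.\<close>
  define r' where "r' = min ((1 - r0) / 2) (1 / (8 * P1 * P2))"
  have r'0: "0 < r'" using P r0 by (simp add: r'_def)
  have r': "r' \<le> (1 - r0) / 2" "r' \<le> 1 / (8 * P1 * P2)"
    unfolding r'_def by (rule min.cobounded1, rule min.cobounded2)
  note r' = r'0 r'
  have "cball 0 (1 - r') \<subseteq> ball (0::complex) 1" using r' by auto
  then have "compact (f ` cball 0 (1 - r'))"
    by (intro compact_continuous_image continuous_on_subset[OF cont_f] compact_cball)
  then have "bounded (f ` cball 0 (1 - r'))" by (rule compact_imp_bounded)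
  then obtain m where m: "m > 0" "\<forall>x\<in>f ` cball 0 (1 - r'). norm x \<le> m" unfolding bounded_pos by blast
  have "norm (f z) \<le> max m (16 * P1)" if z: "z \<in> ball 0 1" for z
  proof (cases "norm z \<le> 1 - r'")
    case True
    then have "norm (f z) \<le> m" using m(2) by simp
    then show ?thesis by simp
  next
    case False
    have "4 * P1 * P2 * (1 - norm z) \<le> 4 * P1 * P2 * (1 / (8 * P1 * P2))"
      using False r' P by (intro mult_left_mono) auto
    also have "\<dots> < 1" using P by simp
    finally have "norm (f z) \<le> 16 * P1"
      by (intro f_bound_near_boundary[OF r0 C P1_def P2_def, of "1 - norm z"]) (use False z r' in auto)
    then show ?thesis by simp
  qed
  then show ?thesis using m(1) by (intro exI[of _ "max m (16 * P1)"]) auto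
qed

end

subsection \<open>Lower bound for the differential\<close>

text \<open>The Schwarz lemma for the Cayley transform (Q - l)/(Q + l). Subtracting the constant
  \<i> Im P(0) makes Q(0) = l, so that the transform vanishes at 0.\<close>

lemma harnack_positive_real_part:
  assumes hol: "P holomorphic_on ball 0 1" and pos: "\<And>z. z \<in> ball 0 1 \<Longrightarrow> 0 < Re (P z)"
    and z: "norm z < 1"
  shows "Re (P 0) * ((1 - norm z) / (1 + norm z)) \<le> Re (P z)"
proof -
  define l where "l = Re (P 0)"
  have l: "l > 0" using pos[of 0] by (simp add: l_def)
  define Q where "Q = (\<lambda>\<zeta>. P \<zeta> - \<i> * of_real (Im (P 0)))"
  have ReQ: "Re (Q \<zeta>) = Re (P \<zeta>)" for \<zeta> by (simp add: Q_def)
  have nz: "Q \<zeta> + of_real l \<noteq> 0" if "\<zeta> \<in> ball 0 1" for \<zeta>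
  proof -
    have "Re (Q \<zeta> + of_real l) > 0" using pos[OF that] l by (simp add: ReQ)
    then show ?thesis by force
  qed
  have "norm ((Q z - of_real l) / (Q z + of_real l)) \<le> norm z"
  proof (rule Schwarz_Lemma(1)[OF _ _ _ z])
    show "(\<lambda>\<zeta>. (Q \<zeta> - of_real l) / (Q \<zeta> + of_real l)) holomorphic_on ball 0 1"
      unfolding Q_def using nz by (intro holomorphic_intros hol) (auto simp: Q_def)
    have "Q 0 = of_real l" by (simp add: Q_def l_def complex_eq_iff)
    then show "(Q 0 - of_real l) / (Q 0 + of_real l) = 0" by simp
    fix \<zeta> :: complex assume "norm \<zeta> < 1"
    then have \<zeta>: "\<zeta> \<in> ball 0 1" by simp
    have "(norm (Q \<zeta> - of_real l))\<^sup>2 < (norm (Q \<zeta> + of_real l))\<^sup>2"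
      unfolding cmod_power2 using pos[OF \<zeta>] l by (simp add: ReQ power2_eq_square algebra_simps)
    then have "norm (Q \<zeta> - of_real l) < norm (Q \<zeta> + of_real l)"
      by (rule power2_less_imp_less) simp
    then show "norm ((Q \<zeta> - of_real l) / (Q \<zeta> + of_real l)) < 1"
      using nz[OF \<zeta>] by (simp add: norm_divide)
  qed
  moreover have "norm (Q z + of_real l) > 0" using nz[of z] z by simp
  ultimately have "norm (Q z - of_real l) \<le> norm z * norm (Q z + of_real l)"
    by (simp add: norm_divide pos_divide_le_eq)
  then have "(norm (Q z - of_real l))\<^sup>2 \<le> (norm z * norm (Q z + of_real l))\<^sup>2"
    by (rule power_mono) simp
  then have "(Re (P z) - l)\<^sup>2 + (Im (Q z))\<^sup>2 \<le> (norm z)\<^sup>2 * ((Re (P z) + l)\<^sup>2 + (Im (Q z))\<^sup>2)"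
    by (simp add: power_mult_distrib cmod_power2[of "Q z - of_real l"] cmod_power2[of "Q z + of_real l"] ReQ)
  \<comment> \<open>The imaginary part can be discarded: it has coefficient 1 on the left and only
    |z|^2 \<le> 1 on the right.\<close>
  moreover have "(norm z)\<^sup>2 * (Im (Q z))\<^sup>2 \<le> 1 * (Im (Q z))\<^sup>2"
    using z by (intro mult_right_mono) (auto simp: power_le_one)
  ultimately have "(Re (P z) - l)\<^sup>2 \<le> (norm z)\<^sup>2 * (Re (P z) + l)\<^sup>2"
    unfolding distrib_left by linarith
  then have "(Re (P z) - l)\<^sup>2 \<le> (norm z * (Re (P z) + l))\<^sup>2"
    by (simp only: power_mult_distrib)
  then have "\<bar>Re (P z) - l\<bar> \<le> \<bar>norm z * (Re (P z) + l)\<bar>"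
    by (simp add: abs_le_square_iff)
  then have "l - Re (P z) \<le> norm z * (Re (P z) + l)"
    using pos[of z] z l by simp
  then have "l * (1 - norm z) \<le> Re (P z) * (1 + norm z)" by (simp add: algebra_simps)
  moreover have "1 + norm z > 0" by (simp add: add_pos_nonneg)
  ultimately have "l * (1 - norm z) / (1 + norm z) \<le> Re (P z)" by (simp add: pos_divide_le_eq)
  then show ?thesis by (simp add: l_def)
qed

context disk_qc
begin

text \<open>If \<open>f\<close> vanished near \<open>p\<close>, so would \<open>q\<close>, and
  \<open>w\<close> would be constant there, against injectivity. A finite order n \<ge> 1 gives
  winding number n + 1 instead of 1.\<close>

lemma f_nonzero:
  assumes inj: "inj_on w (ball 0 1)"
    and winding: "\<And>p r. 0 < r \<Longrightarrow> cball p r \<subseteq> ball 0 1 \<Longrightarrow> winding_number (w \<circ> circlepath p r) (w p) = 1"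
    and p: "p \<in> ball 0 1"
  shows "f p \<noteq> 0"
proof
  assume fp: "f p = 0"
  from vanishing_order[OF open_ball p f_wirt cont_f1 cont_f2 pde b fp]
  show False
  proof
    assume "\<forall>\<^sub>F \<zeta> in nhds p. f \<zeta> = 0"
    then have "\<forall>\<^sub>F \<zeta> in nhds p. f \<zeta> = 0 \<and> \<zeta> \<in> ball 0 1"
      using p by (intro eventually_conj eventually_nhds_in_open) auto
    then obtain e where e: "e > 0" "\<And>\<zeta>. dist \<zeta> p < e \<Longrightarrow> f \<zeta> = 0 \<and> \<zeta> \<in> ball 0 1"
      unfolding eventually_nhds_metric by blast
    have f0: "f \<zeta> = 0" and in1: "\<zeta> \<in> ball 0 1" if "\<zeta> \<in> ball p e" for \<zeta>
      using e(2)[of \<zeta>] that by (simp_all add: dist_commute)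
    have y: "p + of_real (e / 2) \<in> ball p e" using e(1) by (simp add: dist_norm)
    have "norm (w (p + of_real (e / 2)) - w p) \<le> 0 * norm (p + of_real (e / 2) - p)"
    proof (rule has_wirtinger_lipschitz[OF convex_ball])
      show "has_wirtinger w (f \<zeta>) (q \<zeta>) \<zeta>" if "\<zeta> \<in> ball p e" for \<zeta> by (rule w_wirt[OF in1[OF that]])
      show "norm (f \<zeta>) + norm (q \<zeta>) \<le> 0" if "\<zeta> \<in> ball p e" for \<zeta>
        using f0[OF that] norm_q_le[OF in1[OF that]] by simp
    qed (use y e(1) in auto)
    then have "w (p + of_real (e / 2)) = w p" by simp
    then have "p + of_real (e / 2) = p" using inj p in1[OF y] by (auto dest: inj_onD)
    then show False using e(1) by simp
  next
    assume "\<exists>n\<ge>1. \<exists>c. c \<noteq> 0 \<and> ((\<lambda>\<zeta>. f \<zeta> / (\<zeta> - p) ^ n) \<longlongrightarrow> c) (at p)"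
    then obtain n c where n: "n \<ge> 1" "c \<noteq> 0" "((\<lambda>\<zeta>. f \<zeta> / (\<zeta> - p) ^ n) \<longlongrightarrow> c) (at p)" by blast
    obtain r where r: "r > 0" "cball p r \<subseteq> ball 0 1" "winding_number (w \<circ> circlepath p r) (w p) = of_nat (n + 1)"
      using winding_number_dominant_power[OF open_ball p w_wirt k dilatation n(3,2)] by blast
    then have "(of_nat (n + 1) :: complex) = of_nat 1" using winding[OF r(1,2)] by simp
    then have "n + 1 = 1" by (simp only: of_nat_eq_iff)
    then show False using n(1) by simp
  qed
qed

text \<open>On a disc of radius comparable to the distance to the boundary, \<open>1 / f\<close> is a small relative
  perturbation of a zero-free holomorphic function, because its antiholomorphic derivative is
  bounded by \<open>b\<close>. If \<open>f\<close> were tiny at the centre, Harnack's inequality would make it small on nearly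
  the whole disc, and \<open>w\<close> could not approach the boundary linearly.\<close>

lemma f_lower_near_boundary:
  assumes nz: "\<And>z. z \<in> ball 0 1 \<Longrightarrow> f z \<noteq> 0"
  shows "\<exists>\<eta>>0. \<exists>r1>0. \<forall>z. 1 - r1 \<le> norm z \<and> norm z < 1 \<longrightarrow> \<eta> \<le> norm (f z)"
proof -
  obtain r0 where r0: "9 / 10 \<le> r0" "r0 < 1" "\<And>z. r0 \<le> norm z \<Longrightarrow> norm z < 1 \<Longrightarrow> 1 / 2 \<le> norm (w z)"
    using boundary_annulus by blast
  obtain C where C: "C > 0" "\<And>z. r0 \<le> norm z \<Longrightarrow> norm z < 1 \<Longrightarrow> 1 - \<rho> z \<le> C * (1 - norm z)"
    using boundary_upper[OF r0] by blast
  obtain c where c: "c > 0" "\<And>z. r0 \<le> norm z \<Longrightarrow> norm z < 1 \<Longrightarrow> c * (1 - norm z) \<le> 1 - \<rho> z"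
    using boundary_lower[OF r0] by blast
  obtain C0 where C0: "C0 > 0" "\<And>z. z \<in> ball 0 1 \<Longrightarrow> norm (f z) \<le> C0"
    using f_bounded by blast
  \<comment> \<open>\<mu> bounds |1/f| from below, and \<open>m\<close> its holomorphic
    approximation, which loses at most a quarter. \<open>eps\<close> is the factor by which a disc
    reaching the boundary is shrunk, twice; the remaining gap is at most 2 eps r, where 1 - \<rho>
    \<le> 2 C eps r \<le> c r/2.\<close>
  define \<mu> where "\<mu> = 1 / C0"
  define m where "m = \<mu> / 2"
  define eps where "eps = min (1 / 2) (c / (4 * C))"
  \<comment> \<open>The Harnack factor at radius 1 - eps is eps/(2 - eps) \<ge> eps/2.\<close>
  define kap where "kap = eps / 2"
  \<comment> \<open>\<open>T\<close> is the real part of the logarithm forced at the centre by |f| <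
    \<eta>, as 3/(4 \<eta>) = m exp T. It is taken so large that \<open>D\<close>, the resulting
    bound on |f| over the smaller disc, is below c/8.\<close>
  define T where "T = max 0 ((ln (10 / (c * m)) + 1) / kap)"
  define D where "D = 5 / (4 * m) * exp (- kap * T)"
  define \<eta> where "\<eta> = 3 / (4 * m * exp T)"
  \<comment> \<open>Makes the approximation error 2 R b at most \<mu>/4, a quarter of |1/f|.\<close>
  define r1 where "r1 = min (1 - r0) (\<mu> / (8 * (b + 1)))"
  have \<mu>: "\<mu> > 0" and m: "m > 0" using C0 by (auto simp: \<mu>_def m_def)
  have eps: "0 < eps" "eps \<le> 1 / 2" "eps \<le> c / (4 * C)"
  proof -
    show "0 < eps" using c C by (simp add: eps_def)
    show "eps \<le> 1 / 2" "eps \<le> c / (4 * C)" unfolding eps_def by (rule min.cobounded1, rule min.cobounded2)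
  qed
  have kap: "kap > 0" using eps by (simp add: kap_def)
  have T: "T \<ge> 0" "ln (10 / (c * m)) + 1 \<le> kap * T"
  proof -
    show "T \<ge> 0" by (simp add: T_def)
    have "kap * ((ln (10 / (c * m)) + 1) / kap) \<le> kap * T"
      using kap by (intro mult_left_mono) (auto simp: T_def)
    then show "ln (10 / (c * m)) + 1 \<le> kap * T" using kap by simp
  qed
  have D: "D < c / 8" "0 < D"
  proof -
    have "exp (- kap * T) \<le> exp (- ln (10 / (c * m)) - 1)" using T by simp
    also have "\<dots> < exp (- ln (10 / (c * m)))" by simp
    also have "\<dots> = c * m / 10" using c m by (simp add: exp_minus)
    finally have "D < 5 / (4 * m) * (c * m / 10)"
      unfolding D_def using m by (intro mult_strict_left_mono) auto
    then show "D < c / 8" using m by simp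
    show "0 < D" using m by (simp add: D_def)
  qed
  have \<eta>: "\<eta> > 0" using m by (simp add: \<eta>_def)
  have r1: "r1 > 0" "r1 \<le> 1 - r0" "r1 \<le> \<mu> / (8 * (b + 1))"
  proof -
    show "r1 > 0" using r0 \<mu> b by (simp add: r1_def)
    show "r1 \<le> 1 - r0" "r1 \<le> \<mu> / (8 * (b + 1))" unfolding r1_def by (rule min.cobounded1, rule min.cobounded2)
  qed
  have "\<eta> \<le> norm (f z1)" if z1: "1 - r1 \<le> norm z1" "norm z1 < 1" for z1
  proof (rule ccontr)
    assume "\<not> \<eta> \<le> norm (f z1)"
    then have small: "norm (f z1) < \<eta>" by simp
    define r where "r = 1 - norm z1"
    define R where "R = (1 - eps) * r"
    have r: "0 < r" "r \<le> r1" using z1 by (auto simp: r_def)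
    have R: "0 < R" "R < r" using r eps by (auto simp: R_def)
    have sub: "cball z1 R \<subseteq> ball 0 1"
    proof
      fix z assume "z \<in> cball z1 R"
      then have "norm z \<le> norm z1 + R"
        using norm_triangle_ineq2[of z z1] by (simp add: dist_norm norm_minus_commute)
      then show "z \<in> ball 0 1" using R by (simp add: r_def)
    qed
    then have sub': "ball z1 R \<subseteq> ball 0 1" using ball_subset_cball by blast
    define g where "g = (\<lambda>z. inverse (f z))"
    have gw: "has_wirtinger g (- (inverse (f z) * inverse (f z)) * f1 z) (- (inverse (f z) * inverse (f z)) * f2 z) z"
      if "z \<in> ball 0 1" for z
      unfolding g_def using that nz[OF that]
      by (intro has_wirtinger_compose_holomorphic f_wirt) (auto intro!: derivative_eq_intros)
    have contg: "continuous_on (ball 0 1) g" unfolding g_def using nz by (intro continuous_intros cont_f) auto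
    \<comment> \<open>The holomorphic approximation of 1/f. The error is small because the
      antiholomorphic derivative of 1/f has modulus |f2|/|f|^2 \<le> b.\<close>
    define h where "h = (\<lambda>z. contour_integral (circlepath z1 R) (\<lambda>\<zeta>. g \<zeta> / (\<zeta> - z)) / (2 * of_real pi * \<i>))"
    have g\<mu>: "\<mu> \<le> norm (g z)" if "z \<in> ball 0 1" for z
      using C0(2)[OF that] nz[OF that] C0(1) 
      by (simp add: g_def \<mu>_def norm_inverse inverse_eq_divide[symmetric] le_imp_inverse_le)
    have hg: "norm (h z - g z) \<le> norm (g z) / 4" if z: "z \<in> ball z1 R" for z
    proof -
      have "norm (contour_integral (circlepath z1 R) (\<lambda>\<zeta>. g \<zeta> / (\<zeta> - z)) - 2 * of_real pi * \<i> * g z) \<le> 4 * pi * R * b"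
      proof (rule cauchy_approximation[OF R(1) _ gw _ _ _ z, of z1])
        show "continuous_on (cball z1 R) g" by (rule continuous_on_subset[OF contg sub])
        have s: "ball z1 R - {z1} \<subseteq> ball 0 1" using sub' by blast
        show "\<zeta> \<in> ball z1 R - {z1} \<Longrightarrow> \<zeta> \<in> ball 0 1" for \<zeta> using s by blast
        show "continuous_on (ball z1 R - {z1}) (\<lambda>z. - (inverse (f z) * inverse (f z)) * f1 z)"
          "continuous_on (ball z1 R - {z1}) (\<lambda>z. - (inverse (f z) * inverse (f z)) * f2 z)"
          using nz s by (intro continuous_intros continuous_on_subset[OF cont_f s] continuous_on_subset[OF cont_f1 s]
              continuous_on_subset[OF cont_f2 s]; blast)+
        show "norm (- (inverse (f \<zeta>) * inverse (f \<zeta>)) * f2 \<zeta>) \<le> b" if "\<zeta> \<in> ball z1 R - {z1}" for \<zeta>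
        proof -
          have \<zeta>: "\<zeta> \<in> ball 0 1" using that s by blast
          have "norm (f \<zeta>) > 0" using nz[OF \<zeta>] by simp
          then show ?thesis
            using pde[OF \<zeta>]
            by (simp add: norm_mult norm_inverse norm_divide pos_divide_le_eq inverse_eq_divide power2_eq_square)
        qed
      qed
      moreover have "norm (2 * of_real pi * \<i> * x) = 2 * pi * norm x" for x :: complex
        by (simp add: norm_mult)
      moreover have "contour_integral (circlepath z1 R) (\<lambda>\<zeta>. g \<zeta> / (\<zeta> - z)) - 2 * of_real pi * \<i> * g z = 2 * of_real pi * \<i> * (h z - g z)"
        by (simp add: h_def right_diff_distrib)
      ultimately have "2 * pi * norm (h z - g z) \<le> 4 * pi * R * b" by (simp only:)
      then have "2 * pi * norm (h z - g z) \<le> 2 * pi * (2 * R * b)" by simp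
      then have "norm (h z - g z) \<le> 2 * R * b" by (rule mult_left_le_imp_le) simp
      also have "\<dots> \<le> 2 * r1 * (b + 1)" using R r b by (intro mult_mono) auto
      also have "\<dots> \<le> 2 * (\<mu> / (8 * (b + 1))) * (b + 1)" using r1 b by (intro mult_right_mono) auto
      also have "\<dots> = \<mu> / 4" using b by (simp add: field_simps)
      finally show ?thesis using g\<mu>[of z] z sub' by auto
    qed
    have hg_lower: "3 / 4 * norm (g z) \<le> norm (h z)" and hg_upper: "norm (h z) \<le> 5 / 4 * norm (g z)" if "z \<in> ball z1 R" for z
      using hg[OF that] norm_triangle_ineq2[of "g z" "h z"] norm_triangle_ineq2[of "h z" "g z"]
      by (simp_all add: norm_minus_commute)
    have hm: "m < norm (h z)" if "z \<in> ball z1 R" for z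
      using hg_lower[OF that] g\<mu>[of z] that sub' \<mu> by (auto simp: m_def)
    have holh: "h holomorphic_on ball z1 R"
      unfolding h_def using sub
      by (intro holomorphic_on_divide cauchy_integral_holomorphic R(1) continuous_on_subset[OF contg]) auto
    have scale: "z1 + of_real R * \<zeta> \<in> ball z1 R" if "\<zeta> \<in> ball 0 1" for \<zeta>
      using that R by (simp add: dist_norm norm_mult)
    \<comment> \<open>\<open>h/m\<close> has modulus above 1 on a disc, so it has a holomorphic
      logarithm \<open>P\<close> with positive real part, to which Harnack's inequality
      applies.\<close>
    have "(\<lambda>\<zeta>. h (z1 + of_real R * \<zeta>) / of_real m) holomorphic_on ball 0 1"
      using m scale by (intro holomorphic_intros holomorphic_on_compose_gen[OF _ holh, unfolded o_def]) auto
    moreover have "h (z1 + of_real R * \<zeta>) / of_real m \<noteq> 0" if "\<zeta> \<in> ball 0 1" for \<zeta>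
      using hm[OF scale[OF that]] m by auto
    ultimately obtain P where P: "P holomorphic_on ball 0 1"
      "\<And>\<zeta>. \<zeta> \<in> ball 0 1 \<Longrightarrow> h (z1 + of_real R * \<zeta>) / of_real m = exp (P \<zeta>)"
      using contractible_imp_holomorphic_log[of _ "ball 0 1"] convex_imp_contractible[OF convex_ball] by blast
    have nP: "norm (h (z1 + of_real R * \<zeta>)) = m * exp (Re (P \<zeta>))" if "\<zeta> \<in> ball 0 1" for \<zeta>
    proof -
      have "norm (h (z1 + of_real R * \<zeta>) / of_real m) = exp (Re (P \<zeta>))" unfolding P(2)[OF that] by simp
      then show ?thesis using m by (simp add: norm_divide field_simps)
    qed
    have posP: "0 < Re (P \<zeta>)" if "\<zeta> \<in> ball 0 1" for \<zeta>
      using hm[OF scale[OF that]] nP[OF that] m by simp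
    have TP: "T \<le> Re (P 0)"
    proof -
      have z1b: "z1 \<in> ball 0 1" using z1 by simp
      have "1 / \<eta> < norm (g z1)"
        using small nz[OF z1b]
        by (simp add: g_def norm_inverse inverse_eq_divide[symmetric] less_imp_inverse_less)
      then have "3 / 4 * (1 / \<eta>) < norm (h z1)" using hg_lower[of z1] R by simp
      then have "m * exp T < m * exp (Re (P 0))"
        using nP[of 0] m by (simp add: \<eta>_def)
      then show ?thesis using m by simp
    qed
    define s where "s = 1 - eps"
    have s: "0 \<le> s" "s < 1" using eps by (auto simp: s_def)
    have fD: "norm (f z) \<le> D" if z: "z \<in> cball z1 (s * R)" for z
    proof -
      define \<zeta> where "\<zeta> = (z - z1) / of_real R"
      have z_eq: "z = z1 + of_real R * \<zeta>" using R by (simp add: \<zeta>_def)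
      have n\<zeta>: "norm \<zeta> \<le> s" using z R by (simp add: \<zeta>_def norm_divide dist_norm norm_minus_commute field_simps)
      then have \<zeta>: "\<zeta> \<in> ball 0 1" using s by simp
      have "kap \<le> (1 - s) / (1 + s)"
        using eps by (simp add: s_def kap_def field_simps)
      also have "\<dots> \<le> (1 - norm \<zeta>) / (1 + norm \<zeta>)"
        using n\<zeta> s by (intro frac_le) (auto intro: add_pos_nonneg)
      finally have "T * kap \<le> Re (P 0) * ((1 - norm \<zeta>) / (1 + norm \<zeta>))"
        using TP T kap by (intro mult_mono) auto
      also have "\<dots> \<le> Re (P \<zeta>)" by (rule harnack_positive_real_part[OF P(1) posP]) (use \<zeta> in auto)
      finally have "m * exp (kap * T) \<le> norm (h z)"
        unfolding z_eq nP[OF \<zeta>] using m by (simp add: mult.commute)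
      also have "\<dots> \<le> 5 / 4 * norm (g z)" using hg_upper scale[OF \<zeta>] z_eq by simp
      finally have 1: "m * exp (kap * T) \<le> 5 / 4 * norm (g z)" .
      have zb: "z \<in> ball 0 1" using scale[OF \<zeta>] sub' z_eq by blast
      then have "norm (g z) * norm (f z) = 1" using nz[OF zb] by (simp add: g_def norm_inverse)
      moreover have "m * exp (kap * T) * norm (f z) \<le> 5 / 4 * norm (g z) * norm (f z)"
        using 1 by (rule mult_right_mono) simp
      ultimately have "m * exp (kap * T) * norm (f z) \<le> 5 / 4" by simp
      then show ?thesis using m by (simp add: D_def exp_minus field_simps)
    qed
    have z1n: "norm z1 > 0" using z1 r1 r0 by auto
    \<comment> \<open>The point of the smaller disc nearest to the unit circle. Since |f| \<le> D in
      between, \<rho> changes by at most 4 D r < c r/2 from \<open>z1\<close> to \<open>z'\<close>,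
      too little for 1 - \<rho> to fall from at least c r to at most c r/2.\<close>
    define z' where "z' = z1 + of_real (s * R / norm z1) * z1"
    have dist': "norm (z1 - z') = s * R" using s R z1n by (simp add: z'_def norm_mult norm_divide)
    have "z' = of_real (1 + s * R / norm z1) * z1" by (simp add: z'_def algebra_simps)
    then have "norm z' = (1 + s * R / norm z1) * norm z1"
      using s R z1n by (simp add: norm_mult del: of_real_add of_real_divide of_real_mult)
    then have norm': "norm z' = norm z1 + s * R" using z1n by (simp add: distrib_right)
    have sR: "s * R \<le> R" using s R by (simp add: mult_left_le_one_le)
    have z'b: "norm z' < 1" using norm' sR R unfolding r_def by linarith
    have z'0: "r0 \<le> norm z'" "r0 \<le> norm z1" using norm' z1 r1 mult_nonneg_nonneg[of s R] s R by linarith+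
    have "1 - norm z' = r * (1 - (1 - eps) * (1 - eps))"
      by (simp add: norm' r_def R_def s_def algebra_simps)
    also have "\<dots> \<le> r * (2 * eps)" using r eps by (intro mult_left_mono) (auto simp: algebra_simps)
    finally have "1 - norm z' \<le> r * (2 * eps)" .
    then have "C * (1 - norm z') \<le> C * (r * (2 * (c / (4 * C))))"
      using C eps r by (meson less_imp_le mult_left_mono order_trans zero_le_numeral)
    then have "C * (1 - norm z') \<le> r * c / 2" using C(1) by simp
    then have e1: "1 - \<rho> z' \<le> r * c / 2" using C(2)[OF z'0(1) z'b] by linarith
    have "norm (w z1 - w z') \<le> 2 * D * norm (z1 - z')"
    proof (rule has_wirtinger_lipschitz[OF convex_cball])
      have ss: "\<zeta> \<in> ball 0 1" if "\<zeta> \<in> cball z1 (s * R)" for \<zeta>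
        using that sR sub by (meson mem_cball order_trans subsetD)
      show "has_wirtinger w (f \<zeta>) (q \<zeta>) \<zeta>" if "\<zeta> \<in> cball z1 (s * R)" for \<zeta> by (rule w_wirt[OF ss[OF that]])
      show "norm (f \<zeta>) + norm (q \<zeta>) \<le> 2 * D" if "\<zeta> \<in> cball z1 (s * R)" for \<zeta>
        using fD[OF that] norm_q_le[OF ss[OF that]] by simp
      show "z1 \<in> cball z1 (s * R)" "z' \<in> cball z1 (s * R)" using s R dist' by (auto simp: dist_norm)
    qed
    also have "\<dots> \<le> 2 * D * r"
      unfolding dist' using order_trans[OF sR less_imp_le[OF R(2)]] D by (intro mult_left_mono) auto
    finally have "norm (w z1 - w z') \<le> 2 * D * r" .
    moreover have "\<rho> z' - \<rho> z1 \<le> 2 * norm (w z1 - w z')"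
    proof -
      have "\<rho> z' - \<rho> z1 = (norm (w z') - norm (w z1)) * (norm (w z') + norm (w z1))"
        by (simp add: \<rho>_def power2_eq_square algebra_simps)
      also have "\<dots> \<le> norm (w z1 - w z') * (norm (w z') + norm (w z1))"
        using norm_triangle_ineq2[of "w z'" "w z1"] by (intro mult_right_mono) (auto simp: norm_minus_commute)
      also have "\<dots> \<le> norm (w z1 - w z') * 2"
        using norm_w[of z'] norm_w[of z1] z1 z'b by (intro mult_left_mono) auto
      finally show ?thesis by simp
    qed
    moreover have "c * r \<le> 1 - \<rho> z1" using c(2)[of z1] z'0 z1 by (simp add: r_def)
    ultimately have "c * r \<le> r * c / 2 + 4 * D * r" using e1 by linarith
    moreover have "4 * D * r < c / 2 * r" using D r by (intro mult_strict_right_mono) auto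
    moreover have "c / 2 * r + r * c / 2 = c * r" by (simp add: field_simps)
    ultimately show False by linarith
  qed
  then show ?thesis using \<eta> r1 by blast
qed

lemma f_lower:
  assumes nz: "\<And>z. z \<in> ball 0 1 \<Longrightarrow> f z \<noteq> 0"
  shows "\<exists>c>0. \<forall>z\<in>ball 0 1. c \<le> norm (f z)"
proof -
  obtain \<eta> r1 where \<eta>: "\<eta> > 0" "r1 > 0" "\<And>z. 1 - r1 \<le> norm z \<Longrightarrow> norm z < 1 \<Longrightarrow> \<eta> \<le> norm (f z)"
    using f_lower_near_boundary[OF nz] by blast
  define r where "r = max 0 (1 - r1)"
  have sub: "cball 0 r \<subseteq> ball (0::complex) 1" using \<eta>(2) by (auto simp: r_def)
  have "continuous_on (cball 0 r) (\<lambda>z. norm (f z))"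
    by (intro continuous_intros continuous_on_subset[OF cont_f sub])
  moreover have "cball (0::complex) r \<noteq> {}" by (simp add: r_def)
  ultimately obtain m where m: "m \<in> cball 0 r" "\<And>z. z \<in> cball 0 r \<Longrightarrow> norm (f m) \<le> norm (f z)"
    using continuous_attains_inf[OF compact_cball] by metis
  have fm: "norm (f m) > 0" using nz[of m] m(1) sub by auto
  have "min \<eta> (norm (f m)) \<le> norm (f z)" if z: "z \<in> ball 0 1" for z
  proof (cases "z \<in> cball 0 r")
    case True
    then show ?thesis using m(2) by (simp add: min.coboundedI2)
  next
    case False
    then have "1 - r1 \<le> norm z" by (auto simp: r_def)
    then show ?thesis using \<eta>(3)[of z] z by (simp add: min.coboundedI1)
  qed
  then show ?thesis using \<eta>(1) fm by (intro exI[of _ "min \<eta> (norm (f m))"]) auto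
qed

text \<open>Once |f| is bounded below, J = |f|^2 - |q|^2 is positive and the inverse is
  differentiable, with Wirtinger derivatives cnj f/J and -q/J. Their moduli add up to 1/(|f| - |q|),
  which is at most 1/((1 - k)c), and the image disc is convex, so the mean value inequality applies
  to the inverse.\<close>

lemma bi_lipschitz:
  assumes hom: "homeomorphism (ball 0 1) (ball 0 1) w g"
    and winding: "\<And>p r. 0 < r \<Longrightarrow> cball p r \<subseteq> ball 0 1 \<Longrightarrow> winding_number (w \<circ> circlepath p r) (w p) = 1"
  shows "\<exists>l>0. \<exists>L>0. \<forall>z1\<in>ball 0 1. \<forall>z2\<in>ball 0 1.
           l * norm (z1 - z2) \<le> norm (w z1 - w z2) \<and> norm (w z1 - w z2) \<le> L * norm (z1 - z2)"
proof -
  have gw: "g (w z) = z" if "z \<in> ball 0 1" for z using hom that by (auto simp: homeomorphism_def)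
  have wg: "w (g y) = y" if "y \<in> ball 0 1" for y using hom that by (auto simp: homeomorphism_def)
  have g_in: "g y \<in> ball 0 1" if "y \<in> ball 0 1" for y using hom that unfolding homeomorphism_def by blast
  have w_in: "w z \<in> ball 0 1" if "z \<in> ball 0 1" for z using hom that unfolding homeomorphism_def by blast
  have contg: "continuous_on (ball 0 1) g" using hom by (auto simp: homeomorphism_def)
  have inj: "inj_on w (ball 0 1)" using gw by (rule inj_on_inverseI)
  obtain c where c: "c > 0" "\<And>z. z \<in> ball 0 1 \<Longrightarrow> c \<le> norm (f z)"
    using f_lower[OF f_nonzero[OF inj winding]] by blast
  obtain C where C: "C > 0" "\<And>z. z \<in> ball 0 1 \<Longrightarrow> norm (f z) \<le> C" using f_bounded by blast
  have upper: "norm (w z1 - w z2) \<le> 2 * C * norm (z1 - z2)" if "z1 \<in> ball 0 1" "z2 \<in> ball 0 1" for z1 z2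
  proof (rule has_wirtinger_lipschitz[OF convex_ball w_wirt _ that])
    show "norm (f z) + norm (q z) \<le> 2 * C" if "z \<in> ball 0 1" for z
      using C(2)[OF that] norm_q_le[OF that] by simp
  qed
  have gap: "(1 - k) * c \<le> norm (f z) - norm (q z)" if "z \<in> ball 0 1" for z
  proof -
    have "(1 - k) * c \<le> (1 - k) * norm (f z)" using c(2)[OF that] k by (intro mult_left_mono) auto
    then show ?thesis using dilatation[OF that] by (simp add: algebra_simps)
  qed
  have kc: "(1 - k) * c > 0" using k c by simp
  define J where "J = (\<lambda>z. (norm (f z))\<^sup>2 - (norm (q z))\<^sup>2)"
  have J_eq: "J z = (norm (f z) - norm (q z)) * (norm (f z) + norm (q z))" for z
    by (simp add: J_def power2_eq_square algebra_simps)
  have J: "J z > 0" if "z \<in> ball 0 1" for z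
    unfolding J_eq using gap[OF that] kc norm_ge_zero[of "q z"] by (intro mult_pos_pos) linarith+
  have g_wirt: "has_wirtinger g (cnj (f (g y)) / of_real (J (g y))) (- q (g y) / of_real (J (g y))) y"
    if y: "y \<in> ball 0 1" for y
    unfolding has_wirtinger_def
  proof (rule has_derivative_inverse_basic)
    show "(w has_derivative (\<lambda>h. f (g y) * h + q (g y) * cnj h)) (at (g y))"
      using w_wirt[OF g_in[OF y]] by (simp add: has_wirtinger_def)
    show "bounded_linear (\<lambda>h. cnj (f (g y)) / of_real (J (g y)) * h + - q (g y) / of_real (J (g y)) * cnj h)"
      by (intro bounded_linear_add bounded_linear_const_mult bounded_linear_ident bounded_linear_cnj)
    show "(\<lambda>h. cnj (f (g y)) / of_real (J (g y)) * h + - q (g y) / of_real (J (g y)) * cnj h)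
        \<circ> (\<lambda>h. f (g y) * h + q (g y) * cnj h) = id"
    proof
      fix h
      define F G where "F = f (g y)" and "G = q (g y)"
      have j: "complex_of_real (J (g y)) \<noteq> 0" using J[OF g_in[OF y]] by simp
      have J2: "of_real (J (g y)) = F * cnj F - G * cnj G"
        by (simp add: J_def F_def G_def complex_norm_square[symmetric])
      have "cnj F * (F * h + G * cnj h) - G * cnj (F * h + G * cnj h) = of_real (J (g y)) * h"
        unfolding J2 by (simp add: algebra_simps)
      then have "(cnj F * (F * h + G * cnj h) - G * cnj (F * h + G * cnj h)) / of_real (J (g y)) = h"
        using j by simp
      then show "((\<lambda>h. cnj (f (g y)) / of_real (J (g y)) * h + - q (g y) / of_real (J (g y)) * cnj h)
        \<circ> (\<lambda>h. f (g y) * h + q (g y) * cnj h)) h = id h"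
        by (simp add: F_def G_def diff_divide_distrib)
    qed
    show "continuous (at y) g" using contg y by (simp add: continuous_on_eq_continuous_at)
    show "open (ball (0::complex) 1)" by simp
  qed (use y wg in auto)
  have lower: "norm (g y1 - g y2) \<le> 1 / ((1 - k) * c) * norm (y1 - y2)" if "y1 \<in> ball 0 1" "y2 \<in> ball 0 1" for y1 y2
  proof (rule has_wirtinger_lipschitz[OF convex_ball g_wirt _ that])
    fix y :: complex assume y: "y \<in> ball 0 1"
    define z where "z = g y"
    have z: "z \<in> ball 0 1" using g_in[OF y] by (simp add: z_def)
    have pos: "norm (f z) - norm (q z) > 0" "norm (f z) + norm (q z) > 0"
      using gap[OF z] kc norm_ge_zero[of "q z"] by linarith+
    have "norm (cnj (f z) / of_real (J z)) + norm (- q z / of_real (J z)) = (norm (f z) + norm (q z)) / J z"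
      using J[OF z] by (simp add: norm_divide add_divide_distrib)
    also have "\<dots> = 1 / (norm (f z) - norm (q z))" using pos by (simp add: J_eq)
    also have "\<dots> \<le> 1 / ((1 - k) * c)" using gap[OF z] kc by (intro divide_left_mono mult_pos_pos) (use pos k c in auto)
    finally show "norm (cnj (f (g y)) / of_real (J (g y))) + norm (- q (g y) / of_real (J (g y))) \<le> 1 / ((1 - k) * c)"
      by (simp add: z_def)
  qed
  have "(1 - k) * c * norm (z1 - z2) \<le> norm (w z1 - w z2)" if "z1 \<in> ball 0 1" "z2 \<in> ball 0 1" for z1 z2
    using lower[OF w_in[OF that(1)] w_in[OF that(2)]] gw that kc by (simp add: field_simps)
  then show ?thesis
    using upper kc C by (intro exI[of _ "(1 - k) * c"] exI[of _ "2 * C"] conjI ballI) auto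
qed

end

subsection \<open>Symmetry of second derivatives\<close>

text \<open>Two mean value inequalities, along \<open>e2\<close> for the derivative \<open>p\<close>
  and along \<open>e1\<close> for differences of \<open>f\<close>. The second difference is
  symmetric in \<open>e1\<close> and \<open>e2\<close> while the derivative is not, which is the
  source of the symmetry of mixed partials.\<close>

lemma second_difference_bound:
  fixes f p :: "complex \<Rightarrow> complex"
  assumes fd: "\<And>\<zeta>. \<zeta> \<in> ball z \<delta> \<Longrightarrow> (f has_derivative f' \<zeta>) (at \<zeta>)"
    and p: "\<And>\<zeta>. \<zeta> \<in> ball z \<delta> \<Longrightarrow> f' \<zeta> e1 = p \<zeta>"
    and pd: "\<And>\<zeta>. \<zeta> \<in> ball z \<delta> \<Longrightarrow> (p has_derivative p' \<zeta>) (at \<zeta>)"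
    and c: "\<And>\<zeta>. \<zeta> \<in> ball z \<delta> \<Longrightarrow> norm (p' \<zeta> e2 - c) \<le> eps"
    and h: "0 < h" "2 * h < \<delta>" and e: "norm e1 = 1" "norm e2 = 1"
  shows "norm ((f (z + of_real h * e1 + of_real h * e2) - f (z + of_real h * e1)) - (f (z + of_real h * e2) - f z) - of_real (h\<^sup>2) * c) \<le> h\<^sup>2 * eps"
proof -
  have line: "((\<lambda>t::real. a + of_real t * e) has_vector_derivative e) (at t)" for a e :: complex and t
    by (auto intro!: derivative_eq_intros simp: has_vector_derivative_def scaleR_conv_of_real)
  have in_ball: "z + of_real s * e1 + of_real t * e2 \<in> ball z \<delta>" if "0 \<le> s" "s \<le> h" "0 \<le> t" "t \<le> h" for s t
  proof -
    have "norm (of_real s * e1 + of_real t * e2) \<le> norm (of_real s * e1) + norm (of_real t * e2)"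
      by (rule norm_triangle_ineq)
    also have "\<dots> < \<delta>" using that h e by (simp add: norm_mult)
    finally show ?thesis by (simp add: dist_norm norm_minus_commute add_ac)
  qed
  have contf: "isCont f \<zeta>" and contp: "isCont p \<zeta>" if "\<zeta> \<in> ball z \<delta>" for \<zeta>
    using fd[OF that] pd[OF that] has_derivative_continuous by blast+
  have inner: "norm (p (z + of_real s * e1 + of_real h * e2) - p (z + of_real s * e1) - of_real h * c) \<le> h * eps"
    if s: "0 \<le> s" "s \<le> h" for s
  proof -
    define G where "G = (\<lambda>t. p (z + of_real s * e1 + of_real t * e2) - of_real t * c)"
    have "norm (G h - G 0) \<le> h * eps - 0 * eps"
    proof (rule differentiable_bound_general[where f' = "\<lambda>t. p' (z + of_real s * e1 + of_real t * e2) e2 - c" and \<phi>' = "\<lambda>_. eps"])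
      have "isCont (\<lambda>t. p (z + of_real s * e1 + of_real t * e2)) t" if "t \<in> {0..h}" for t
        using in_ball[OF s, of t] that by (intro isCont_o2[OF _ contp] continuous_intros) auto
      then show "continuous_on {0..h} G"
        unfolding G_def by (intro continuous_intros continuous_at_imp_continuous_on) auto
      fix t assume t: "0 < t" "t < h"
      have "(p has_derivative p' (z + of_real s * e1 + of_real t * e2)) (at (z + of_real s * e1 + of_real t * e2))"
        using in_ball[OF s, of t] t by (intro pd) auto
      from vector_derivative_diff_chain_within[OF line has_derivative_at_withinI[OF this]]
      have "((\<lambda>t. p (z + of_real s * e1 + of_real t * e2)) has_vector_derivative p' (z + of_real s * e1 + of_real t * e2) e2) (at t)"
        by (simp add: o_def)
      from has_vector_derivative_diff[OF this line[of 0 c t]]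
      show "(G has_vector_derivative p' (z + of_real s * e1 + of_real t * e2) e2 - c) (at t)"
        by (simp add: G_def)
      show "norm (p' (z + of_real s * e1 + of_real t * e2) e2 - c) \<le> eps"
        using in_ball[OF s, of t] t by (intro c) auto
    qed (use h in \<open>auto intro!: continuous_intros derivative_eq_intros simp: has_vector_derivative_def\<close>)
    then show ?thesis by (simp add: G_def algebra_simps)
  qed
  define F where "F = (\<lambda>s. f (z + of_real s * e1 + of_real h * e2) - f (z + of_real s * e1) - of_real s * (of_real h * c))"
  have "norm (F h - F 0) \<le> h * (h * eps) - 0 * (h * eps)"
  proof (rule differentiable_bound_general[where \<phi>' = "\<lambda>_. h * eps" and
        f' = "\<lambda>s. p (z + of_real s * e1 + of_real h * e2) - p (z + of_real s * e1) - of_real h * c"])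
    have in1: "z + of_real s * e1 + of_real h * e2 \<in> ball z \<delta>" and in2: "z + of_real s * e1 \<in> ball z \<delta>"
      if "0 \<le> s" "s \<le> h" for s
      using in_ball[OF that, of h] in_ball[OF that, of 0] h by auto
    have "isCont (\<lambda>s. f (z + of_real s * e1 + of_real h * e2)) s" "isCont (\<lambda>s. f (z + of_real s * e1)) s"
      if "s \<in> {0..h}" for s
      using in1[of s] in2[of s] that by (intro isCont_o2[OF _ contf] continuous_intros; auto)+
    then show "continuous_on {0..h} F"
      unfolding F_def by (intro continuous_intros continuous_at_imp_continuous_on) auto
    fix s assume s: "0 < s" "s < h"
    have d: "((\<lambda>s. f (a + of_real s * e1)) has_vector_derivative p (a + of_real s * e1)) (at s)"
      if "a + of_real s * e1 \<in> ball z \<delta>" for a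
      using vector_derivative_diff_chain_within[OF line has_derivative_at_withinI[OF fd[OF that]]] p[OF that]
      by (simp add: o_def)
    have "((\<lambda>s. f ((z + of_real h * e2) + of_real s * e1)) has_vector_derivative p ((z + of_real h * e2) + of_real s * e1)) (at s)"
      using in1[of s] s by (intro d) (simp add: add_ac)
    moreover have "((\<lambda>s. f (z + of_real s * e1)) has_vector_derivative p (z + of_real s * e1)) (at s)"
      using in2[of s] s by (intro d) simp
    ultimately show "(F has_vector_derivative p (z + of_real s * e1 + of_real h * e2) - p (z + of_real s * e1) - of_real h * c) (at s)"
      unfolding F_def using has_vector_derivative_diff[OF has_vector_derivative_diff line[of 0 "of_real h * c" s]]
      by (simp add: add_ac)
    show "norm (p (z + of_real s * e1 + of_real h * e2) - p (z + of_real s * e1) - of_real h * c) \<le> h * eps"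
      using s by (intro inner) auto
  qed (use h in \<open>auto intro!: continuous_intros derivative_eq_intros simp: has_vector_derivative_def\<close>)
  then show ?thesis by (simp add: F_def algebra_simps power2_eq_square)
qed

text \<open>One and the same second difference, divided by h^2, lies within e/2 of either mixed
  derivative, by their continuity at \<open>z\<close>.\<close>

lemma mixed_partials_eq:
  assumes S: "open S" "z \<in> S" and C2: "C2_map_on f S"
  shows "dx (dy f) z = dy (dx f) z"
proof -
  have C1: "C1_map_on f S" "C1_map_on (dx f) S" "C1_map_on (dy f) S"
    using C2 by (auto simp: C2_map_on_def)
  have D: "(u has_derivative frechet_derivative u (at \<zeta>)) (at \<zeta>)" if "C1_map_on u S" "\<zeta> \<in> S" for u \<zeta>
    using that by (auto simp: C1_map_on_def frechet_derivative_works)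
  have "norm (dx (dy f) z - dy (dx f) z) \<le> e" if "e > 0" for e
  proof -
    have c1: "isCont (dy (dx f)) z" and c2: "isCont (dx (dy f)) z"
      using C1 S by (auto simp: C1_map_on_def continuous_on_eq_continuous_at)
    obtain d1 where d1: "d1 > 0" "\<And>\<zeta>. dist \<zeta> z < d1 \<Longrightarrow> dist (dy (dx f) \<zeta>) (dy (dx f) z) < e / 2"
      using c1 \<open>e > 0\<close> unfolding continuous_at_eps_delta by (metis half_gt_zero)
    obtain d2 where d2: "d2 > 0" "\<And>\<zeta>. dist \<zeta> z < d2 \<Longrightarrow> dist (dx (dy f) \<zeta>) (dx (dy f) z) < e / 2"
      using c2 \<open>e > 0\<close> unfolding continuous_at_eps_delta by (metis half_gt_zero)
    obtain d3 where d3: "d3 > 0" "ball z d3 \<subseteq> S" using S open_contains_ball by blast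
    define \<delta> where "\<delta> = min d1 (min d2 d3)"
    have \<delta>: "\<delta> > 0" and sub: "ball z \<delta> \<subseteq> S" using d1(1) d2(1) d3 by (auto simp: \<delta>_def)
    define h where "h = \<delta> / 4"
    have h: "0 < h" "2 * h < \<delta>" using \<delta> by (auto simp: h_def)
    define X where "X = f (z + of_real h + of_real h * \<i>) - f (z + of_real h) - f (z + of_real h * \<i>) + f z"
    have "norm ((f (z + of_real h * 1 + of_real h * \<i>) - f (z + of_real h * 1)) - (f (z + of_real h * \<i>) - f z) - of_real (h\<^sup>2) * dy (dx f) z) \<le> h\<^sup>2 * (e / 2)"
    proof (rule second_difference_bound[OF _ _ _ _ h])
      fix \<zeta> assume \<zeta>: "\<zeta> \<in> ball z \<delta>"
      then have \<zeta>S: "\<zeta> \<in> S" using sub by blast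
      show "(f has_derivative frechet_derivative f (at \<zeta>)) (at \<zeta>)"
        "(dx f has_derivative frechet_derivative (dx f) (at \<zeta>)) (at \<zeta>)" using D C1 \<zeta>S by auto
      show "frechet_derivative f (at \<zeta>) 1 = dx f \<zeta>" by (simp add: dx_def)
      show "norm (frechet_derivative (dx f) (at \<zeta>) \<i> - dy (dx f) z) \<le> e / 2"
        using d1(2)[of \<zeta>] \<zeta> by (simp add: dy_def dist_norm \<delta>_def norm_minus_commute)
    qed auto
    then have 1: "norm (X - of_real (h\<^sup>2) * dy (dx f) z) \<le> h\<^sup>2 * (e / 2)" by (simp add: X_def algebra_simps)
    have "norm ((f (z + of_real h * \<i> + of_real h * 1) - f (z + of_real h * \<i>)) - (f (z + of_real h * 1) - f z) - of_real (h\<^sup>2) * dx (dy f) z) \<le> h\<^sup>2 * (e / 2)"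
    proof (rule second_difference_bound[OF _ _ _ _ h])
      fix \<zeta> assume \<zeta>: "\<zeta> \<in> ball z \<delta>"
      then have \<zeta>S: "\<zeta> \<in> S" using sub by blast
      show "(f has_derivative frechet_derivative f (at \<zeta>)) (at \<zeta>)"
        "(dy f has_derivative frechet_derivative (dy f) (at \<zeta>)) (at \<zeta>)" using D C1 \<zeta>S by auto
      show "frechet_derivative f (at \<zeta>) \<i> = dy f \<zeta>" by (simp add: dy_def)
      show "norm (frechet_derivative (dy f) (at \<zeta>) 1 - dx (dy f) z) \<le> e / 2"
        using d2(2)[of \<zeta>] \<zeta> by (simp add: dx_def dist_norm \<delta>_def norm_minus_commute)
    qed auto
    then have 2: "norm (X - of_real (h\<^sup>2) * dx (dy f) z) \<le> h\<^sup>2 * (e / 2)" by (simp add: X_def algebra_simps)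
    have "norm ((X - of_real (h\<^sup>2) * dy (dx f) z) - (X - of_real (h\<^sup>2) * dx (dy f) z)) \<le> h\<^sup>2 * (e / 2) + h\<^sup>2 * (e / 2)"
      using 1 2 norm_triangle_ineq4 by (meson add_mono order_trans)
    moreover have "(X - of_real (h\<^sup>2) * dy (dx f) z) - (X - of_real (h\<^sup>2) * dx (dy f) z) = of_real (h\<^sup>2) * (dx (dy f) z - dy (dx f) z)"
      by (simp add: algebra_simps)
    moreover have "norm (of_real (h\<^sup>2) * x) = h\<^sup>2 * norm x" for x :: complex
      by (simp add: norm_mult norm_power)
    moreover have "h\<^sup>2 * (e / 2) + h\<^sup>2 * (e / 2) = h\<^sup>2 * e" by (simp add: field_simps)
    ultimately have "h\<^sup>2 * norm (dx (dy f) z - dy (dx f) z) \<le> h\<^sup>2 * e"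
      by (simp only:)
    then show ?thesis using h by simp
  qed
  then have "norm (dx (dy f) z - dy (dx f) z) \<le> 0" by (rule field_le_epsilon[of _ 0, simplified])
  then show ?thesis by simp
qed

subsection \<open>Wirtinger derivatives of a \<open>C\<^sup>2\<close> map\<close>

lemma has_wirtinger_frechet:
  assumes "f differentiable at z"
  shows "has_wirtinger f (wirtinger f z) (wirtinger_bar f z) z"
proof -
  have D: "(f has_derivative frechet_derivative f (at z)) (at z)"
    using assms by (simp add: frechet_derivative_works)
  interpret bounded_linear "frechet_derivative f (at z)" using D by (rule has_derivative_bounded_linear)
  have "frechet_derivative f (at z) = (\<lambda>h. wirtinger f z * h + wirtinger_bar f z * cnj h)"
  proof
    fix h
    have "h = Re h *\<^sub>R 1 + Im h *\<^sub>R \<i>" by (simp add: complex_eq_iff)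
    then have "frechet_derivative f (at z) h = Re h *\<^sub>R dx f z + Im h *\<^sub>R dy f z"
      unfolding dx_def dy_def using add scaleR by metis
    then show "frechet_derivative f (at z) h = wirtinger f z * h + wirtinger_bar f z * cnj h"
      by (simp add: wirtinger_def wirtinger_bar_def complex_eq_iff field_simps)
  qed
  then show ?thesis using D unfolding has_wirtinger_def by simp
qed

lemma differentiable_dx_dy:
  assumes "(f has_derivative f') (at z)"
  shows "dx f z = f' 1" "dy f z = f' \<i>"
  using frechet_derivative_at[OF assms] by (auto simp: dx_def dy_def)

lemma C2_wirtinger:
  assumes C2: "C2_map_on w S" and S: "open S"
  shows "\<And>z. z \<in> S \<Longrightarrow> wirtinger w differentiable at z"
    "\<And>z. z \<in> S \<Longrightarrow> wirtinger_bar w differentiable at z"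
    "continuous_on S (wirtinger (wirtinger w))" "continuous_on S (wirtinger_bar (wirtinger w))"
    "\<And>z. z \<in> S \<Longrightarrow> wirtinger (wirtinger_bar w) z = wirtinger_bar (wirtinger w) z"
proof -
  have C1: "C1_map_on (dx w) S" "C1_map_on (dy w) S" using C2 by (auto simp: C2_map_on_def)
  have der: "(wirtinger w has_derivative (\<lambda>h. (frechet_derivative (dx w) (at z) h - \<i> * frechet_derivative (dy w) (at z) h) / 2)) (at z)"
    "(wirtinger_bar w has_derivative (\<lambda>h. (frechet_derivative (dx w) (at z) h + \<i> * frechet_derivative (dy w) (at z) h) / 2)) (at z)"
    if "z \<in> S" for z
  proof -
    have "(dx w has_derivative frechet_derivative (dx w) (at z)) (at z)" "(dy w has_derivative frechet_derivative (dy w) (at z)) (at z)"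
      using C1 that by (auto simp: C1_map_on_def frechet_derivative_works)
    note d = this
    have "((\<lambda>z. (dx w z - \<i> * dy w z) / 2) has_derivative (\<lambda>h. (frechet_derivative (dx w) (at z) h - \<i> * frechet_derivative (dy w) (at z) h) / 2)) (at z)"
      "((\<lambda>z. (dx w z + \<i> * dy w z) / 2) has_derivative (\<lambda>h. (frechet_derivative (dx w) (at z) h + \<i> * frechet_derivative (dy w) (at z) h) / 2)) (at z)"
      by (rule derivative_eq_intros d refl | simp)+
    then show "(wirtinger w has_derivative (\<lambda>h. (frechet_derivative (dx w) (at z) h - \<i> * frechet_derivative (dy w) (at z) h) / 2)) (at z)"
      "(wirtinger_bar w has_derivative (\<lambda>h. (frechet_derivative (dx w) (at z) h + \<i> * frechet_derivative (dy w) (at z) h) / 2)) (at z)"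
      unfolding wirtinger_def[abs_def] wirtinger_bar_def[abs_def] by simp_all
  qed
  show "wirtinger w differentiable at z" "wirtinger_bar w differentiable at z" if "z \<in> S" for z
    using der[OF that] by (auto simp: differentiable_def)
  have f1: "wirtinger (wirtinger w) z = ((dx (dx w) z - \<i> * dx (dy w) z) / 2 - \<i> * ((dy (dx w) z - \<i> * dy (dy w) z) / 2)) / 2"
    and f2: "wirtinger_bar (wirtinger w) z = ((dx (dx w) z - \<i> * dx (dy w) z) / 2 + \<i> * ((dy (dx w) z - \<i> * dy (dy w) z) / 2)) / 2"
    and q1: "wirtinger (wirtinger_bar w) z = ((dx (dx w) z + \<i> * dx (dy w) z) / 2 - \<i> * ((dy (dx w) z + \<i> * dy (dy w) z) / 2)) / 2"
    if "z \<in> S" for z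
    unfolding wirtinger_def[of "wirtinger w"] wirtinger_bar_def[of "wirtinger w"] wirtinger_def[of "wirtinger_bar w"]
      differentiable_dx_dy[OF der(1)[OF that]] differentiable_dx_dy[OF der(2)[OF that]]
    by (simp_all add: dx_def dy_def)
  have cont: "continuous_on S (dx (dx w))" "continuous_on S (dy (dx w))" "continuous_on S (dx (dy w))" "continuous_on S (dy (dy w))"
    using C1 by (auto simp: C1_map_on_def)
  show "continuous_on S (wirtinger (wirtinger w))"
    by (subst continuous_on_cong[OF refl f1]) (auto intro!: continuous_intros cont)
  show "continuous_on S (wirtinger_bar (wirtinger w))"
    by (subst continuous_on_cong[OF refl f2]) (auto intro!: continuous_intros cont)
  show "wirtinger (wirtinger_bar w) z = wirtinger_bar (wirtinger w) z" if "z \<in> S" for z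
    unfolding f2[OF that] q1[OF that] mixed_partials_eq[OF S that C2]
    by (simp add: field_simps)
qed

text \<open>The triangle inequality suffices, since \<open>grad_norm\<close> stands on the larger
  side of the assumed differential inequality.\<close>

lemma grad_norm_le:
  assumes "f differentiable at z"
  shows "grad_norm f z \<le> norm (wirtinger f z) + norm (wirtinger_bar f z)"
proof -
  have "frechet_derivative f (at z) = (\<lambda>h. wirtinger f z * h + wirtinger_bar f z * cnj h)"
    using frechet_derivative_at[OF has_wirtinger_frechet[OF assms, unfolded has_wirtinger_def]] by simp
  then show ?thesis
    unfolding grad_norm_def
  proof (simp only:, intro onorm_le)
    show "norm (wirtinger f z * h + wirtinger_bar f z * cnj h) \<le> (norm (wirtinger f z) + norm (wirtinger_bar f z)) * norm h" for h
      by (metis complex_mod_cnj distrib_right norm_mult norm_triangle_ineq)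
  qed
qed

text \<open>The preimage of a closed disc is its image under the continuous inverse, hence compact
  in the open disc and away from the unit circle.\<close>

lemma disk_homeomorphism_proper:
  fixes w g :: "complex \<Rightarrow> complex"
  assumes hom: "homeomorphism (ball 0 1) (ball 0 1) w g" and "0 < e"
  shows "\<exists>R<1. \<forall>z. R \<le> norm z \<and> norm z < 1 \<longrightarrow> 1 - e \<le> norm (w z)"
proof -
  have sub: "cball 0 (1 - e) \<subseteq> ball (0::complex) 1" using \<open>0 < e\<close> by auto
  have contg: "continuous_on (ball 0 1) g" using hom by (simp add: homeomorphism_def)
  have "compact (g ` cball 0 (1 - e))"
    by (intro compact_continuous_image continuous_on_subset[OF contg sub] compact_cball)
  moreover have gsub: "g ` cball 0 (1 - e) \<subseteq> ball 0 1" using hom sub unfolding homeomorphism_def by blast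
  ultimately have "\<exists>R<1. \<forall>x\<in>g ` cball 0 (1 - e). norm x < R"
  proof (cases "g ` cball 0 (1 - e) = {}")
    case False
    assume "compact (g ` cball 0 (1 - e))"
    then obtain m where m: "m \<in> g ` cball 0 (1 - e)" "\<And>x. x \<in> g ` cball 0 (1 - e) \<Longrightarrow> norm x \<le> norm m"
      using continuous_attains_sup[OF _ False, of norm] by (auto intro: continuous_intros)
    have "norm m < 1" using m(1) gsub by auto
    then show ?thesis using m(2) by (intro exI[of _ "(1 + norm m) / 2"]) force
  \<comment> \<open>The disc is empty when e > 1.\<close>
  qed (auto intro!: exI[of _ 0])
  then obtain R where R: "R < 1" "\<And>y. y \<in> cball 0 (1 - e) \<Longrightarrow> norm (g y) < R" by blast
  have "1 - e \<le> norm (w z)" if z: "R \<le> norm z" "norm z < 1" for z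
  proof (rule ccontr)
    assume "\<not> 1 - e \<le> norm (w z)"
    then have "norm (g (w z)) < R" by (intro R(2)) simp
    moreover have "g (w z) = z" using hom z by (auto simp: homeomorphism_def)
    ultimately show False using z by simp
  qed
  then show ?thesis using R(1) by blast
qed

theorem theorem1p3:
  fixes w :: "complex \<Rightarrow> complex" and K B :: real
  assumes "K \<ge> 1" and "B \<ge> 0"
    and "C2_quasiconformal_on K w (ball 0 1)"
    and "w ` ball 0 1 = ball 0 1"
    and "\<And>z. z \<in> ball 0 1 \<Longrightarrow> norm (laplacian w z) \<le> B * (grad_norm w z)\<^sup>2"
  shows "\<exists>q>0. \<exists>Q>0. \<forall>z1\<in>ball 0 1. \<forall>z2\<in>ball 0 1.
           q * norm (z1 - z2) \<le> norm (w z1 - w z2) \<and>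
           norm (w z1 - w z2) \<le> Q * norm (z1 - z2)"
proof -
  have C2: "C2_map_on w (ball 0 1)" and orient: "orientation_preserving_on w (ball 0 1)"
    and qc: "\<And>z. z \<in> ball 0 1 \<Longrightarrow> norm (wirtinger_bar w z) \<le> (K - 1) / (K + 1) * norm (wirtinger w z)"
    using assms(3) by (auto simp: C2_quasiconformal_on_def)
  obtain g where hom: "homeomorphism (ball 0 1) (ball 0 1) w g"
    using assms(3,4) by (auto simp: C2_quasiconformal_on_def)
  have k: "0 \<le> (K - 1) / (K + 1)" "(K - 1) / (K + 1) < 1" using assms(1) by auto
  have diff: "w differentiable at z" if "z \<in> ball 0 1" for z
    using C2 that by (auto simp: C2_map_on_def C1_map_on_def)
  note C = C2_wirtinger[OF C2 open_ball]
  interpret disk_qc w "wirtinger w" "wirtinger_bar w" "wirtinger (wirtinger w)" "wirtinger_bar (wirtinger w)"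
    "wirtinger (wirtinger_bar w)" "wirtinger_bar (wirtinger_bar w)" "(K - 1) / (K + 1)" B
  proof
    fix z :: complex assume z: "z \<in> ball 0 1"
    \<comment> \<open>The dilatation bound gives |\<nabla>w| \<le> 2|f|. The 4 from its square
      cancels the 4 in the Laplacian, so the locale constant \<open>b\<close> is \<open>B\<close>
      itself.\<close>
    have "(K - 1) / (K + 1) * norm (wirtinger w z) \<le> 1 * norm (wirtinger w z)"
      using k by (intro mult_right_mono) auto
    then have "grad_norm w z \<le> 2 * norm (wirtinger w z)"
      using grad_norm_le[OF diff[OF z]] qc[OF z] by simp
    moreover have "0 \<le> grad_norm w z"
      unfolding grad_norm_def
      using has_derivative_bounded_linear[OF diff[OF z, unfolded frechet_derivative_works]] by (rule onorm_pos_le)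
    ultimately have "(grad_norm w z)\<^sup>2 \<le> (2 * norm (wirtinger w z))\<^sup>2" by (intro power_mono)
    then have "B * (grad_norm w z)\<^sup>2 \<le> B * (2 * norm (wirtinger w z))\<^sup>2"
      using assms(2) by (intro mult_left_mono) auto
    then show "norm (wirtinger_bar (wirtinger w) z) \<le> B * (norm (wirtinger w z))\<^sup>2"
      using assms(5)[OF z] by (simp add: laplacian_def norm_mult power_mult_distrib)
    show "has_wirtinger (wirtinger_bar w) (wirtinger (wirtinger_bar w) z) (wirtinger_bar (wirtinger_bar w) z) z"
      by (rule has_wirtinger_frechet[OF C(2)[OF z]])
    have "w z \<in> ball 0 1" using assms(4) z by blast
    then show "norm (w z) < 1" by simp
  qed (use k assms(2) C qc diff disk_homeomorphism_proper[OF hom] in \<open>auto intro: has_wirtinger_frechet\<close>)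
  show ?thesis
    by (rule bi_lipschitz[OF hom]) (use orient in \<open>auto simp: orientation_preserving_on_def\<close>)
qed

end
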